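(* For $n \ge 1$ let $\ell_n$ be the number of labelled interval orders on $[n]=\{1,2,\dots,n\}$. Then there are real constants $E_0, E_1, E_2, \dots$ such that, as $n\to\infty$, \[ \ell_n \sim (n!)^2 \sqrt{n} \left(\frac{6}{\pi^2}\right)^n \left( E_0 + \frac{E_1}{n} + \frac{E_2}{n^2} + \cdots \right) \] in the sense of an asymptotic expansion, that is, for every integer $m\ge 0$, \[ \ell_n = (n!)^2 \sqrt{n} \left(\frac{6}{\pi^2}\right)^n \left( \sum_{i=0}^{m} \frac{E_i}{n^i} + O\!\left(n^{-m-1}\right) \right) \quad (n\to\infty), \] where \[ E_0 = \frac{12\sqrt{3}}{\pi^{5/2}} \] and the other $E_i$ are explicitly computable.
   Context: An interval order is a (finite, strict) partially ordered set $P=(X,<)$ for which one can assign to each $x\in X$ a closed real interval $[a_x,b_x]$ (with $a_x\le b_x$) such that $x<y$ in $P$ if and only if $b_x<a_y$. A labelled interval order on $[n]$ is a strict partial order on the ground set $[n]=\{1,\dots,n\}$ that is an interval order; two labelled interval orders are counted as different whenever they differ as relations on $[n]$ (isomorphic ones are not identified). "Explicitly computable" means that there is an explicit effective procedure which, given $i$, determines the constant $E_i$. *)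

theory Defs
  imports Complex_Main "HOL-Library.Landau_Symbols"
begin

definition strict_order_on :: "'a set \<Rightarrow> ('a \<times> 'a) set \<Rightarrow> bool" where
  "strict_order_on X r \<longleftrightarrow> r \<subseteq> X \<times> X \<and> irrefl r \<and> trans r"

definition interval_order_on :: "'a set \<Rightarrow> ('a \<times> 'a) set \<Rightarrow> bool" where
  "interval_order_on X r \<longleftrightarrow>
     finite X \<and> strict_order_on X r \<and>
     (\<exists>a b :: 'a \<Rightarrow> real.
        (\<forall>x\<in>X. a x \<le> b x) \<and>
        (\<forall>x\<in>X. \<forall>y\<in>X. (x, y) \<in> r \<longleftrightarrow> b x < a y))"

definition num_labelled_interval_orders :: "nat \<Rightarrow> nat" where
  "num_labelled_interval_orders n = card {r :: (nat \<times> nat) set. interval_order_on {1..n} r}"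

(* The set counted above is finite, so card returns its genuine cardinality. *)
lemma finite_interval_orders: "finite {r. interval_order_on {1..n::nat} r}"
  by (rule finite_subset[of _ "Pow ({1..n} \<times> {1..n})"])
    (auto simp: interval_order_on_def strict_order_on_def)

(* total_recursive k f: f, restricted to argument lists of length k, is a total
   mu-recursive function of k arguments.  The values of f on lists of any other length are
   irrelevant.  Minimization is only applied to regular functions, which yields exactly
   the total computable functions. *)
inductive total_recursive :: "nat \<Rightarrow> (nat list \<Rightarrow> nat) \<Rightarrow> bool" where
  Zero: "total_recursive k (\<lambda>xs. 0)"
| Succ: "total_recursive 1 (\<lambda>xs. Suc (hd xs))"
| Proj: "i < k \<Longrightarrow> total_recursive k (\<lambda>xs. xs ! i)"
| Comp: "total_recursive (length gs) f \<Longrightarrow> (\<And>g. g \<in> set gs \<Longrightarrow> total_recursive k g)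
    \<Longrightarrow> total_recursive k (\<lambda>xs. f (map (\<lambda>g. g xs) gs))"
| Prim: "total_recursive k f \<Longrightarrow> total_recursive (k + 2) g
    \<Longrightarrow> total_recursive (k + 1) (\<lambda>xs. rec_nat (f (tl xs)) (\<lambda>n v. g (n # v # tl xs)) (hd xs))"
| Minim: "total_recursive (k + 1) f \<Longrightarrow> (\<And>xs. length xs = k \<Longrightarrow> \<exists>n. f (n # xs) = 0)
    \<Longrightarrow> total_recursive k (\<lambda>xs. LEAST n. f (n # xs) = 0)"

(* A sequence of reals is computable if a single algorithm, given i and k, returns a rational
   number within 2^(-k) of the i-th term.  The rational is presented as (p - q) / (d + 1)
   with natural numbers p, q, d.  In particular the procedure is uniform in i. *)
definition computable_real_seq :: "(nat \<Rightarrow> real) \<Rightarrow> bool" where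
  "computable_real_seq E \<longleftrightarrow>
     (\<exists>p q d. total_recursive 2 p \<and> total_recursive 2 q \<and> total_recursive 2 d \<and>
        (\<forall>i k. \<bar>E i - (real (p [i, k]) - real (q [i, k])) / (real (d [i, k]) + 1)\<bar> \<le> 1 / 2 ^ k))"

end

theory Submission
  imports Defs "HOL-Complex_Analysis.Complex_Analysis" "HOL-Real_Asymp.Real_Asymp"
    "HOL-Library.Discrete_Functions"
begin

text \<open>
  Choosing the endpoints of the intervals minimally, a labelled interval order is the same thing as a
  number \<open>m\<close> and a pair of surjections \<open>a \<le> b\<close> onto \<open>{..<m}\<close>. Inclusion-exclusion over the
  values of both and a one-step recursion on \<open>m\<close> give the exponential generating function
  \<open>\<Sum>k. \<Prod>i=1..k. 1 - exp (- i t)\<close>.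

  Zagier evaluates this series through \<open>S(x) = \<Sum>n. (x)\<^bsub>n+1\<^esub> x\<^sup>n\<close> with \<open>(x)\<^sub>n = \<Prod>i<n. 1 - q\<^sup>i x\<close>, which
  satisfies \<open>S(x) + q\<^sup>2 x\<^sup>3 S(q x) = 1 - q x\<^sup>2\<close>. For \<open>q = exp (- t)\<close> and \<open>x = exp (- z t)\<close> the
  equation makes sense for formal power series in \<open>t\<close> whose coefficients are polynomials in \<open>z\<close>, where
  its solution is unique. A second solution is \<open>L\<^sub>c (exp ((1/24 + z/2 + c z - c\<^sup>2/6) t))\<close>, where the linear
  functional \<open>L\<^sub>c\<close> sends \<open>exp (c u)\<close> to \<open>sinh u / cosh (3u/2)\<close>. Comparing the \<open>z\<close>-derivatives at
  \<open>0\<close> expresses the counts by the Taylor coefficients of \<open>sinh u / cosh (3u/2)\<close>, whose asymptotics are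
  determined by the poles at \<open>u = \<plusminus> i pi / 3\<close> up to an exponentially small error.

  The resulting main term satisfies a three-term linear recurrence, which has a unique formal solution in
  powers of \<open>1/n\<close> with constant term \<open>1\<close>. A truncated solution has a small defect, and since the main term
  converges, the difference can be bootstrapped to the order of the truncation. The formal solution is
  given by an explicit recursion over \<open>pi\<^sup>2\<close>, hence is computable.
\<close>

unbundle no vec_syntax

section \<open>Interval orders and their minimal representations\<close>

text \<open>The counts grow like \<open>(n!)^2\<close>, so the exponential generating function has
  radius of convergence 0 and its singularities cannot be analysed. Zagier's identity is therefore
  proved formally, modulo \<open>t^(N+1)\<close>, and analysis enters only through the moments,
  which belong to a meromorphic function. The term \<open>- c^2/6\<close> is forced: completing the
  square, \<open>c \<mapsto> c - 3\<close> turns the exponent for \<open>z\<close> into the one for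
  \<open>z + 1\<close> plus \<open>- 3 z - 3/2\<close>, and the functional satisfies
  \<open>L(p(c)) + L(p(c - 3)) = p(-1/2) - p(-5/2)\<close>. At these two nodes the full exponent is
  \<open>0\<close> and \<open>- 2 z - 1\<close>, which is where \<open>1 - q x^2\<close> comes from.
  Polynomial dependence on \<open>z\<close> excludes antiperiodic homogeneous solutions such as
  \<open>exp (i pi z)\<close>. The coefficients are defined by course-of-values recursion on real
  numbers, whereas recursive functions handle naturals and reach reals only up to a prescribed
  precision. The recursion is therefore unrolled into finite sums and products, under which
  computable reals are closed uniformly in the parameters.\<close>

definition endpoint_rel :: "'a set \<Rightarrow> ('a \<Rightarrow> nat \<times> nat) \<Rightarrow> ('a \<times> 'a) set" where
  "endpoint_rel X f = {(x, y) \<in> X \<times> X. snd (f x) < fst (f y)}"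

text \<open>Letting both coordinates take every value below \<open>m\<close> leaves no two
  neighbouring values that could be merged, so the order determines the map. Extensionality
  identifies maps that agree on \<open>X\<close>, so that cardinalities count representations
  once.\<close>

definition tight_reps :: "'a set \<Rightarrow> nat \<Rightarrow> ('a \<Rightarrow> nat \<times> nat) set" where
  "tight_reps X m = {f \<in> X \<rightarrow>\<^sub>E {(i, j). i \<le> j \<and> j < m}.
     (fst \<circ> f) ` X = {..<m} \<and> (snd \<circ> f) ` X = {..<m}}"

lemma tight_reps_le:
  assumes "f \<in> tight_reps X m" "x \<in> X"
  shows "fst (f x) \<le> snd (f x)" "snd (f x) < m"
proof -
  have "f x \<in> {(i, j). i \<le> j \<and> j < m}"
    using assms by (intro PiE_mem[of f X "\<lambda>_. {(i, j). i \<le> j \<and> j < m}"]) (simp_all add: tight_reps_def)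
  then show "fst (f x) \<le> snd (f x)" "snd (f x) < m"
    by (auto simp: case_prod_unfold)
qed

lemma tight_reps_fst:
  assumes "f \<in> tight_reps X m" "i < m"
  shows "\<exists>x\<in>X. fst (f x) = i"
proof -
  have "i \<in> (fst \<circ> f) ` X" using assms by (simp add: tight_reps_def)
  then show ?thesis by auto
qed

lemma tight_reps_snd:
  assumes "f \<in> tight_reps X m" "i < m"
  shows "\<exists>x\<in>X. snd (f x) = i"
proof -
  have "i \<in> (snd \<circ> f) ` X" using assms by (simp add: tight_reps_def)
  then show ?thesis by auto
qed

lemma interval_order_endpoint_rel:
  assumes "finite X" "f \<in> tight_reps X m"
  shows "interval_order_on X (endpoint_rel X f)"
proof -
  note le = tight_reps_le[OF assms(2)]
  have "irrefl (endpoint_rel X f)"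
    using le(1) by (force simp: irrefl_def endpoint_rel_def not_less)
  moreover have "trans (endpoint_rel X f)"
  proof (rule transI)
    fix x y z assume "(x, y) \<in> endpoint_rel X f" "(y, z) \<in> endpoint_rel X f"
    then show "(x, z) \<in> endpoint_rel X f"
      using le(1)[of y] by (simp add: endpoint_rel_def)
  qed
  ultimately have "strict_order_on X (endpoint_rel X f)"
    by (auto simp: strict_order_on_def endpoint_rel_def)
  moreover have "\<exists>a b :: 'a \<Rightarrow> real. (\<forall>x\<in>X. a x \<le> b x) \<and>
        (\<forall>x\<in>X. \<forall>y\<in>X. (x, y) \<in> endpoint_rel X f \<longleftrightarrow> b x < a y)"
    by (rule exI[of _ "\<lambda>x. real (fst (f x))"], rule exI[of _ "\<lambda>x. real (snd (f x))"])
      (auto simp: endpoint_rel_def le)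
  ultimately show ?thesis
    using assms(1) by (auto simp: interval_order_on_def)
qed

text \<open>The endpoints of a tight representation are determined by the order: the left endpoint
  of \<open>x\<close> counts the distinct down-sets strictly below that of \<open>x\<close>, and the right endpoint is
  the largest left endpoint among the elements not above \<open>x\<close>.\<close>

definition down_rank :: "'a set \<Rightarrow> ('a \<times> 'a) set \<Rightarrow> 'a \<Rightarrow> nat" where
  "down_rank X r x = card {S \<in> (\<lambda>z. r\<inverse> `` {z}) ` X. S \<subset> r\<inverse> `` {x}}"

text \<open>The down-set of an element depends only on its left endpoint \<open>i\<close>, say
  \<open>D i\<close>. It grows strictly with \<open>i\<close> because every value is a right
  endpoint, and each \<open>D i\<close> occurs because every value is a left endpoint. Hence exactly
  \<open>i\<close> down-sets lie strictly below \<open>D i\<close>.\<close>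

lemma fst_tight_rep:
  assumes f: "f \<in> tight_reps X m" and x: "x \<in> X"
  shows "fst (f x) = down_rank X (endpoint_rel X f) x"
proof -
  define D where "D = (\<lambda>i. {y \<in> X. snd (f y) < i})"
  have D: "(endpoint_rel X f)\<inverse> `` {z} = D (fst (f z))" if "z \<in> X" for z
    using that by (auto simp: endpoint_rel_def D_def)
  have less: "D i \<subset> D j \<longleftrightarrow> i < j" if "i < m" "j < m" for i j
  proof
    assume "i < j"
    moreover obtain y where "y \<in> X" "snd (f y) = i"
      using tight_reps_snd[OF f \<open>i < m\<close>] by blast
    ultimately show "D i \<subset> D j"
      by (auto simp: D_def)
  next
    assume "D i \<subset> D j"
    then show "i < j"
      by (auto simp: D_def not_le[symmetric])
  qed
  have lt: "fst (f z) < m" if "z \<in> X" for z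
    using tight_reps_le[OF f that] by simp
  have inj: "inj_on D {..<m}"
    by (rule linorder_inj_onI') (use less in blast)
  have "{S \<in> (\<lambda>z. (endpoint_rel X f)\<inverse> `` {z}) ` X. S \<subset> (endpoint_rel X f)\<inverse> `` {x}}
      = D ` {..<fst (f x)}" (is "?L = ?R")
  proof
    show "?L \<subseteq> ?R"
    proof
      fix S assume "S \<in> ?L"
      then obtain z where z: "z \<in> X" "S = D (fst (f z))" "D (fst (f z)) \<subset> D (fst (f x))"
        using x by (auto simp: D)
      then have "fst (f z) < fst (f x)" using less lt x by blast
      then show "S \<in> ?R" using z by blast
    qed
    show "?R \<subseteq> ?L"
    proof
      fix S assume "S \<in> ?R"
      then obtain i where i: "i < fst (f x)" "S = D i" by auto
      then obtain z where "z \<in> X" "fst (f z) = i"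
        using tight_reps_fst[OF f, of i] lt[OF x] by auto
      then show "S \<in> ?L"
        using i less[of i "fst (f x)"] lt[OF x] x D by (auto simp: image_iff intro!: bexI[of _ z])
    qed
  qed
  moreover have "card (D ` {..<fst (f x)}) = fst (f x)"
    using lt[OF x] by (subst card_image) (auto intro: inj_on_subset[OF inj])
  ultimately show ?thesis
    by (simp add: down_rank_def)
qed

text \<open>Every value is a left endpoint, so the left endpoints of the elements not above
  \<open>x\<close> fill the whole initial segment up to \<open>snd (f x)\<close>.\<close>

lemma snd_tight_rep:
  assumes f: "f \<in> tight_reps X m" and x: "x \<in> X"
  shows "snd (f x) = Max {fst (f y) |y. y \<in> X \<and> (x, y) \<notin> endpoint_rel X f}"
proof -
  have "{fst (f y) |y. y \<in> X \<and> (x, y) \<notin> endpoint_rel X f} = {..snd (f x)}"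
    using x tight_reps_fst[OF f] tight_reps_le[OF f x]
    by (auto simp: endpoint_rel_def) (metis le_less_trans not_le)
  then show ?thesis by (auto intro!: Max_eqI[symmetric])
qed

lemma tight_rep_unique:
  assumes f: "f \<in> tight_reps X m" and g: "g \<in> tight_reps X m'"
    and eq: "endpoint_rel X f = endpoint_rel X g"
  shows "m = m'" "f = g"
proof -
  have 1: "fst (f x) = fst (g x)" if "x \<in> X" for x
    using fst_tight_rep[OF f that] fst_tight_rep[OF g that] eq by simp
  have 2: "snd (f x) = snd (g x)" if "x \<in> X" for x
  proof -
    have "{fst (f y) |y. y \<in> X \<and> (x, y) \<notin> endpoint_rel X f}
        = {fst (g y) |y. y \<in> X \<and> (x, y) \<notin> endpoint_rel X g}"
      using 1 eq by auto metis
    then show ?thesis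
      using snd_tight_rep[OF f that] snd_tight_rep[OF g that] by simp
  qed
  have "{..<m} = {..<m'}"
    using f g 1 unfolding tight_reps_def by (auto simp: image_iff set_eq_iff)
  then show "m = m'" by simp
  have "f \<in> extensional X" "g \<in> extensional X"
    using f g by (auto simp: tight_reps_def PiE_def)
  then show "f = g"
    by (rule extensionalityI) (simp add: prod_eq_iff 1 2)
qed

text \<open>The real left endpoints are used only to see that the down-sets form a chain. The rank
  of a down-set in this chain is the new left endpoint \<open>l\<close>, and \<open>u x\<close> is
  the largest \<open>l\<close> among the elements not above \<open>x\<close>.\<close>

lemma ex_tight_rep:
  assumes "interval_order_on X r"
  shows "\<exists>m. \<exists>f\<in>tight_reps X m. endpoint_rel X f = r"
proof -
  from assms obtain a b :: "'a \<Rightarrow> real" where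
    fin: "finite X" and so: "strict_order_on X r" and
    rep: "\<And>x y. x \<in> X \<Longrightarrow> y \<in> X \<Longrightarrow> (x, y) \<in> r \<longleftrightarrow> b x < a y"
    unfolding interval_order_on_def by blast
  have sub: "r \<subseteq> X \<times> X" and irr: "\<And>x. (x, x) \<notin> r"
    using so by (auto simp: strict_order_on_def irrefl_def)
  define D where "D = (\<lambda>x. r\<inverse> `` {x})"
  have D: "y \<in> D x \<longleftrightarrow> (y, x) \<in> r" for x y by (simp add: D_def)
  have chain: "D x \<subseteq> D y \<or> D y \<subseteq> D x" if "x \<in> X" "y \<in> X" for x y
  proof (cases "a x \<le> a y")
    case True
    then have "D x \<subseteq> D y" using rep that sub by (force simp: D_def)
    then show ?thesis ..
  next
    case False
    then have "D y \<subseteq> D x" using rep that sub by (force simp: D_def)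
    then show ?thesis ..
  qed
  define m where "m = card (D ` X)"
  define g where "g = (\<lambda>S. card {T \<in> D ` X. T \<subset> S})"
  have g_less: "g S < g T" if "S \<subset> T" "S \<in> D ` X" for S T
    unfolding g_def by (rule psubset_card_mono) (use that fin in auto)
  have inj_g: "inj_on g (D ` X)"
  proof (rule inj_onI)
    fix S T assume "S \<in> D ` X" "T \<in> D ` X" "g S = g T"
    then show "S = T"
      using g_less[of S T] g_less[of T S] chain by (metis imageE less_irrefl psubsetI)
  qed
  have "g ` D ` X \<subseteq> {..<m}"
  proof clarify
    fix x assume "x \<in> X"
    then show "g (D x) < m"
      unfolding g_def m_def by (intro psubset_card_mono) (use fin in auto)
  qed
  then have g_img: "g ` D ` X = {..<m}"
    by (rule card_subset_eq[OF finite_lessThan]) (simp add: card_image[OF inj_g] m_def)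
  define l where "l = (\<lambda>x. g (D x))"
  have l_img: "l ` X = {..<m}" using g_img by (simp add: l_def image_image)
  have l_less: "l x < l y \<longleftrightarrow> D x \<subset> D y" if "x \<in> X" "y \<in> X" for x y
    using that chain[of x y] g_less[of "D x" "D y"] g_less[of "D y" "D x"]
    unfolding l_def by (metis imageI less_imp_neq not_less_iff_gr_or_eq psubsetI)
  define u where "u = (\<lambda>x. Max (l ` {y \<in> X. (x, y) \<notin> r}))"
  have u_ge: "l y \<le> u x" if "y \<in> X" "(x, y) \<notin> r" for x y
    unfolding u_def using that fin by (intro Max_ge) auto
  have u_ex: "\<exists>y\<in>X. (x, y) \<notin> r \<and> u x = l y" if "x \<in> X" for x
  proof -
    have "u x \<in> l ` {y \<in> X. (x, y) \<notin> r}"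
      unfolding u_def using that fin irr by (intro Max_in) auto
    then show ?thesis by auto
  qed
  have rel: "(x, y) \<in> r \<longleftrightarrow> u x < l y" if x: "x \<in> X" and y: "y \<in> X" for x y
  proof
    assume xy: "(x, y) \<in> r"
    obtain z where z: "z \<in> X" "(x, z) \<notin> r" "u x = l z" using u_ex[OF x] by blast
    have "\<not> D y \<subseteq> D z" using xy z D by blast
    then have "D z \<subset> D y" using chain[of y z] y z by blast
    then show "u x < l y" using l_less[of z y] y z by simp
  next
    assume "u x < l y"
    then show "(x, y) \<in> r" using u_ge[OF y, of x] by linarith
  qed
  have u_less: "u x < m" if "x \<in> X" for x
    using u_ex[OF that] l_img by auto
  have u_img: "u ` X = {..<m}"
  proof
    show "{..<m} \<subseteq> u ` X"
    proof
      fix i assume i: "i \<in> {..<m}"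
      show "i \<in> u ` X"
      proof (cases "Suc i < m")
        case True
        \<comment> \<open>An element in the difference of two consecutive down-sets has right
          endpoint exactly \<open>i\<close>: it is not below \<open>x\<close>, and it is below
          \<open>y\<close>.\<close>
        obtain x y where xy: "x \<in> X" "l x = i" "y \<in> X" "l y = Suc i"
          using l_img i True by (metis imageE lessThan_iff)
        then have "D x \<subset> D y" using l_less[of x y] by simp
        then obtain z where z: "(z, y) \<in> r" "(z, x) \<notin> r" "z \<in> X" using D sub by blast
        have "i \<le> u z" "u z < Suc i"
          using u_ge[OF xy(1) z(2)] rel[of z y] z xy by auto
        then show ?thesis using z by (auto simp: image_iff intro!: bexI[of _ z])
      next
        case False
        \<comment> \<open>Here \<open>i = m - 1\<close> is the top rank, and irreflexivity already
          forces \<open>u x \<ge> i\<close>.\<close>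
        obtain x where x: "x \<in> X" "l x = i" using l_img i by (metis imageE)
        have "i \<le> u x" using u_ge[OF x(1) irr] x by simp
        then have "u x = i" using u_less[OF x(1)] False by simp
        then show ?thesis using x by auto
      qed
    qed
  qed (use u_less in auto)
  define f where "f = restrict (\<lambda>x. (l x, u x)) X"
  have "f \<in> tight_reps X m"
    using u_less u_ge[OF _ irr] l_img u_img
    by (auto simp: tight_reps_def f_def image_comp[symmetric] image_image)
  moreover have "endpoint_rel X f = r"
    using rel sub by (auto simp: endpoint_rel_def f_def)
  ultimately show ?thesis by blast
qed

lemma finite_tight_reps: "finite X \<Longrightarrow> finite (tight_reps X m)"
proof -
  assume "finite X"
  have "finite {(i, j). i \<le> j \<and> j < m}"
    by (rule finite_subset[of _ "{..m} \<times> {..m}"]) auto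
  then show ?thesis
    unfolding tight_reps_def using \<open>finite X\<close> by (auto intro!: finite_PiE)
qed

lemma tight_reps_empty:
  assumes "finite X" "card X < m"
  shows "tight_reps X m = {}"
proof (rule ccontr)
  assume "tight_reps X m \<noteq> {}"
  then obtain f :: "'a \<Rightarrow> nat \<times> nat" where "(fst \<circ> f) ` X = {..<m}"
    unfolding tight_reps_def by blast
  then show False
    using card_image_le[OF assms(1), of "fst \<circ> f"] assms by simp
qed

text \<open>Uniqueness of tight representations makes the union over \<open>m\<close> disjoint and
  the map to orders injective; \<open>m > n\<close> is impossible since \<open>n\<close> elements
  cannot have more than \<open>n\<close> left endpoints.\<close>

lemma num_labelled_interval_orders_eq_sum:
  "num_labelled_interval_orders n = (\<Sum>m\<le>n. card (tight_reps {1..n} m))"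
proof -
  let ?X = "{1..n}"
  have "{r. interval_order_on ?X r} = (\<Union>m\<le>n. endpoint_rel ?X ` tight_reps ?X m)" (is "?L = ?R")
  proof
    show "?L \<subseteq> ?R"
    proof
      fix r assume "r \<in> ?L"
      then obtain m f where f: "f \<in> tight_reps ?X m" "endpoint_rel ?X f = r"
        using ex_tight_rep by blast
      then have "m \<le> n" using tight_reps_empty[of ?X m] by force
      then show "r \<in> ?R" using f by blast
    qed
  qed (auto intro: interval_order_endpoint_rel)
  moreover have "card ?R = (\<Sum>m\<le>n. card (endpoint_rel ?X ` tight_reps ?X m))"
    by (rule card_UN_disjoint) (auto intro: finite_tight_reps dest: tight_rep_unique)
  moreover have "card (endpoint_rel ?X ` tight_reps ?X m) = card (tight_reps ?X m)" for m
    by (rule card_image) (auto intro!: inj_onI dest: tight_rep_unique)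
  ultimately show ?thesis by (simp add: num_labelled_interval_orders_def)
qed

section \<open>Inclusion-exclusion over the allowed endpoint values\<close>

lemma alternating_sum_supersets:
  assumes "finite M" "A \<subseteq> M"
  shows "(\<Sum>S | S \<subseteq> M \<and> A \<subseteq> S. (-1) ^ (card M - card S)) = (if A = M then 1 else 0 :: 'a :: comm_ring_1)"
proof -
  have fin: "finite (M - A)" using assms by simp
  have "(\<Sum>S | S \<subseteq> M \<and> A \<subseteq> S. (-1 :: 'a) ^ (card M - card S))
      = (\<Sum>B\<in>Pow (M - A). (-1) ^ card (M - A - B))"
  proof (rule sum.reindex_bij_witness[of _ "\<lambda>B. A \<union> B" "\<lambda>S. S - A"])
    fix S assume S: "S \<in> {S. S \<subseteq> M \<and> A \<subseteq> S}"
    then have "M - A - (S - A) = M - S" by auto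
    then show "(-1 :: 'a) ^ card (M - A - (S - A)) = (-1) ^ (card M - card S)"
      using S assms by (metis card_Diff_subset finite_subset mem_Collect_eq)
  qed (use assms in auto)
  \<comment> \<open>The signed sum is the expansion of a product of factors \<open>1 + (-1)\<close>,
    which vanishes unless the index set is empty.\<close>
  also have "\<dots> = (\<Prod>x\<in>M - A. 1 + (-1))"
    using prod_add[OF fin, of "\<lambda>_. 1 :: 'a" "\<lambda>_. -1"] by simp
  also have "\<dots> = (if A = M then 1 else 0)"
    using assms by (auto simp: power_0_left card_gt_0_iff fin)
  finally show ?thesis .
qed

text \<open>Each of the two surjectivity conditions becomes a signed sum over sets \<open>S\<close>
  and \<open>T\<close> of permitted values. For fixed \<open>S\<close> and \<open>T\<close> the
  elements of \<open>X\<close> choose independently among the permitted pairs, hence the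
  power.\<close>

lemma card_tight_reps:
  assumes "finite X"
  shows "(of_nat (card (tight_reps X m)) :: 'a :: comm_ring_1)
    = (\<Sum>S\<in>Pow {..<m}. \<Sum>T\<in>Pow {..<m}. (-1) ^ (m - card S) * (-1) ^ (m - card T) *
        of_nat (card {(i, j) \<in> S \<times> T. i \<le> j} ^ card X))"
proof -
  let ?C = "{(i, j). i \<le> j \<and> j < m}" and ?P = "Pow {..<m}"
  have finC: "finite ?C"
    by (rule finite_subset[of _ "{..m} \<times> {..m}"]) auto
  have finF: "finite (X \<rightarrow>\<^sub>E ?C)" by (rule finite_PiE[OF assms finC])
  define s :: "nat set \<Rightarrow> 'a" where "s S = (-1) ^ (m - card S)" for S
  have surj: "(\<Sum>S\<in>?P. s S * (if A \<subseteq> S then 1 else 0)) = (if A = {..<m} then 1 else 0)"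
    if "A \<subseteq> {..<m}" for A
  proof -
    have "(\<Sum>S\<in>?P. s S * (if A \<subseteq> S then 1 else 0)) = (\<Sum>S | S \<subseteq> {..<m} \<and> A \<subseteq> S. s S)"
      by (intro sum.mono_neutral_cong_right) auto
    then show ?thesis
      using alternating_sum_supersets[OF _ that] by (simp add: s_def)
  qed
  have ind: "(\<Sum>f\<in>X \<rightarrow>\<^sub>E ?C. (if (fst \<circ> f) ` X \<subseteq> S then 1 else 0) * (if (snd \<circ> f) ` X \<subseteq> T then 1 else 0))
      = (of_nat (card {(i, j) \<in> S \<times> T. i \<le> j} ^ card X) :: 'a)" (is "?sum = _")
    if "S \<in> ?P" "T \<in> ?P" for S T
  proof -
    have "?sum = (\<Sum>f\<in>X \<rightarrow>\<^sub>E ?C. if f \<in> X \<rightarrow>\<^sub>E {(i, j) \<in> S \<times> T. i \<le> j} then 1 else 0)"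
    proof (rule sum.cong[OF refl])
      fix f assume f: "f \<in> X \<rightarrow>\<^sub>E ?C"
      have "f \<in> X \<rightarrow>\<^sub>E {(i, j) \<in> S \<times> T. i \<le> j}
          \<longleftrightarrow> (fst \<circ> f) ` X \<subseteq> S \<and> (snd \<circ> f) ` X \<subseteq> T"
        using f unfolding PiE_iff image_subset_iff by (auto simp: case_prod_unfold mem_Times_iff)
      then show "(if (fst \<circ> f) ` X \<subseteq> S then 1 else 0) * (if (snd \<circ> f) ` X \<subseteq> T then 1 else (0::'a)) =
          (if f \<in> X \<rightarrow>\<^sub>E {(i, j) \<in> S \<times> T. i \<le> j} then 1 else 0)"
        by simp
    qed
    also have "\<dots> = (\<Sum>f\<in>X \<rightarrow>\<^sub>E {(i, j) \<in> S \<times> T. i \<le> j}. 1)"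
    proof (rule sum.mono_neutral_cong_right[OF finF])
      show "(X \<rightarrow>\<^sub>E {(i, j) \<in> S \<times> T. i \<le> j}) \<subseteq> X \<rightarrow>\<^sub>E ?C"
        using that by (intro PiE_mono) auto
    qed auto
    also have "\<dots> = of_nat (card {(i, j) \<in> S \<times> T. i \<le> j} ^ card X)"
      by (simp add: card_PiE assms)
    finally show ?thesis .
  qed
  have "(of_nat (card (tight_reps X m)) :: 'a)
      = (\<Sum>f\<in>X \<rightarrow>\<^sub>E ?C. (if (fst \<circ> f) ` X = {..<m} then 1 else 0) * (if (snd \<circ> f) ` X = {..<m} then 1 else 0))"
  proof -
    have "(of_nat (card (tight_reps X m)) :: 'a) = (\<Sum>f\<in>tight_reps X m. 1)"
      by simp
    also have "\<dots> = (\<Sum>f\<in>X \<rightarrow>\<^sub>E ?C. (if (fst \<circ> f) ` X = {..<m} then 1 else 0) *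
        (if (snd \<circ> f) ` X = {..<m} then 1 else 0))"
      unfolding tight_reps_def by (rule sum.mono_neutral_cong_left[OF finF]) auto
    finally show ?thesis .
  qed
  also have "\<dots> = (\<Sum>f\<in>X \<rightarrow>\<^sub>E ?C. (\<Sum>S\<in>?P. s S * (if (fst \<circ> f) ` X \<subseteq> S then 1 else 0)) *
      (\<Sum>T\<in>?P. s T * (if (snd \<circ> f) ` X \<subseteq> T then 1 else 0)))"
  proof (rule sum.cong[OF refl])
    fix f assume f: "f \<in> X \<rightarrow>\<^sub>E ?C"
    then have "\<And>x. x \<in> X \<Longrightarrow> fst (f x) \<le> snd (f x) \<and> snd (f x) < m"
      by (auto simp: PiE_iff case_prod_unfold)
    then have "(fst \<circ> f) ` X \<subseteq> {..<m}" "(snd \<circ> f) ` X \<subseteq> {..<m}"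
      by (auto intro: le_less_trans)
    then show "(if (fst \<circ> f) ` X = {..<m} then 1 else 0) * (if (snd \<circ> f) ` X = {..<m} then 1 else 0)
      = (\<Sum>S\<in>?P. s S * (if (fst \<circ> f) ` X \<subseteq> S then 1 else 0)) *
      (\<Sum>T\<in>?P. s T * (if (snd \<circ> f) ` X \<subseteq> T then 1 else 0))"
      by (simp only: surj)
  qed
  also have "\<dots> = (\<Sum>f\<in>X \<rightarrow>\<^sub>E ?C. \<Sum>S\<in>?P. \<Sum>T\<in>?P. s S * s T *
      ((if (fst \<circ> f) ` X \<subseteq> S then 1 else 0) * (if (snd \<circ> f) ` X \<subseteq> T then 1 else 0)))"
    unfolding sum_product by (intro sum.cong refl) (simp only: mult_ac)
  also have "\<dots> = (\<Sum>S\<in>?P. \<Sum>T\<in>?P. \<Sum>f\<in>X \<rightarrow>\<^sub>E ?C. s S * s T *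
      ((if (fst \<circ> f) ` X \<subseteq> S then 1 else 0) * (if (snd \<circ> f) ` X \<subseteq> T then 1 else 0)))"
    by (subst sum.swap, rule sum.cong[OF refl], rule sum.swap)
  also have "\<dots> = (\<Sum>S\<in>?P. \<Sum>T\<in>?P. s S * s T * of_nat (card {(i, j) \<in> S \<times> T. i \<le> j} ^ card X))"
  proof (intro sum.cong refl)
    fix S T assume ST: "S \<in> ?P" "T \<in> ?P"
    show "(\<Sum>f\<in>X \<rightarrow>\<^sub>E ?C. s S * s T *
      ((if (fst \<circ> f) ` X \<subseteq> S then 1 else 0) * (if (snd \<circ> f) ` X \<subseteq> T then 1 else 0)))
      = s S * s T * of_nat (card {(i, j) \<in> S \<times> T. i \<le> j} ^ card X)"
      unfolding sum_distrib_left[symmetric] ind[OF ST] ..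
  qed
  finally show ?thesis by (simp add: s_def)
qed

section \<open>The exponential generating function\<close>

definition qfact_fps :: "nat \<Rightarrow> 'a :: field_char_0 fps" where
  "qfact_fps k = (\<Prod>i=1..k. 1 - fps_exp (- of_nat i))"

lemma fps_X_dvd_iff: "fps_X dvd (f :: 'a :: field fps) \<longleftrightarrow> f $ 0 = 0"
proof
  assume "f $ 0 = 0"
  then have "f = fps_X * fps_shift 1 f"
    by (simp add: fps_eq_iff fps_X_mult_nth)
  then show "fps_X dvd f" by (rule dvdI)
qed (auto simp: dvd_def)

lemma fps_X_power_dvd_nth:
  assumes "fps_X ^ Suc N dvd (f :: 'a :: field fps)" "n \<le> N"
  shows "f $ n = 0"
  using assms by (auto simp: dvd_def fps_X_power_mult_nth simp del: power_Suc)

lemma fps_exp_of_nat: "fps_exp (of_nat n :: 'a :: field_char_0) = fps_exp 1 ^ n"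
  by (simp add: fps_exp_power_mult)

lemma card_le_pairs:
  assumes "finite S" "finite (T :: nat set)"
  shows "card {(i, j) \<in> S \<times> T. i \<le> j} = (\<Sum>j\<in>T. card {i \<in> S. i \<le> j})"
proof -
  have "{(i, j) \<in> S \<times> T. i \<le> j} = prod.swap ` (SIGMA j:T. {i \<in> S. i \<le> j})"
    by (auto simp: image_iff)
  then show ?thesis
    using assms by (simp add: card_image)
qed

text \<open>\<open>S\<close> is the set of values allowed for the left endpoints. The left endpoints are made surjective
  by the sign, the right endpoints by subtracting \<open>1\<close> in every factor.\<close>

definition set_weight :: "nat \<Rightarrow> nat set \<Rightarrow> 'a :: field_char_0 fps" where
  "set_weight m S = (-1) ^ (m - card S) * (\<Prod>j<m. fps_exp 1 ^ card {i \<in> S. i \<le> j} - 1)"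

text \<open>Grouping by size permits a recursion in \<open>m\<close>: the factor contributed by a
  new largest value depends on \<open>S\<close> only through its size.\<close>

definition level_weight :: "nat \<Rightarrow> nat \<Rightarrow> 'a :: field_char_0 fps" where
  "level_weight m k = (\<Sum>S | S \<subseteq> {..<m} \<and> card S = k. set_weight m S)"

lemma finite_subsets_card: "finite {S. S \<subseteq> {..<m :: nat} \<and> card S = k}"
  by (rule finite_subset[of _ "Pow {..<m}"]) auto

lemma card_subset_lessThan: "S \<subseteq> {..<m :: nat} \<Longrightarrow> card S \<le> m"
  using card_mono[of "{..<m}" S] by simp

text \<open>A power \<open>c ^ n\<close> is \<open>n!\<close> times a coefficient of
  \<open>exp (c t)\<close>. The number of permitted pairs is additive over the right endpoints in
  \<open>T\<close>, so the signed sum over \<open>T\<close> factors into the product in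
  \<open>set_weight\<close>.\<close>

lemma card_tight_reps_eq_level_weight:
  assumes "finite X"
  shows "(of_nat (card (tight_reps X m)) :: 'a :: field_char_0)
    = fact (card X) * (\<Sum>k\<le>m. level_weight m k) $ card X"
proof -
  let ?n = "card X" and ?P = "Pow {..<m}"
  have inner: "(\<Sum>T\<in>?P. (-1) ^ (m - card S) * ((-1) ^ (m - card T) * fps_exp (of_nat (card {(i, j) \<in> S \<times> T. i \<le> j}))))
      = (set_weight m S :: 'a fps)" if S: "S \<in> ?P" for S
  proof -
    have fin: "finite S" using S finite_subset by auto
    have "(\<Prod>j<m. fps_exp 1 ^ card {i \<in> S. i \<le> j} + (-1))
      = (\<Sum>T\<in>?P. (\<Prod>j\<in>T. fps_exp 1 ^ card {i \<in> S. i \<le> j}) * (\<Prod>j\<in>{..<m} - T. -1 :: 'a fps))"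
      by (rule prod_add) simp
    also have "\<dots> = (\<Sum>T\<in>?P. (-1) ^ (m - card T) * fps_exp (of_nat (card {(i, j) \<in> S \<times> T. i \<le> j})))"
    proof (rule sum.cong[OF refl])
      fix T assume T: "T \<in> ?P"
      then have finT: "finite T" using finite_subset by auto
      have "card ({..<m} - T) = m - card T"
        using T finT by (subst card_Diff_subset) auto
      then show "(\<Prod>j\<in>T. fps_exp 1 ^ card {i \<in> S. i \<le> j}) * (\<Prod>j\<in>{..<m} - T. -1 :: 'a fps)
        = (-1) ^ (m - card T) * fps_exp (of_nat (card {(i, j) \<in> S \<times> T. i \<le> j}))"
        by (simp only: fps_exp_of_nat card_le_pairs[OF fin finT] power_sum prod_constant mult.commute)
    qed
    finally show ?thesis
      by (simp add: set_weight_def sum_distrib_left)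
  qed
  have "(of_nat (card (tight_reps X m)) :: 'a) = fact ?n * (\<Sum>S\<in>?P. \<Sum>T\<in>?P. (-1) ^ (m - card S) *
      ((-1) ^ (m - card T) * fps_exp (of_nat (card {(i, j) \<in> S \<times> T. i \<le> j})))) $ ?n"
  proof -
    have sign: "((-1) ^ a * f) $ n = (-1) ^ a * f $ n" for a n and f :: "'a fps"
      by (cases "even a") auto
    show ?thesis
      by (simp add: card_tight_reps[OF assms] fps_sum_nth sum_distrib_left sign mult_ac)
  qed
  also have "(\<Sum>S\<in>?P. \<Sum>T\<in>?P. (-1) ^ (m - card S) *
      ((-1) ^ (m - card T) * fps_exp (of_nat (card {(i, j) \<in> S \<times> T. i \<le> j}))))
      = (\<Sum>S\<in>?P. set_weight m S :: 'a fps)"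
    by (rule sum.cong[OF refl inner])
  also have "(\<Sum>S\<in>?P. set_weight m S) = (\<Sum>k\<le>m. level_weight m k :: 'a fps)"
    unfolding level_weight_def
    by (subst sum.group[of ?P "{..m}" card, symmetric]) (auto intro: card_subset_lessThan)
  finally show ?thesis .
qed

lemma level_weight_0: "level_weight m 0 = (if m = 0 then 1 else 0)"
proof -
  have "{S. S \<subseteq> {..<m} \<and> card S = 0} = {{}}"
    by (auto dest: finite_subset)
  then show ?thesis
    by (simp add: level_weight_def set_weight_def power_0_left)
qed

lemma level_weight_eq_0: "m < k \<Longrightarrow> level_weight m k = 0"
  unfolding level_weight_def by (rule sum.neutral) (auto dest: card_subset_lessThan)

text \<open>Split according to whether the new value \<open>m\<close> lies in \<open>S\<close>. In
  both cases the new factor is \<open>exp\<close> to the size of \<open>S\<close>, minus 1; the sign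
  changes only if \<open>m\<close> is left out.\<close>

lemma level_weight_Suc:
  "level_weight (Suc m) (Suc k) = (fps_exp 1 ^ Suc k - 1) * (level_weight m k - level_weight m (Suc k))"
proof -
  let ?A = "\<lambda>k. {S. S \<subseteq> {..<m} \<and> card S = k}"
  have split: "{S. S \<subseteq> {..<Suc m} \<and> card S = Suc k} = ?A (Suc k) \<union> insert m ` ?A k" (is "?L = ?R")
  proof
    show "?L \<subseteq> ?R"
    proof
      fix S assume S: "S \<in> ?L"
      have fin: "finite S" using S finite_subset by auto
      show "S \<in> ?R"
      proof (cases "m \<in> S")
        case True
        have "S - {m} \<subseteq> {..<m}" using S by (auto simp: less_Suc_eq)
        then have "S - {m} \<in> ?A k" using S True fin by simp
        then show ?thesis
          using True by (intro UnI2 image_eqI[of _ _ "S - {m}"]) auto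
      next
        case False
        have "S \<subseteq> {..<m}"
        proof
          fix x assume "x \<in> S"
          then show "x \<in> {..<m}" using S False by (cases "x = m") (auto simp: less_Suc_eq)
        qed
        then show ?thesis using S by simp
      qed
    qed
    show "?R \<subseteq> ?L"
    proof -
      have "card (insert m S) = Suc (card S)" if "S \<subseteq> {..<m}" for S
        using that finite_subset[OF that] by (subst card_insert_disjoint) auto
      moreover have "S \<subseteq> {..<Suc m}" if "S \<subseteq> {..<m}" for S
        using that by force
      ultimately show ?thesis by simp blast
    qed
  qed
  have inj: "inj_on (insert m) (?A k)"
  proof (rule inj_onI)
    fix S T assume "S \<in> ?A k" "T \<in> ?A k" "insert m S = insert m T"
    moreover from this have "m \<notin> S" "m \<notin> T" by auto
    ultimately show "S = T" by (simp add: insert_ident)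
  qed
  have last: "card {i \<in> S. i \<le> m} = card S" if "S \<subseteq> {..<Suc m}" for S
    by (rule arg_cong[of _ _ card]) (use that in \<open>auto simp: less_Suc_eq_le\<close>)
  have w1: "set_weight (Suc m) S = - ((fps_exp 1 ^ Suc k - 1) * set_weight m S)" if "S \<in> ?A (Suc k)" for S
  proof -
    have "Suc m - card S = Suc (m - card S)"
      using card_subset_lessThan[of S m] that by (simp add: Suc_diff_le)
    moreover have "card {i \<in> S. i \<le> m} = Suc k"
      using last[of S] that lessThan_subset_iff[of m "Suc m"] by force
    ultimately show ?thesis
      by (simp add: set_weight_def del: power_Suc) simp
  qed
  have w2: "set_weight (Suc m) (insert m S) = (fps_exp 1 ^ Suc k - 1) * set_weight m S" if S: "S \<in> ?A k" for S
  proof -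
    have "card (insert m S) = Suc k"
      using S finite_subset[of S "{..<m}"] by (subst card_insert_disjoint) auto
    moreover have "card {i \<in> insert m S. i \<le> m} = card (insert m S)"
      by (rule last) (use S in auto)
    moreover have "{i \<in> insert m S. i \<le> j} = {i \<in> S. i \<le> j}" if "j < m" for j
      using that by auto
    ultimately show ?thesis
      using S by (simp add: set_weight_def del: power_Suc)
  qed
  have "level_weight (Suc m) (Suc k) = (\<Sum>S\<in>?A (Suc k). set_weight (Suc m) S)
      + (\<Sum>S\<in>insert m ` ?A k. set_weight (Suc m) S)"
    unfolding level_weight_def split
    by (rule sum.union_disjoint) (auto simp: finite_subsets_card)
  also have "(\<Sum>S\<in>?A (Suc k). set_weight (Suc m) S) = - ((fps_exp 1 ^ Suc k - 1) * level_weight m (Suc k))"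
    unfolding level_weight_def sum_distrib_left sum_negf[symmetric]
    by (rule sum.cong[OF refl], rule w1)
  also have "(\<Sum>S\<in>insert m ` ?A k. set_weight (Suc m) S) = (\<Sum>S\<in>?A k. set_weight (Suc m) (insert m S))"
    by (simp add: sum.reindex[OF inj])
  also have "\<dots> = (fps_exp 1 ^ Suc k - 1) * level_weight m k"
    unfolding level_weight_def sum_distrib_left
    by (rule sum.cong[OF refl], rule w2)
  finally show ?thesis by (simp add: algebra_simps)
qed

text \<open>Each of the \<open>m\<close> factors lacks a constant term, so levels beyond the
  truncation do not affect low coefficients.\<close>

lemma fps_X_power_dvd_level_weight: "fps_X ^ m dvd (level_weight m k :: 'a :: field_char_0 fps)"
  unfolding level_weight_def
proof (rule dvd_sum)
  fix S
  have "(\<Prod>j<m. fps_X) dvd (\<Prod>j<m. fps_exp 1 ^ card {i \<in> S. i \<le> j} - 1 :: 'a fps)"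
    by (rule prod_dvd_prod) (simp add: fps_X_dvd_iff fps_nth_power_0)
  then show "fps_X ^ m dvd (set_weight m S :: 'a fps)"
    by (simp add: set_weight_def)
qed

text \<open>Summing the recursion over \<open>m\<close> gives \<open>q A(k+1) = (q - 1) A(k)\<close>
  with \<open>q = exp ((k+1) t)\<close>, hence \<open>A(k+1) = (1 - 1/q) A(k)\<close>, which is the
  recursion of \<open>qfact_fps\<close>. Cutting the sum at \<open>N\<close> leaves one boundary
  level, which is divisible by \<open>t^(N+1)\<close>.\<close>

lemma level_weight_sum_cong:
  "fps_X ^ Suc N dvd (\<Sum>m\<le>N. level_weight m k) - (qfact_fps k :: 'a :: field_char_0 fps)"
proof (induction k)
  case 0
  then show ?case by (simp add: level_weight_0 qfact_fps_def)
next
  case (Suc k)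
  define A :: "nat \<Rightarrow> 'a fps" where "A = (\<lambda>k. \<Sum>m\<le>N. level_weight m k)"
  define q :: "'a fps" where "q = fps_exp 1 ^ Suc k"
  define u :: "'a fps" where "u = fps_exp (- of_nat (Suc k))"
  define w :: "'a fps" where "w = level_weight (Suc N) (Suc k)"
  have uq: "u * q = 1"
    unfolding u_def q_def fps_exp_of_nat[symmetric] fps_exp_add_mult[symmetric] by simp
  have "A (Suc k) + w = (\<Sum>m\<le>Suc N. level_weight m (Suc k))"
    by (simp add: A_def w_def)
  also have "\<dots> = (\<Sum>m\<le>N. level_weight (Suc m) (Suc k))"
    by (subst sum.atMost_Suc_shift) (simp add: level_weight_eq_0)
  also have "\<dots> = (q - 1) * (A k - A (Suc k))"
    by (simp only: level_weight_Suc A_def q_def sum_subtractf[symmetric] sum_distrib_left)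
  finally have "q * A (Suc k) = (q - 1) * A k - w"
    by (simp add: algebra_simps)
  then have "u * q * A (Suc k) = (u * q - u) * A k - u * w"
    by (metis (no_types, opaque_lifting) mult.assoc mult.right_neutral right_diff_distrib left_diff_distrib)
  then have "A (Suc k) = (1 - u) * A k - u * w"
    by (simp add: uq)
  moreover have "qfact_fps (Suc k) = (1 - u) * qfact_fps k"
    by (simp add: qfact_fps_def u_def mult.commute)
  ultimately have "A (Suc k) - qfact_fps (Suc k) = (1 - u) * (A k - qfact_fps k) - u * w"
    by (simp add: algebra_simps)
  moreover have "fps_X ^ Suc N dvd w"
    unfolding w_def by (rule fps_X_power_dvd_level_weight)
  ultimately show ?case
    using Suc unfolding A_def by (metis dvd_diff dvd_mult)
qed

text \<open>Vanishing of the levels with \<open>k > m\<close> allows summation over a square, so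
  that the sum over \<open>m\<close> can be done first, separately for each
  \<open>k\<close>.\<close>

theorem num_labelled_interval_orders_qfact:
  "(of_nat (num_labelled_interval_orders n) :: 'a :: field_char_0) = fact n * (\<Sum>k\<le>n. qfact_fps k) $ n"
proof -
  have "(of_nat (num_labelled_interval_orders n) :: 'a)
      = (\<Sum>m\<le>n. fact n * (\<Sum>k\<le>m. level_weight m k) $ n)"
    by (simp add: num_labelled_interval_orders_eq_sum card_tight_reps_eq_level_weight)
  also have "\<dots> = (\<Sum>m\<le>n. fact n * (\<Sum>k\<le>n. level_weight m k) $ n)"
    by (intro sum.cong refl arg_cong[of _ _ "\<lambda>f. _ * f $ n"] sum.mono_neutral_left)
      (auto simp: level_weight_eq_0)
  also have "\<dots> = fact n * (\<Sum>m\<le>n. \<Sum>k\<le>n. level_weight m k $ n)"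
    by (simp add: sum_distrib_left fps_sum_nth)
  also have "(\<Sum>m\<le>n. \<Sum>k\<le>n. level_weight m k $ n) = (\<Sum>k\<le>n. (\<Sum>m\<le>n. level_weight m k) $ n :: 'a)"
    by (subst sum.swap) (simp add: fps_sum_nth)
  also have "\<dots> = (\<Sum>k\<le>n. qfact_fps k $ n)"
  proof (rule sum.cong[OF refl])
    fix k
    show "(\<Sum>m\<le>n. level_weight m k) $ n = (qfact_fps k $ n :: 'a)"
      using fps_X_power_dvd_nth[OF level_weight_sum_cong[of n k], of n] by simp
  qed
  finally show ?thesis by (simp add: fps_sum_nth)
qed

section \<open>Zagier's identity\<close>

text \<open>The expansion of \<open>sinh u / cosh (3u/2)\<close>, and its moments.\<close>

definition sech_fps :: "complex fps" where
  "sech_fps = (fps_exp 1 - fps_exp (-1)) / (fps_exp (3/2) + fps_exp (-3/2))"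

definition mom :: "nat \<Rightarrow> complex" where
  "mom m = fact m * sech_fps $ m"

lemma sech_fps_eq: "sech_fps * (fps_exp (3/2) + fps_exp (-3/2)) = fps_exp 1 - fps_exp (-1)"
proof -
  have "(fps_exp (3/2) + fps_exp (-3/2) :: complex fps) $ 0 \<noteq> 0" by simp
  then show ?thesis
    unfolding sech_fps_def by (simp add: fps_divide_unit mult.assoc inverse_mult_eq_1)
qed

text \<open>Multiplication by \<open>exp (-3u/2)\<close> turns the symmetric denominator into
  \<open>1 + exp (-3u)\<close>, whose second term acts on the moments as a shift of the variable by
  \<open>-3\<close>.\<close>

lemma sech_fps_eq': "sech_fps + sech_fps * fps_exp (-3) = fps_exp (-1/2) - fps_exp (-5/2)"
proof -
  have e: "fps_exp (3/2) * fps_exp (-3/2) = (1 :: complex fps)"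
    "fps_exp (-3/2) * fps_exp (-3/2) = (fps_exp (-3) :: complex fps)"
    "fps_exp 1 * fps_exp (-3/2) = (fps_exp (-1/2) :: complex fps)"
    "fps_exp (-1) * fps_exp (-3/2) = (fps_exp (-5/2) :: complex fps)"
    unfolding fps_exp_add_mult[symmetric] by simp_all
  have "sech_fps * (fps_exp (3/2) + fps_exp (-3/2)) * fps_exp (-3/2)
    = (fps_exp 1 - fps_exp (-1)) * fps_exp (-3/2)"
    by (simp only: sech_fps_eq)
  then show ?thesis
    by (simp only: distrib_left distrib_right left_diff_distrib mult.assoc e mult_1_right)
qed

lemma mom_rec:
  "mom m + (\<Sum>k\<le>m. of_nat (m choose k) * (-3) ^ (m - k) * mom k) = (-1/2) ^ m - (-5/2) ^ m"
proof -
  have "(sech_fps + sech_fps * fps_exp (-3)) $ m = (fps_exp (-1/2) - fps_exp (-5/2)) $ m"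
    by (simp only: sech_fps_eq')
  then have "sech_fps $ m + (\<Sum>k\<le>m. sech_fps $ k * ((-3) ^ (m - k) / fact (m - k)))
      = ((-1/2) ^ m - (-5/2) ^ m) / fact m"
    by (simp add: fps_mult_nth atLeast0AtMost diff_divide_distrib)
  then have "fact m * (sech_fps $ m + (\<Sum>k\<le>m. sech_fps $ k * ((-3) ^ (m - k) / fact (m - k))))
      = (-1/2) ^ m - (-5/2) ^ m"
    by simp
  moreover have "fact m * (sech_fps $ k * ((-3) ^ (m - k) / fact (m - k)))
      = of_nat (m choose k) * (-3) ^ (m - k) * mom k" if "k \<le> m" for k
    using that by (simp add: mom_def binomial_fact field_simps)
  ultimately show ?thesis
    by (simp add: distrib_left sum_distrib_left mom_def)
qed

text \<open>The functional \<open>L\<^sub>c\<close>, on polynomials in \<open>c\<close>.\<close>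

definition umbral :: "complex poly \<Rightarrow> complex" where
  "umbral p = (\<Sum>i\<le>degree p. coeff p i * mom i)"

lemma umbral_bound: "degree p \<le> n \<Longrightarrow> umbral p = (\<Sum>i\<le>n. coeff p i * mom i)"
  unfolding umbral_def by (rule sum.mono_neutral_left) (auto simp: coeff_eq_0)

lemma umbral_add: "umbral (p + q) = umbral p + umbral q"
proof -
  define n where "n = max (degree p) (degree q)"
  have "degree (p + q) \<le> n" "degree p \<le> n" "degree q \<le> n"
    unfolding n_def by (auto intro: degree_add_le_max)
  then show ?thesis
    by (simp add: umbral_bound sum.distrib distrib_right)
qed

lemma umbral_smult: "umbral (smult c p) = c * umbral p"
proof -
  have "umbral (smult c p) = (\<Sum>i\<le>degree p. coeff (smult c p) i * mom i)"
    by (rule umbral_bound) (rule degree_smult_le)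
  then show ?thesis by (simp add: umbral_def sum_distrib_left mult_ac)
qed

lemma umbral_0 [simp]: "umbral 0 = 0"
  by (simp add: umbral_def)

lemma umbral_sum: "umbral (\<Sum>i\<in>A. f i) = (\<Sum>i\<in>A. umbral (f i))"
  by (induction A rule: infinite_finite_induct) (auto simp: umbral_add)

lemma umbral_X_power: "umbral ([:0, 1:] ^ m) = mom m"
proof -
  have "umbral (monom 1 m) = (\<Sum>i\<le>m. coeff (monom 1 m) i * mom i)"
    by (rule umbral_bound) (simp add: degree_monom_le)
  also have "\<dots> = mom m"
    by (simp add: if_distrib[of "\<lambda>x. x * _"] sum.delta cong: if_cong)
  finally show ?thesis by (simp add: monom_altdef)
qed

lemma pcompose_power: "pcompose (p ^ n) q = pcompose p q ^ n" for p q :: "'a :: comm_semiring_1 poly"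
  by (induction n) (auto simp: pcompose_mult pcompose_1)

lemma poly_eq_sum_smult_X:
  "p = (\<Sum>i\<le>degree p. smult (coeff p i) ([:0, 1:] ^ i))" for p :: "'a :: comm_ring_1 poly"
  using poly_as_sum_of_monoms[of p] by (simp add: monom_altdef)

lemma pcompose_sum': "pcompose (\<Sum>i\<in>A. f i) q = (\<Sum>i\<in>A. pcompose (f i) q)"
  for q :: "'a :: comm_semiring_1 poly"
  by (induction A rule: infinite_finite_induct) (auto simp: pcompose_add)

text \<open>By linearity only monomials matter, and for these it is \<open>mom_rec\<close>. The two
  nodes are the exponents on the right of \<open>sech_fps_eq'\<close>.\<close>

lemma umbral_shift:
  "umbral p + umbral (pcompose p [:-3, 1:]) = poly p (-1/2) - poly p (-5/2)"
proof -
  have X: "umbral ([:0, 1:] ^ m) + umbral ([:-3, 1:] ^ m) = (-1/2) ^ m - (-5/2) ^ m" for m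
  proof -
    have "[:-3, 1:] ^ m = ([:0, 1:] + [:-3:] :: complex poly) ^ m" by simp
    also have "\<dots> = (\<Sum>k\<le>m. smult (of_nat (m choose k) * (-3) ^ (m - k)) ([:0, 1:] ^ k))"
      unfolding binomial_ring
      by (intro sum.cong refl) (simp add: poly_const_pow of_nat_poly mult_ac)
    finally have "umbral ([:-3, 1:] ^ m) = (\<Sum>k\<le>m. of_nat (m choose k) * (-3) ^ (m - k) * mom k)"
      by (simp add: umbral_sum umbral_smult umbral_X_power)
    then show ?thesis
      using mom_rec[of m] by (simp add: umbral_X_power)
  qed
  define c where "c = coeff p"
  define n where "n = degree p"
  have p: "p = (\<Sum>i\<le>n. smult (c i) ([:0, 1:] ^ i))"
    unfolding c_def n_def by (rule poly_eq_sum_smult_X)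
  have "umbral p + umbral (pcompose p [:-3, 1:])
      = (\<Sum>i\<le>n. c i * (umbral ([:0, 1:] ^ i) + umbral ([:-3, 1:] ^ i)))"
    unfolding p
    by (simp add: pcompose_sum' pcompose_smult pcompose_power pcompose_pCons umbral_sum umbral_smult
        sum.distrib distrib_left)
  also have "\<dots> = poly p (-1/2) - poly p (-5/2)"
    unfolding X p by (simp add: poly_sum sum_subtractf right_diff_distrib)
  finally show ?thesis .
qed

text \<open>\<open>L\<^sub>c (exp ((c z - c\<^sup>2/6) t))\<close>, a formal solution of a heat equation in \<open>u = z t\<close>.\<close>

definition heat_fps :: "complex \<Rightarrow> complex fps" where
  "heat_fps z = Abs_fps (\<lambda>N. umbral ([:0, z, -1/6:] ^ N) / fact N)"

text \<open>Substituting \<open>c - 3\<close> into \<open>z c - c^2/6\<close> gives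
  \<open>(z + 1) c - c^2/6 - 3 z - 3/2\<close>. Thus \<open>umbral_shift\<close> relates
  \<open>z\<close> to \<open>z + 1\<close>, and its two nodes produce the exponentials on the
  right.\<close>

lemma heat_fps_eq:
  "heat_fps z + fps_exp (-3 * z - 3/2) * heat_fps (z + 1)
    = fps_exp (- z/2 - 1/24) - fps_exp (-5/2 * z - 25/24)"
proof (rule fps_ext)
  fix N
  let ?c = "-3 * z - 3/2" and ?Q = "[:0, z, -1/6:]" and ?Q' = "[:0, z + 1, -1/6:]"
  have Q: "pcompose ?Q [:-3, 1:] = [:?c:] + ?Q'"
    by (simp add: pcompose_pCons field_simps)
  have "(fps_exp ?c * heat_fps (z + 1)) $ N
      = (\<Sum>i\<le>N. of_nat (N choose i) * ?c ^ i * umbral (?Q' ^ (N - i))) / fact N"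
    unfolding fps_mult_nth atLeast0AtMost sum_divide_distrib
    by (intro sum.cong refl) (auto simp: heat_fps_def binomial_fact field_simps)
  also have "(\<Sum>i\<le>N. of_nat (N choose i) * ?c ^ i * umbral (?Q' ^ (N - i)))
      = umbral (([:?c:] + ?Q') ^ N)"
    unfolding binomial_ring umbral_sum
    by (intro sum.cong refl) (simp add: poly_const_pow of_nat_poly umbral_smult mult_ac)
  also have "\<dots> = umbral (pcompose (?Q ^ N) [:-3, 1:])"
    by (simp only: pcompose_power Q)
  finally have "(heat_fps z + fps_exp ?c * heat_fps (z + 1)) $ N
      = (umbral (?Q ^ N) + umbral (pcompose (?Q ^ N) [:-3, 1:])) / fact N"
    by (simp add: heat_fps_def add_divide_distrib)
  also have "\<dots> = ((- z/2 - 1/24) ^ N - (-5/2 * z - 25/24) ^ N) / fact N"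
  proof -
    have "poly ?Q (-1/2) = - z/2 - 1/24" "poly ?Q (-5/2) = -5/2 * z - 25/24"
      by (simp_all add: field_simps)
    then show ?thesis by (simp only: umbral_shift poly_power)
  qed
  finally show "(heat_fps z + fps_exp ?c * heat_fps (z + 1)) $ N
    = (fps_exp (- z/2 - 1/24) - fps_exp (-5/2 * z - 25/24)) $ N"
    by (simp add: diff_divide_distrib)
qed

text \<open>Expanding in powers of \<open>z\<close> shows that the coefficients are polynomials in
  \<open>z\<close> and exposes the linear term, which gives the derivative at 0.\<close>

lemma heat_fps_nth:
  "heat_fps z $ N = (\<Sum>k\<le>N. of_nat (N choose k) * z ^ k * (-1/6) ^ (N - k) * mom (2 * N - k)) / fact N"
proof -
  have Q: "[:0, z, -1/6:] = (smult z [:0, 1:] + smult (-1/6) ([:0, 1:] ^ 2) :: complex poly)"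
    by (simp add: power2_eq_square)
  have gen: "of_nat C * smult a x ^ k * smult b y ^ j = smult (of_nat C * a ^ k * b ^ j) (x ^ k * y ^ j)"
    for C k j a b and x y :: "complex poly"
    by (simp add: smult_power of_nat_poly mult_ac)
  have "umbral ([:0, z, -1/6:] ^ N) = umbral ((smult z [:0, 1:] + smult (-1/6) ([:0, 1:] ^ 2)) ^ N)"
    by (simp only: Q)
  also have "\<dots> = (\<Sum>k\<le>N. umbral (smult (of_nat (N choose k) * z ^ k * (-1/6) ^ (N - k)) ([:0, 1:] ^ (2 * N - k))))"
    unfolding binomial_ring umbral_sum
  proof (intro sum.cong refl arg_cong[of _ _ umbral])
    fix k assume "k \<in> {..N}"
    then have "2 * N - k = k + 2 * (N - k)" by simp
    then have "[:0, 1:] ^ (2 * N - k) = ([:0, 1:] :: complex poly) ^ k * ([:0, 1:] ^ 2) ^ (N - k)"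
      by (simp only: power_mult power_add)
    then show "of_nat (N choose k) * smult z [:0, 1:] ^ k * smult (-1/6) ([:0, 1:] ^ 2) ^ (N - k)
      = smult (of_nat (N choose k) * z ^ k * (-1/6) ^ (N - k)) ([:0, 1:] ^ (2 * N - k) :: complex poly)"
      by (simp only: gen)
  qed
  finally show ?thesis
    by (simp add: heat_fps_def umbral_smult umbral_X_power)
qed

section \<open>Uniqueness for the functional equation among series with polynomial
  coefficients\<close>

definition is_polyfun :: "(complex \<Rightarrow> complex) \<Rightarrow> bool" where
  "is_polyfun f \<longleftrightarrow> (\<exists>p. \<forall>z. f z = poly p z)"

lemma is_polyfun_const: "is_polyfun (\<lambda>_. c)"
  unfolding is_polyfun_def by (rule exI[of _ "[:c:]"]) simp

lemma is_polyfun_linear: "is_polyfun (\<lambda>z. a * z + b)"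
  unfolding is_polyfun_def by (rule exI[of _ "[:b, a:]"]) (simp add: mult.commute)

lemma is_polyfun_diff: "is_polyfun f \<Longrightarrow> is_polyfun g \<Longrightarrow> is_polyfun (\<lambda>z. f z - g z)"
  unfolding is_polyfun_def by (metis poly_diff)

lemma is_polyfun_mult: "is_polyfun f \<Longrightarrow> is_polyfun g \<Longrightarrow> is_polyfun (\<lambda>z. f z * g z)"
  unfolding is_polyfun_def by (metis poly_mult)

lemma is_polyfun_power: "is_polyfun f \<Longrightarrow> is_polyfun (\<lambda>z. f z ^ n)"
  unfolding is_polyfun_def by (metis poly_power)

lemma is_polyfun_sum:
  assumes "\<And>i. i \<in> A \<Longrightarrow> is_polyfun (f i)"
  shows "is_polyfun (\<lambda>z. \<Sum>i\<in>A. f i z)"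
proof -
  obtain p where "\<And>i z. i \<in> A \<Longrightarrow> f i z = poly (p i) z"
    using assms unfolding is_polyfun_def by metis
  then show ?thesis
    unfolding is_polyfun_def by (intro exI[of _ "\<Sum>i\<in>A. p i"]) (simp add: poly_sum)
qed

definition poly_coeffs :: "(complex \<Rightarrow> complex fps) \<Rightarrow> bool" where
  "poly_coeffs F \<longleftrightarrow> (\<forall>n. is_polyfun (\<lambda>z. F z $ n))"

lemma poly_coeffs_const: "poly_coeffs (\<lambda>_. c)"
  by (simp add: poly_coeffs_def is_polyfun_const)

lemma poly_coeffs_diff: "poly_coeffs F \<Longrightarrow> poly_coeffs G \<Longrightarrow> poly_coeffs (\<lambda>z. F z - G z)"
  by (simp add: poly_coeffs_def is_polyfun_diff)

lemma poly_coeffs_mult: "poly_coeffs F \<Longrightarrow> poly_coeffs G \<Longrightarrow> poly_coeffs (\<lambda>z. F z * G z)"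
  unfolding poly_coeffs_def fps_mult_nth by (auto intro!: is_polyfun_sum is_polyfun_mult)

lemma poly_coeffs_sum: "(\<And>i. i \<in> A \<Longrightarrow> poly_coeffs (F i)) \<Longrightarrow> poly_coeffs (\<lambda>z. \<Sum>i\<in>A. F i z)"
  unfolding poly_coeffs_def fps_sum_nth by (auto intro!: is_polyfun_sum)

lemma poly_coeffs_prod: "(\<And>i. i \<in> A \<Longrightarrow> poly_coeffs (F i)) \<Longrightarrow> poly_coeffs (\<lambda>z. \<Prod>i\<in>A. F i z)"
  by (induction A rule: infinite_finite_induct) (auto intro: poly_coeffs_const poly_coeffs_mult)

lemma poly_coeffs_power: "poly_coeffs F \<Longrightarrow> poly_coeffs (\<lambda>z. F z ^ k)"
  by (induction k) (auto intro: poly_coeffs_const poly_coeffs_mult)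

lemma poly_coeffs_fps_exp: "poly_coeffs (\<lambda>z. fps_exp (a * z + b))"
  unfolding poly_coeffs_def fps_exp_nth divide_inverse
  by (intro allI is_polyfun_mult is_polyfun_power is_polyfun_linear is_polyfun_const)

lemma poly_coeffs_heat_fps: "poly_coeffs heat_fps"
proof -
  have id: "is_polyfun (\<lambda>z. z)" using is_polyfun_linear[of 1 0] by simp
  show ?thesis
    unfolding poly_coeffs_def heat_fps_nth divide_inverse
    by (intro allI is_polyfun_mult is_polyfun_sum is_polyfun_power is_polyfun_const id)
qed

text \<open>Antiperiodicity gives period 2, so the polynomial repeats the value \<open>f 0\<close>
  at infinitely many points and is constant; a constant \<open>c\<close> with
  \<open>c + c = 0\<close> vanishes.\<close>

lemma antiperiodic_polyfun:
  assumes "is_polyfun f" and anti: "\<And>z. f z + f (z + 1) = 0"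
  shows "f z = 0"
proof -
  obtain p where p: "\<And>z. f z = poly p z" using assms(1) unfolding is_polyfun_def by blast
  have per: "f (z + 2) = f z" for z
  proof -
    have "f z = - f (z + 1)" "f (z + 1) = - f (z + 1 + 1)"
      using anti[of z] anti[of "z + 1"] by (simp_all only: eq_neg_iff_add_eq_0)
    moreover have "z + 1 + 1 = z + 2" by simp
    ultimately show ?thesis by simp
  qed
  have "f (of_nat (2 * k)) = f 0" for k :: nat
  proof (induction k)
    case (Suc k)
    then show ?case using per[of "of_nat (2 * k)"] by (simp add: algebra_simps)
  qed simp
  then have "range (\<lambda>k. of_nat (2 * k)) \<subseteq> {x. poly (p - [:f 0:]) x = 0}"
    by (auto simp: p)
  moreover have "infinite (range (\<lambda>k :: nat. of_nat (2 * k) :: complex))"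
    by (rule range_inj_infinite) (auto intro: injI)
  ultimately have "p - [:f 0:] = 0"
    using poly_roots_finite finite_subset by metis
  then have "p = [:f 0:]" by simp
  then have const: "poly p z = f 0" for z by (metis poly_pCons poly_0 mult_zero_right add.right_neutral)
  have "f z = f 0" "f (z + 1) = f 0" unfolding p[of z] p[of "z + 1"] by (rule const)+
  then show ?thesis using anti[of z] by simp
qed

text \<open>Once the lower coefficients vanish, the exponential contributes only its constant term
  1, and the coefficient in question is antiperiodic in \<open>z\<close>.\<close>

lemma functional_equation_unique:
  assumes poly: "poly_coeffs D"
    and eq: "\<And>z. fps_X ^ Suc N dvd D z + fps_exp (-2 - 3 * z) * D (z + 1)"
  shows "n \<le> N \<Longrightarrow> D z $ n = 0"
proof (induction n arbitrary: z rule: less_induct)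
  case (less n)
  have "D z $ n + D (z + 1) $ n = 0" for z
  proof -
    have "(D z + fps_exp (-2 - 3 * z) * D (z + 1)) $ n = 0"
      using fps_X_power_dvd_nth[OF eq less.prems] .
    moreover have "(fps_exp (-2 - 3 * z) * D (z + 1)) $ n = (\<Sum>i\<in>{0}. fps_exp (-2 - 3 * z) $ i * D (z + 1) $ (n - i))"
      unfolding fps_mult_nth using less by (intro sum.mono_neutral_right) auto
    ultimately show ?thesis by simp
  qed
  then show ?case
    using antiperiodic_polyfun[of "\<lambda>z. D z $ n"] poly unfolding poly_coeffs_def by blast
qed

section \<open>The q-series solution and the comparison of the two solutions\<close>

lemma q_telescope:
  fixes x q :: "'a :: comm_ring_1"
  defines "P \<equiv> \<lambda>n. \<Prod>i=1..n. 1 - q ^ i * x"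
  shows "x ^ 2 * q ^ Suc k * (\<Sum>n\<le>N. P n * (x * q ^ Suc k) ^ n)
    = (\<Sum>n\<le>N. P n * (x * q ^ k) ^ n) * (x * q ^ k - 1) + 1 - P (Suc N) * (x * q ^ k) ^ Suc N"
proof (induction N)
  case 0
  then show ?case by (simp add: P_def algebra_simps power2_eq_square)
next
  case (Suc N)
  define n where "n = Suc N"
  have P: "P (Suc n) = P n * (1 - q ^ Suc n * x)" by (simp add: P_def mult.commute)
  \<comment> \<open>With \<open>y = x q^k\<close>, the factor \<open>q^(n+1) x\<close> converts
    \<open>P n\<close> into \<open>P n - P (n+1)\<close>; the resulting term is
    \<open>P n y^n (y - 1)\<close> plus a telescoping difference.\<close>
  have "x ^ 2 * q ^ Suc k * (P n * (x * q ^ Suc k) ^ n) = P n * (x * q ^ k) ^ Suc n * (q ^ Suc n * x)"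
    by (simp add: power_mult_distrib power2_eq_square mult_ac)
  also have "\<dots> = P n * (x * q ^ k) ^ n * (x * q ^ k - 1) + P n * (x * q ^ k) ^ n - P (Suc n) * (x * q ^ k) ^ Suc n"
    unfolding P by (simp add: algebra_simps)
  finally show ?case
    using Suc unfolding n_def by (simp add: algebra_simps)
qed

text \<open>The truncation of \<open>S(x) / (1 - x)\<close> at \<open>x = exp (- z t)\<close>; its \<open>n\<close>-th term is divisible by \<open>t\<^sup>n\<close>.\<close>

definition zagier_sum :: "nat \<Rightarrow> complex \<Rightarrow> complex fps" where
  "zagier_sum N z = (\<Sum>n\<le>N. (\<Prod>i=1..n. 1 - fps_exp (-1) ^ i * fps_exp (- z)) * fps_exp (- z) ^ n)"

text \<open>With \<open>a k\<close> the sum weighted by \<open>(x q^k)^n\<close>, the two values of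
  \<open>S\<close> are \<open>(1 - x) a 0\<close> and \<open>a 1 - q x a 2\<close>. Telescoping for
  \<open>k = 0\<close> and \<open>k = 1\<close> eliminates all three sums. What remains is a
  multiple of \<open>P (Suc N)\<close>, whose \<open>N + 1\<close> factors lack constant
  terms.\<close>

lemma zagier_sum_eq:
  fixes z :: complex and N :: nat
  defines "S \<equiv> \<lambda>z. (1 - fps_exp (- z)) * zagier_sum N z"
  shows "fps_X ^ Suc N dvd S z + fps_exp (-2 - 3 * z) * S (z + 1) - (1 - fps_exp (- 2 * z - 1))"
proof -
  define x q where "x = fps_exp (- z)" and "q = fps_exp (-1 :: complex)"
  define P where "P = (\<lambda>n. \<Prod>i=1..n. 1 - q ^ i * x)"
  define a where "a = (\<lambda>k. \<Sum>n\<le>N. P n * (x * q ^ k) ^ n)"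
  define r where "r = (\<lambda>k. P (Suc N) * (x * q ^ k) ^ Suc N)"
  have P: "P (Suc n) = P n * (1 - q ^ Suc n * x)" for n by (simp add: P_def mult.commute)
  have tel: "x ^ 2 * q ^ Suc k * a (Suc k) = a k * (x * q ^ k - 1) + 1 - r k" for k
    unfolding a_def r_def P_def by (rule q_telescope)
  have S: "S z = (1 - x) * a 0"
    by (simp add: S_def zagier_sum_def a_def P_def x_def q_def)
  have x': "fps_exp (- (z + 1)) = q * x"
    unfolding x_def q_def fps_exp_add_mult[symmetric] by simp
  have "(1 - q * x) * (\<Prod>i=1..n. 1 - q ^ i * (q * x)) = P (Suc n)" for n
  proof (induction n)
    case (Suc n)
    have "(1 - q * x) * (\<Prod>i=1..Suc n. 1 - q ^ i * (q * x))
        = (1 - q * x) * (\<Prod>i=1..n. 1 - q ^ i * (q * x)) * (1 - q ^ Suc n * (q * x))"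
      by (simp add: mult_ac)
    then show ?case unfolding Suc P[of "Suc n"] by (simp add: mult_ac)
  qed (simp add: P_def)
  then have "S (z + 1) = (\<Sum>n\<le>N. P n * (1 - q ^ Suc n * x) * (q * x) ^ n)"
    unfolding S_def zagier_sum_def x' sum_distrib_left mult.assoc[symmetric]
    by (simp add: P q_def)
  also have "\<dots> = a 1 - q * x * a 2"
    unfolding a_def sum_distrib_left sum_subtractf[symmetric]
    by (intro sum.cong refl) (simp add: algebra_simps power_mult_distrib power2_eq_square)
  finally have S': "S (z + 1) = a 1 - q * x * a 2" .
  have "fps_exp (-2 - 3 * z) = q ^ 2 * x ^ 3"
    by (simp add: q_def x_def fps_exp_power_mult flip: fps_exp_add_mult)
  moreover have "fps_exp (- 2 * z - 1) = q * x ^ 2"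
    by (simp add: q_def x_def fps_exp_power_mult flip: fps_exp_add_mult)
  ultimately have "S z + fps_exp (-2 - 3 * z) * S (z + 1) - (1 - fps_exp (- 2 * z - 1))
    = (1 - x) * a 0 + q ^ 2 * x ^ 3 * (a 1 - q * x * a 2) - (1 - q * x ^ 2)"
    by (simp add: S S')
  also have "\<dots> = q * x ^ 2 * r 1 - r 0"
  proof -
    have 0: "x ^ 2 * q * a 1 = a 0 * (x - 1) + 1 - r 0" using tel[of 0] by simp
    have 1: "x ^ 2 * q ^ 2 * a 2 = a 1 * (x * q - 1) + 1 - r 1"
      using tel[of 1] by (simp add: numeral_2_eq_2)
    show ?thesis using 0 1 by algebra
  qed
  also have "\<dots> = P (Suc N) * (q * x ^ 2 * (x * q) ^ Suc N - x ^ Suc N)"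
    by (simp add: r_def algebra_simps)
  finally have eq: "S z + fps_exp (-2 - 3 * z) * S (z + 1) - (1 - fps_exp (- 2 * z - 1))
    = P (Suc N) * (q * x ^ 2 * (x * q) ^ Suc N - x ^ Suc N)" .
  have "(\<Prod>i=1..Suc N. fps_X) dvd P (Suc N)"
    unfolding P_def by (rule prod_dvd_prod) (simp add: fps_X_dvd_iff q_def x_def fps_nth_power_0)
  then show ?thesis unfolding eq by (simp add: dvd_mult2)
qed

text \<open>The prefactor \<open>exp ((z/2 + 1/24) t)\<close> normalises the right-hand side of
  \<open>heat_fps_eq\<close> to that of Zagier's equation, so the difference of both sides solves
  the homogeneous equation modulo \<open>t^(N+1)\<close>.\<close>

lemma zagier_sum_eq_heat_fps:
  assumes "n \<le> N"
  shows "((1 - fps_exp (- z)) * zagier_sum N z) $ n = (fps_exp (z/2 + 1/24) * heat_fps z) $ n"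
proof -
  define S where "S = (\<lambda>z. (1 - fps_exp (- z)) * zagier_sum N z)"
  define H where "H = (\<lambda>z. fps_exp (z/2 + 1/24) * heat_fps z)"
  have H: "H z + fps_exp (-2 - 3 * z) * H (z + 1) = 1 - fps_exp (- 2 * z - 1)" for z
  proof -
    have "H z + fps_exp (-2 - 3 * z) * H (z + 1)
      = fps_exp (z/2 + 1/24) * (heat_fps z + fps_exp (-3 * z - 3/2) * heat_fps (z + 1))"
      unfolding H_def distrib_left mult.assoc[symmetric] fps_exp_add_mult[symmetric]
      by (simp add: field_simps)
    also have "\<dots> = 1 - fps_exp (- 2 * z - 1)"
      unfolding heat_fps_eq right_diff_distrib fps_exp_add_mult[symmetric] by (simp add: field_simps)
    finally show ?thesis .
  qed
  have e: "poly_coeffs (\<lambda>z. fps_exp (- z))" "poly_coeffs (\<lambda>z. fps_exp (z/2 + 1/24))"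
    using poly_coeffs_fps_exp[of "-1" 0] poly_coeffs_fps_exp[of "1/2" "1/24"] by simp_all
  have "poly_coeffs (\<lambda>z. S z - H z)"
    unfolding S_def H_def zagier_sum_def
    by (intro poly_coeffs_diff poly_coeffs_mult poly_coeffs_sum poly_coeffs_prod poly_coeffs_power
        poly_coeffs_const poly_coeffs_heat_fps e)
  moreover have "fps_X ^ Suc N dvd (S z - H z) + fps_exp (-2 - 3 * z) * (S (z + 1) - H (z + 1))" for z
  proof -
    have "(S z - H z) + fps_exp (-2 - 3 * z) * (S (z + 1) - H (z + 1))
      = S z + fps_exp (-2 - 3 * z) * S (z + 1) - (1 - fps_exp (- 2 * z - 1))"
      unfolding H[symmetric] by (simp add: algebra_simps)
    then show ?thesis using zagier_sum_eq[of N z] by (simp only: S_def)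
  qed
  ultimately have "(S z - H z) $ n = 0"
    using functional_equation_unique[of "\<lambda>z. S z - H z" N n z] assms by blast
  then show ?thesis by (simp add: S_def H_def)
qed

lemma is_polyfun_has_derivative:
  assumes "is_polyfun f"
  shows "\<exists>d. (f has_field_derivative d) (at z)"
proof -
  obtain p where p: "\<And>z. f z = poly p z" using assms unfolding is_polyfun_def by blast
  then have "f = poly p" by (simp add: fun_eq_iff)
  then show ?thesis using poly_DERIV by metis
qed

text \<open>The coefficient \<open>n + 1\<close> of the identity is differentiated in
  \<open>z\<close> at 0. There \<open>1 - exp (- z t)\<close> vanishes with derivative
  \<open>t\<close>, which leaves the coefficient \<open>n\<close> of the q-series. On the other side
  \<open>heat_fps 0\<close> vanishes, which leaves the part linear in \<open>z\<close>, and this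
  carries the odd moments.\<close>

theorem qfact_sum_nth:
  "(\<Sum>k\<le>n. qfact_fps k) $ n
    = (\<Sum>i\<le>n. (1/24) ^ i / fact i * ((-1/6) ^ (n - i) / fact (n - i) * mom (2 * (n - i) + 1)))"
  (is "_ = ?R")
proof -
  let ?N = "Suc n"
  have e: "poly_coeffs (\<lambda>z. fps_exp (- z))"
    using poly_coeffs_fps_exp[of "-1" 0] by simp
  have "poly_coeffs (zagier_sum ?N)"
    unfolding zagier_sum_def
    by (intro poly_coeffs_diff poly_coeffs_mult poly_coeffs_sum poly_coeffs_prod poly_coeffs_power
        poly_coeffs_const e)
  then have "\<forall>j. \<exists>d. ((\<lambda>z. zagier_sum ?N z $ j) has_field_derivative d) (at 0)"
    unfolding poly_coeffs_def by (intro allI is_polyfun_has_derivative) (rule spec)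
  from choice[OF this] obtain A' where
    A': "\<And>j. ((\<lambda>z. zagier_sum ?N z $ j) has_field_derivative A' j) (at 0)" by blast
  have one: "((\<lambda>z. (1 - fps_exp (- z)) $ i) has_field_derivative (if i = 1 then 1 else 0)) (at (0 :: complex))" for i
  proof -
    consider "i = 0" | "i = 1" | j where "i = Suc (Suc j)"
      by (metis One_nat_def not0_implies_Suc)
    then show ?thesis
    proof cases
      case (3 j)
      then show ?thesis
        by (auto intro!: derivative_eq_intros simp: power_0_left simp del: fact_Suc)
    next
      case 2
      have "((\<lambda>z. z) has_field_derivative 1) (at (0 :: complex))" by (rule DERIV_ident)
      then show ?thesis using 2 by simp
    next
      case 1
      then show ?thesis by simp
    qed
  qed
  have "((\<lambda>z. ((1 - fps_exp (- z)) * zagier_sum ?N z) $ ?N) has_field_derivative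
      (\<Sum>i\<le>?N. (if i = 1 then 1 else 0) * zagier_sum ?N 0 $ (?N - i) + A' (?N - i) * (1 - fps_exp (- 0)) $ i)) (at 0)"
    unfolding fps_mult_nth atLeast0AtMost
    by (intro DERIV_sum DERIV_mult one A')
  also have "(\<Sum>i\<le>?N. (if i = 1 then 1 else 0) * zagier_sum ?N 0 $ (?N - i) + A' (?N - i) * (1 - fps_exp (- 0)) $ i)
      = (\<Sum>i\<in>{1}. zagier_sum ?N 0 $ (?N - i))"
    by (rule sum.mono_neutral_cong_right) auto
  finally have L: "((\<lambda>z. ((1 - fps_exp (- z)) * zagier_sum ?N z) $ ?N) has_field_derivative zagier_sum ?N 0 $ n) (at 0)"
    by simp
  \<comment> \<open>At \<open>z = 0\<close> the identity itself has left-hand side 0; dividing by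
    the exponential gives the claim.\<close>
  have heat0: "heat_fps 0 $ j = 0" if "j \<le> ?N" for j
  proof -
    have "(fps_exp (1/24) * heat_fps 0) $ i = 0" if "i \<le> ?N" for i
      using zagier_sum_eq_heat_fps[OF that, of 0] by simp
    then have "(fps_exp (-1/24) * (fps_exp (1/24) * heat_fps 0)) $ j = 0"
      using that unfolding fps_mult_nth[of "fps_exp (-1/24)"] by (intro sum.neutral) auto
    then show ?thesis
      by (simp add: mult.assoc[symmetric] flip: fps_exp_add_mult)
  qed
  \<comment> \<open>Only the term \<open>k = 1\<close> has a nonzero derivative at 0; its moment has
    index \<open>2 M - 1\<close>, written with \<open>M - 1\<close>.\<close>
  define h' where "h' = (\<lambda>M. if M = 0 then 0 else (-1/6) ^ (M - 1) * mom (2 * (M - 1) + 1) / fact (M - 1))"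
  have heat': "((\<lambda>z. heat_fps z $ M) has_field_derivative h' M) (at 0)" for M
  proof -
    have pw: "((\<lambda>z. z ^ k) has_field_derivative (if k = 1 then 1 else 0)) (at (0 :: complex))" for k
      by (cases k) (auto intro!: derivative_eq_intros simp: power_0_left)
    have "((\<lambda>z. heat_fps z $ M) has_field_derivative
        (\<Sum>k\<le>M. of_nat (M choose k) * (if k = 1 then 1 else 0) * (-1/6) ^ (M - k) * mom (2 * M - k)) / fact M) (at 0)"
      unfolding heat_fps_nth
      by (intro DERIV_cdivide DERIV_sum DERIV_cmult_right DERIV_cmult pw)
    also have "(\<Sum>k\<le>M. of_nat (M choose k) * (if k = 1 then 1 else 0) * (-1/6) ^ (M - k) * mom (2 * M - k)) / fact M = h' M"
    proof (cases M)
      case (Suc m)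
      have "(\<Sum>k\<le>M. of_nat (M choose k) * (if k = 1 then 1 else 0) * (-1/6) ^ (M - k) * mom (2 * M - k))
          = (\<Sum>k\<in>{1}. of_nat (M choose k) * (-1/6) ^ (M - k) * mom (2 * M - k))"
        using Suc by (intro sum.mono_neutral_cong_right) auto
      then show ?thesis
        using Suc by (simp add: h'_def field_simps del: of_nat_Suc)
    qed (simp add: h'_def)
    finally show ?thesis .
  qed
  define g' where "g' = (\<lambda>i. of_nat i * (1/24) ^ (i - 1) * (1/2) / fact i :: complex)"
  have g': "((\<lambda>z. fps_exp (z/2 + 1/24) $ i) has_field_derivative g' i) (at (0 :: complex))" for i
    unfolding g'_def fps_exp_nth by (auto intro!: derivative_eq_intros)
  have "((\<lambda>z. (fps_exp (z/2 + 1/24) * heat_fps z) $ ?N) has_field_derivative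
      (\<Sum>i\<le>?N. g' i * heat_fps 0 $ (?N - i) + h' (?N - i) * fps_exp (0/2 + 1/24) $ i)) (at 0)"
    unfolding fps_mult_nth atLeast0AtMost
    by (intro DERIV_sum DERIV_mult g' heat')
  also have "(\<Sum>i\<le>?N. g' i * heat_fps 0 $ (?N - i) + h' (?N - i) * fps_exp (0/2 + 1/24) $ i)
      = (\<Sum>i\<le>?N. h' (?N - i) * ((1/24) ^ i / fact i))"
    by (simp add: heat0)
  also have "\<dots> = ?R"
    by (simp add: h'_def Suc_diff_le mult_ac)
  finally have R: "((\<lambda>z. (fps_exp (z/2 + 1/24) * heat_fps z) $ ?N) has_field_derivative
    ?R) (at 0)" .
  have "zagier_sum ?N 0 $ n = ?R"
    by (rule DERIV_unique[OF L]) (use R zagier_sum_eq_heat_fps[of ?N ?N] in simp)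
  moreover have "zagier_sum ?N 0 = (\<Sum>k\<le>?N. qfact_fps k)"
    by (simp add: zagier_sum_def qfact_fps_def fps_exp_power_mult)
  \<comment> \<open>Working up to order \<open>Suc n\<close> brought in one summand too many; it is
    divisible by \<open>t^(n+1)\<close>.\<close>
  moreover have "(qfact_fps ?N :: complex fps) $ n = 0"
  proof (rule fps_X_power_dvd_nth)
    have "(\<Prod>i=1..?N. fps_X) dvd (qfact_fps ?N :: complex fps)"
      unfolding qfact_fps_def by (rule prod_dvd_prod) (simp add: fps_X_dvd_iff)
    then show "fps_X ^ Suc n dvd (qfact_fps ?N :: complex fps)" by simp
  qed simp
  ultimately show ?thesis by simp
qed

section \<open>Poles of \<open>sinh u / cosh (3u/2)\<close>\<close>

lemma has_fps_expansion_sech_fps: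
  "(\<lambda>u. (exp u - exp (- u)) / (exp (3/2 * u) + exp (-3/2 * u))) has_fps_expansion sech_fps"
  unfolding sech_fps_def
  by (intro has_fps_expansion_divide' has_fps_expansion_diff has_fps_expansion_add
      has_fps_expansion_exp has_fps_expansion_exp1 has_fps_expansion_exp_neg1) simp

text \<open>The equation says \<open>exp (3 u) = -1\<close>, so \<open>u\<close> is an odd multiple
  of \<open>i pi / 3\<close>; all but two of these have modulus at least \<open>pi\<close>, hence
  greater than 2.\<close>

lemma exp_add_exp_minus_eq_0:
  assumes "exp (3/2 * u) + exp (-3/2 * u) = 0" "norm (u :: complex) < 2"
  shows "u = \<i> * (pi/3) \<or> u = - (\<i> * (pi/3))"
proof -
  have "exp (-3/2 * u) * exp (3/2 * u) = 1"
    by (simp flip: exp_add)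
  moreover have "exp (-3/2 * u) = - exp (3/2 * u)"
    using assms(1) by (simp add: eq_neg_iff_add_eq_0 add.commute)
  ultimately have "- (exp (3/2 * u) * exp (3/2 * u)) = 1" by simp
  then have "exp (3 * u) = -1"
    by (simp add: minus_equation_iff flip: exp_add)
  then have "exp (3 * u) = exp (\<i> * pi)" by simp
  then obtain n :: int where "3 * u = \<i> * pi + of_int (2 * n) * pi * \<i>"
    unfolding exp_eq by auto
  then have u: "u = \<i> * (of_int (2 * n + 1) * pi / 3)"
    by (simp add: field_simps)
  define t :: real where "t = of_int (2 * n + 1)"
  have ut: "u = \<i> * of_real (t * pi / 3)" using u by (simp add: t_def)
  have "\<bar>t * pi / 3\<bar> < 2"
    using assms(2) unfolding ut by (simp only: norm_mult norm_of_real norm_ii mult_1)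
  then have "\<bar>t\<bar> * pi < 6"
    by (simp add: abs_mult)
  moreover have "\<bar>t\<bar> * 3 \<le> \<bar>t\<bar> * pi"
    using pi_gt3 by (intro mult_left_mono) auto
  ultimately have "\<bar>t\<bar> < 2" by linarith
  then have "\<bar>2 * n + 1\<bar> < 2" unfolding t_def by linarith
  then have "n = 0 \<or> n = -1" by linarith
  then have "t = 1 \<or> t = -1" unfolding t_def by auto
  then show ?thesis unfolding ut by (elim disjE) simp_all
qed

text \<open>Up to a contour integral, a Taylor coefficient is minus the sum of the residues at
  \<open>\<plusminus> i pi / 3\<close>. The numerator there is \<open>\<plusminus> i sqrt 3\<close>
  and the derivative of the denominator is \<open>\<plusminus> 3 i\<close>, so both quotients are
  \<open>1 / sqrt 3\<close>. In odd degree the two poles contribute equally.\<close>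

lemma sech_fps_nth_bound:
  defines "a \<equiv> pi / 3"
  shows "\<exists>B. \<forall>k. norm (sech_fps $ (2 * k + 1) - of_real (2 / sqrt 3 * (-1) ^ k / a ^ (2 * k + 2)))
    \<le> B * (2/3) ^ (2 * k + 1)"
proof -
  define N D f where "N = (\<lambda>u :: complex. exp u - exp (- u))"
    and "D = (\<lambda>u :: complex. exp (3/2 * u) + exp (-3/2 * u))" and "f = (\<lambda>u. N u / D u)"
  define w where "w = \<i> * complex_of_real a"
  have a: "0 < a" "a < 3/2" using pi_less_4 by (auto simp: a_def)
  have w: "w \<noteq> 0" "w \<noteq> - w" "norm w < 3/2" using a by (auto simp: w_def norm_mult)
  have expw: "exp (3/2 * w) = \<i>" "exp (-3/2 * w) = - \<i>"
  proof -
    have "3/2 * w = \<i> * complex_of_real (pi/2)" "-3/2 * w = \<i> * complex_of_real (- pi/2)"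
      by (simp_all add: w_def a_def)
    then show "exp (3/2 * w) = \<i>" "exp (-3/2 * w) = - \<i>"
      by (simp_all only: cis_conv_exp[symmetric]) (simp_all add: complex_eq_iff)
  qed
  have Nw: "N w = \<i> * sqrt 3"
  proof -
    have "exp w = cis (pi/3)" "exp (- w) = cis (- (pi/3))"
      by (simp_all add: cis_conv_exp w_def a_def)
    then show ?thesis
      by (simp add: N_def complex_eq_iff sin_60 cos_60)
  qed
  have holo: "f holomorphic_on ball 0 2 - {w, - w}"
    unfolding f_def N_def D_def
    by (intro holomorphic_intros) (use exp_add_exp_minus_eq_0 in \<open>force simp: w_def a_def\<close>)
  \<comment> \<open>The radius has to lie strictly between \<open>pi / 3\<close> and 2; its inverse
    is the base of the error.\<close>
  define r :: real where "r = 3/2"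
  have sub: "cball 0 r \<subseteq> (ball 0 2 :: complex set)" by (auto simp: r_def)
  have "compact (f ` sphere 0 r)"
  proof (intro compact_continuous_image holomorphic_on_imp_continuous_on holomorphic_on_subset[OF holo])
    show "sphere 0 r \<subseteq> ball 0 2 - {w, - w}" using w sub by (auto simp: r_def)
  qed simp
  then have "bounded (f ` sphere 0 r)" by (rule compact_imp_bounded)
  then obtain B where B: "\<And>z. z \<in> sphere 0 r \<Longrightarrow> norm (f z) \<le> B"
    unfolding bounded_iff by blast
  have B0: "B \<ge> 0"
    by (rule order_trans[OF norm_ge_zero B[of "of_real r"]]) (simp add: r_def)
  have dD: "(D has_field_derivative (3/2 * (exp (3/2 * z) - exp (-3/2 * z)))) (at z)" for z
    unfolding D_def by (auto intro!: derivative_eq_intros simp: algebra_simps)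
  have res: "residue (\<lambda>z. f z / z ^ Suc n) p = N p / p ^ Suc n / (3/2 * (exp (3/2 * p) - exp (-3/2 * p)))"
    if p: "p = w \<or> p = - w" for p n
  proof -
    have "residue (\<lambda>z. (N z / z ^ Suc n) / D z) p
        = (N p / p ^ Suc n) / (3/2 * (exp (3/2 * p) - exp (-3/2 * p)))"
    \<comment> \<open>This ball just avoids 0, where the quotient taken as numerator has its
      pole.\<close>
    proof (rule residue_simple_pole_deriv[where s = "ball p (norm p)"])
      show "(\<lambda>z. N z / z ^ Suc n) holomorphic_on ball p (norm p)"
        unfolding N_def by (intro holomorphic_intros) (auto simp: dist_norm)
      show "D holomorphic_on ball p (norm p)"
        unfolding D_def by (intro holomorphic_intros)
      show "(D has_field_derivative (3/2 * (exp (3/2 * p) - exp (-3/2 * p)))) (at p)" by (rule dD)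
      show "p \<in> ball p (norm p)" using p w by auto
      show "D p = 0" using p expw unfolding D_def by auto
      show "N p / p ^ Suc n \<noteq> 0" using p w Nw by (auto simp: N_def)
      show "3/2 * (exp (3/2 * p) - exp (-3/2 * p)) \<noteq> 0" using p expw by auto
    qed auto
    then show ?thesis by (simp add: f_def mult.commute)
  qed
  have res_sum: "(\<Sum>p\<in>{w, - w}. residue (\<lambda>z. f z / z ^ Suc (2 * k + 1)) p)
      = - of_real (2 / sqrt 3 * (-1) ^ k / a ^ (2 * k + 2))" for k
  proof -
    have "N (- w) = - N w" by (simp add: N_def)
    moreover have "exp (3/2 * - w) = - \<i>" "exp (-3/2 * - w) = \<i>" using expw by simp_all
    moreover have pw: "w ^ Suc (2 * k + 1) = - of_real ((-1) ^ k * a ^ (2 * k + 2))"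
    proof -
      have "Suc (2 * k + 1) = 2 * (k + 1)" by simp
      then have "w ^ Suc (2 * k + 1) = (w ^ 2) ^ (k + 1)" by (simp only: power_mult)
      also have "w ^ 2 = - of_real (a ^ 2)" by (simp add: w_def power_mult_distrib)
      also have "(- complex_of_real (a ^ 2)) ^ (k + 1) = (-1) ^ (k + 1) * of_real ((a ^ 2) ^ (k + 1))"
        by (subst power_minus) simp
      also have "(a ^ 2) ^ (k + 1) = a ^ (2 * k + 2)"
        by (simp only: power_mult[symmetric] distrib_left mult_1_right)
      finally show ?thesis by simp
    qed
    moreover have "(- w) ^ Suc (2 * k + 1) = w ^ Suc (2 * k + 1)" by simp
    ultimately have "(\<Sum>p\<in>{w, - w}. residue (\<lambda>z. f z / z ^ Suc (2 * k + 1)) p)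
      = 2 * (\<i> * sqrt 3 / w ^ Suc (2 * k + 1) / (3/2 * (\<i> - - \<i>)))"
      using w by (simp add: res expw Nw del: power_Suc)
    also have "\<dots> = - of_real (2 * (sqrt 3 / 3) / ((-1) ^ k * a ^ (2 * k + 2)))"
      unfolding pw by (simp add: field_simps)
    also have "2 * (sqrt 3 / 3) / ((-1) ^ k * a ^ (2 * k + 2)) = 2 / sqrt 3 * (-1) ^ k / a ^ (2 * k + 2)"
      using a by (cases "even k") (simp_all add: field_simps)
    finally show ?thesis .
  qed
  show ?thesis
  proof (intro exI allI)
    fix k
    have "norm ((deriv ^^ (2 * k + 1)) f 0 / fact (2 * k + 1)
        + (\<Sum>p\<in>{w, - w}. residue (\<lambda>z. f z / z ^ Suc (2 * k + 1)) p)) \<le> B / r ^ (2 * k + 1)"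
    proof (rule fps_coeff_residues_bound[where A = "ball 0 2" and k = "{}"])
      show "f holomorphic_on ball 0 2 - {w, - w}" by (rule holo)
      show "{w, - w} \<subseteq> ball 0 r" using w by (auto simp: r_def)
    qed (use w sub B B0 in \<open>auto simp: r_def\<close>)
    moreover have "sech_fps $ n = (deriv ^^ n) f 0 / fact n" for n
      using fps_nth_fps_expansion[OF has_fps_expansion_sech_fps] by (simp add: f_def N_def D_def)
    ultimately have "norm (sech_fps $ (2 * k + 1) - of_real (2 / sqrt 3 * (-1) ^ k / a ^ (2 * k + 2)))
      \<le> B / r ^ (2 * k + 1)"
      unfolding res_sum by (simp only: add_uminus_conv_diff)
    also have "B / r ^ (2 * k + 1) = B * (2/3) ^ (2 * k + 1)"
      by (simp add: r_def power_divide)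
    finally show "norm (sech_fps $ (2 * k + 1) - of_real (2 / sqrt 3 * (-1) ^ k / a ^ (2 * k + 2)))
      \<le> B * (2/3) ^ (2 * k + 1)" .
  qed
qed

section \<open>The main term\<close>

text \<open>This is the sum of \<open>qfact_sum_nth\<close> with the odd Taylor coefficients
  replaced by a geometric sequence. The base is left open: \<open>beta\<close> gives the
  contribution of the nearest poles, \<open>2/27\<close> bounds the rest.\<close>

definition conv_sum :: "real \<Rightarrow> nat \<Rightarrow> real" where
  "conv_sum b n = (\<Sum>k\<le>n. (1/24) ^ (n - k) / fact (n - k) * (b ^ k * (fact (2 * k + 1) / fact k)))"

text \<open>Equal to \<open>(1/6) / (pi/3)^2\<close>: the \<open>1/6\<close> is that of the
  quadratic exponent, and \<open>pi/3\<close> is the modulus of the nearest poles. The ratio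
  \<open>(2k+1)! / k!\<close> grows like \<open>4^k k! sqrt k\<close>, so the final growth rate is
  \<open>4 * beta = 6 / pi^2\<close>.\<close>

definition beta :: real where "beta = 3 / (2 * pi\<^sup>2)"

lemma beta_pos: "beta > 0" by (simp add: beta_def)

text \<open>The signs of \<open>(-1/6)^k\<close> and of the pole contributions cancel. The constants
  are \<open>18 / (pi^2 sqrt 3) = (2 / sqrt 3) / (pi/3)^2\<close> and
  \<open>2/27 = 1/6 * (2/3)^2\<close>.\<close>

lemma num_labelled_interval_orders_conv_sum:
  "\<exists>B. \<forall>n. \<bar>real (num_labelled_interval_orders n) - fact n * (18 / (pi\<^sup>2 * sqrt 3) * conv_sum beta n)\<bar>
    \<le> fact n * (B * conv_sum (2/27) n)"
proof -
  let ?c = "18 / (pi\<^sup>2 * sqrt 3) :: real"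
  define a where "a = pi / 3"
  define m where "m = (\<lambda>k. 2 / sqrt 3 * (-1) ^ k / a ^ (2 * k + 2) :: real)"
  obtain B where B: "\<And>k. norm (sech_fps $ (2 * k + 1) - of_real (m k)) \<le> B * (2/3) ^ (2 * k + 1)"
    using sech_fps_nth_bound unfolding m_def a_def by blast
  define c where "c = (\<lambda>n k. (1/24) ^ (n - k) / fact (n - k) * ((-1/6) ^ k / fact k * fact (2 * k + 1)) :: real)"
  show ?thesis
  proof (intro exI allI)
    fix n
    let ?D = "\<bar>real (num_labelled_interval_orders n) - fact n * (?c * conv_sum beta n)\<bar>"
    have "complex_of_real (real (num_labelled_interval_orders n))
      = fact n * (\<Sum>k\<le>n. (1/24) ^ (n - k) / fact (n - k) * ((-1/6) ^ k / fact k * mom (2 * k + 1)))"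
      unfolding of_real_of_nat_eq num_labelled_interval_orders_qfact[where 'a = complex] qfact_sum_nth
      by (intro arg_cong[of _ _ "\<lambda>x. fact n * x"], rule sum.reindex_bij_witness[of _ "\<lambda>k. n - k" "\<lambda>k. n - k"]) auto
    also have "\<dots> = fact n * (\<Sum>k\<le>n. of_real (c n k) * sech_fps $ (2 * k + 1))"
      by (intro arg_cong[of _ _ "\<lambda>x. fact n * x"] sum.cong refl)
        (simp add: c_def mom_def del: fact_Suc)
    finally have L: "complex_of_real (real (num_labelled_interval_orders n))
      = fact n * (\<Sum>k\<le>n. of_real (c n k) * sech_fps $ (2 * k + 1))" .
    have M: "?c * conv_sum beta n = (\<Sum>k\<le>n. c n k * m k)"
    proof -
      have "c n k * m k = ?c * ((1/24) ^ (n - k) / fact (n - k) * (beta ^ k * (fact (2 * k + 1) / fact k)))" for k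
      proof -
        have "(-1/6 :: real) ^ k * m k = ?c * beta ^ k"
        proof -
          have "(-1/6 :: real) ^ k * (-1) ^ k = (1/6) ^ k"
            by (simp flip: power_mult_distrib)
          moreover have "a ^ (2 * k + 2) = (a ^ 2) ^ k * a ^ 2"
            by (simp only: power_mult[symmetric] power_add[symmetric])
          moreover have "beta = 1/6 / a ^ 2"
            by (simp add: beta_def a_def power_divide)
          moreover have "2 / sqrt 3 / a ^ 2 = ?c"
            by (simp add: a_def power_divide)
          moreover have "x ^ k * (2 / sqrt 3 * (-1) ^ k / (y ^ k * y)) = x ^ k * (-1) ^ k * (1 / y) ^ k * (2 / sqrt 3 / y)"
            for x y :: real
            by (simp add: power_divide mult_ac)
          ultimately have "(-1/6 :: real) ^ k * m k = (1/6) ^ k * (1 / a ^ 2) ^ k * (?c)"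
            unfolding m_def by metis
          also have "(1/6) ^ k * (1 / a ^ 2) ^ k = beta ^ k"
            unfolding power_mult_distrib[symmetric] by (simp add: beta_def a_def power_divide)
          finally show ?thesis by (simp only: mult.commute)
        qed
        moreover have "c n k * m k = (1/24) ^ (n - k) / fact (n - k) * (((-1/6) ^ k * m k) * (fact (2 * k + 1) / fact k))"
          unfolding c_def by (simp only: mult_ac times_divide_eq_right times_divide_eq_left)
        ultimately show ?thesis
          by (simp only: mult_ac times_divide_eq_right times_divide_eq_left divide_divide_eq_left)
      qed
      then show ?thesis by (simp only: conv_sum_def sum_distrib_left)
    qed
    have "?D
      = norm (complex_of_real (real (num_labelled_interval_orders n)) - fact n * of_real (\<Sum>k\<le>n. c n k * m k))"
    proof -
      have "complex_of_real x - fact n * of_real y = of_real (x - fact n * y)" for x y by simp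
      then show ?thesis unfolding M by (simp only: norm_of_real)
    qed
    also have "\<dots> = norm (fact n * (\<Sum>k\<le>n. of_real (c n k) * (sech_fps $ (2 * k + 1) - of_real (m k))))"
      unfolding L by (simp add: sum_subtractf right_diff_distrib)
    also have "\<dots> = fact n * norm (\<Sum>k\<le>n. of_real (c n k) * (sech_fps $ (2 * k + 1) - of_real (m k)))"
      by (simp add: norm_mult)
    also have "\<dots> \<le> fact n * (\<Sum>k\<le>n. \<bar>c n k\<bar> * (B * (2/3) ^ (2 * k + 1)))"
    proof (intro mult_left_mono sum_norm_le)
      fix k
      show "norm (of_real (c n k) * (sech_fps $ (2 * k + 1) - of_real (m k))) \<le> \<bar>c n k\<bar> * (B * (2/3) ^ (2 * k + 1))"
        unfolding norm_mult norm_of_real by (intro mult_left_mono B) auto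
    qed simp
    also have "(\<Sum>k\<le>n. \<bar>c n k\<bar> * (B * (2/3) ^ (2 * k + 1))) = 2/3 * B * conv_sum (2/27) n"
      unfolding conv_sum_def sum_distrib_left
    proof (intro sum.cong refl)
      fix k
      have "(2/3 :: real) ^ (2 * k + 1) = 2/3 * (4/9) ^ k"
        by (simp add: power_mult power2_eq_square)
      moreover have "\<bar>c n k\<bar> = (1/24) ^ (n - k) / fact (n - k) * ((1/6) ^ k / fact k * fact (2 * k + 1))"
        by (simp add: c_def abs_mult power_abs)
      moreover have "(2/27 :: real) ^ k = (1/6) ^ k * (4/9) ^ k"
        by (simp flip: power_mult_distrib)
      ultimately show "\<bar>c n k\<bar> * (B * (2/3) ^ (2 * k + 1))
        = 2/3 * B * ((1/24) ^ (n - k) / fact (n - k) * ((2/27) ^ k * (fact (2 * k + 1) / fact k)))"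
        by (simp only: mult_ac times_divide_eq_right times_divide_eq_left)
    qed
    finally show "?D
      \<le> fact n * (2/3 * B * conv_sum (2/27) n)" .
  qed
qed

section \<open>Growth, limit and recurrence of the convolution sums\<close>

lemma fact_ratio_Suc:
  "(fact (2 * Suc k + 1) / fact (Suc k) :: real) = (4 * real k + 6) * (fact (2 * k + 1) / fact k)"
proof -
  have "(fact (2 * Suc k + 1) :: real) = (2 * real k + 3) * (2 * real k + 2) * fact (2 * k + 1)"
    by (simp add: algebra_simps)
  also have "(2 * real k + 3) * (2 * real k + 2) = (4 * real k + 6) * (real k + 1)"
    by (simp add: algebra_simps)
  finally show ?thesis
    by (simp add: divide_simps del: fact_Suc) (simp add: fact_Suc)
qed

lemma fact_ratio_le: "(fact (2 * k + 1) / fact k :: real) \<le> 4 ^ k * fact (Suc k)"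
proof (induction k)
  case (Suc k)
  have "(fact (2 * Suc k + 1) / fact (Suc k) :: real) \<le> (4 * real k + 6) * (4 ^ k * fact (Suc k))"
    unfolding fact_ratio_Suc by (rule mult_left_mono[OF Suc]) simp
  also have "\<dots> \<le> (4 * (real k + 2)) * (4 ^ k * fact (Suc k))"
    by (rule mult_right_mono) auto
  also have "\<dots> = 4 ^ Suc k * fact (Suc (Suc k))"
    by (simp add: algebra_simps)
  finally show ?case .
qed simp

lemma conv_sum_nonneg: "b \<ge> 0 \<Longrightarrow> conv_sum b n \<ge> 0"
  unfolding conv_sum_def by (intro sum_nonneg) auto

lemma exp_partial_sum_le:
  assumes "(x :: real) \<ge> 0"
  shows "(\<Sum>k\<le>n. x ^ (n - k) / fact (n - k)) \<le> exp x"
proof -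
  have "(\<Sum>k\<le>n. x ^ (n - k) / fact (n - k)) = (\<Sum>k\<le>n. x ^ k / fact k)"
    by (rule sum.reindex_bij_witness[of _ "\<lambda>k. n - k" "\<lambda>k. n - k"]) auto
  also have "\<dots> \<le> (\<Sum>k. x ^ k / fact k)"
    using assms summable_exp[of x] by (intro sum_le_suminf) (auto simp: field_simps)
  also have "\<dots> = exp x"
    by (simp add: exp_def field_simps scaleR_conv_of_real)
  finally show ?thesis .
qed

text \<open>Taking out \<open>(4 b)^n\<close> replaces \<open>1/24\<close> by
  \<open>(1/24) / (4 b) = 1 / (96 b)\<close>, so the sum over \<open>k\<close> is controlled by an
  exponential series.\<close>

lemma conv_sum_term_le:
  assumes "(b :: real) > 0" "k \<le> n"
  shows "(1/24) ^ (n - k) / fact (n - k) * (b ^ k * (fact (2 * k + 1) / fact k))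
    \<le> (4 * b) ^ n * ((1 / (96 * b)) ^ (n - k) / fact (n - k)) * fact (Suc k)"
proof -
  have "(1/24 :: real) ^ (n - k) / fact (n - k) * (b ^ k * (fact (2 * k + 1) / fact k))
    \<le> (1/24) ^ (n - k) / fact (n - k) * (b ^ k * (4 ^ k * fact (Suc k)))"
    using assms by (intro mult_left_mono fact_ratio_le) auto
  also have "(1/24) ^ (n - k) / fact (n - k) * (b ^ k * (4 ^ k * fact (Suc k)))
    = ((4 * b) ^ (n - k) * (4 * b) ^ k) * ((1 / (96 * b)) ^ (n - k) / fact (n - k)) * fact (Suc k)"
  proof -
    have "(1/24 :: real) ^ (n - k) = (4 * b) ^ (n - k) * (1 / (96 * b)) ^ (n - k)"
      unfolding power_mult_distrib[symmetric] using assms by simp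
    then show ?thesis by (simp add: power_mult_distrib)
  qed
  also have "(4 * b) ^ (n - k) * (4 * b) ^ k = (4 * b) ^ n"
    unfolding power_add[symmetric] using assms by simp
  finally show ?thesis .
qed

lemma conv_sum_le:
  assumes "b > 0"
  shows "conv_sum b n \<le> exp (1 / (96 * b)) * fact (Suc n) * (4 * b) ^ n"
proof -
  have "conv_sum b n \<le> (\<Sum>k\<le>n. (4 * b) ^ n * fact (Suc n) * ((1 / (96 * b)) ^ (n - k) / fact (n - k)))"
    unfolding conv_sum_def
  proof (rule sum_mono)
    fix k assume k: "k \<in> {..n}"
    let ?t = "(1/24) ^ (n - k) / fact (n - k) * (b ^ k * (fact (2 * k + 1) / fact k))"
    have "?t
      \<le> (4 * b) ^ n * ((1 / (96 * b)) ^ (n - k) / fact (n - k)) * fact (Suc k)"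
      using conv_sum_term_le[OF assms, of k n] k by simp
    also have "\<dots> \<le> (4 * b) ^ n * ((1 / (96 * b)) ^ (n - k) / fact (n - k)) * fact (Suc n)"
      using assms k by (intro mult_left_mono fact_mono) auto
    finally show "?t
      \<le> (4 * b) ^ n * fact (Suc n) * ((1 / (96 * b)) ^ (n - k) / fact (n - k))"
      by (simp only: mult_ac)
  qed
  also have "\<dots> \<le> (4 * b) ^ n * fact (Suc n) * exp (1 / (96 * b))"
    unfolding sum_distrib_left[symmetric]
    using assms by (intro mult_left_mono exp_partial_sum_le) auto
  finally show ?thesis by (simp only: mult_ac)
qed

text \<open>In \<open>u (k+1) = b (4 k + 6) u k\<close> the factor is rewritten as
  \<open>4 n + 10 - 4 (n + 1 - k)\<close>. The part \<open>n + 1 - k\<close> is absorbed by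
  \<open>v\<close>, which lowers its index and gives the term with \<open>conv_sum b n\<close>. The
  inhomogeneous term is the summand \<open>k = 0\<close>.\<close>

lemma conv_sum_rec:
  "conv_sum b (Suc (Suc n)) = b * (4 * real n + 10) * conv_sum b (Suc n) - b / 6 * conv_sum b n
    + (1/24) ^ Suc (Suc n) / fact (Suc (Suc n))"
proof -
  define u where "u = (\<lambda>k. b ^ k * (fact (2 * k + 1) / fact k) :: real)"
  define v where "v = (\<lambda>j. (1/24) ^ j / fact j :: real)"
  have u: "u (Suc k) = b * (4 * real k + 6) * u k" for k
    unfolding u_def fact_ratio_Suc by simp
  have v: "real (Suc j) * v (Suc j) = 1/24 * v j" for j
    by (simp add: v_def)
  have s: "conv_sum b n = (\<Sum>k\<le>n. v (n - k) * u k)" for n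
    by (simp add: conv_sum_def u_def v_def)
  have "(\<Sum>k\<le>Suc n. real (Suc n - k) * v (Suc n - k) * u k) = (\<Sum>k\<le>n. real (Suc n - k) * v (Suc n - k) * u k)"
    by simp
  also have "\<dots> = (\<Sum>k\<le>n. 1/24 * (v (n - k) * u k))"
    by (intro sum.cong refl) (simp add: Suc_diff_le v del: of_nat_Suc)
  finally have *: "(\<Sum>k\<le>Suc n. real (Suc n - k) * v (Suc n - k) * u k) = 1/24 * conv_sum b n"
    by (simp add: s sum_distrib_left)
  have "conv_sum b (Suc (Suc n)) = v (Suc (Suc n)) * u 0 + (\<Sum>k\<le>Suc n. v (Suc n - k) * u (Suc k))"
    unfolding s by (subst sum.atMost_Suc_shift) simp
  also have "(\<Sum>k\<le>Suc n. v (Suc n - k) * u (Suc k))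
    = (\<Sum>k\<le>Suc n. b * (4 * real n + 10) * (v (Suc n - k) * u k) - 4 * b * (real (Suc n - k) * v (Suc n - k) * u k))"
  proof (intro sum.cong refl)
    fix k assume "k \<in> {..Suc n}"
    then have "real k = real n + 1 - real (Suc n - k)" by simp
    then show "v (Suc n - k) * u (Suc k)
      = b * (4 * real n + 10) * (v (Suc n - k) * u k) - 4 * b * (real (Suc n - k) * v (Suc n - k) * u k)"
      unfolding u by (simp add: algebra_simps)
  qed
  also have "\<dots> = b * (4 * real n + 10) * conv_sum b (Suc n) - 4 * b * (1/24 * conv_sum b n)"
    unfolding sum_subtractf sum_distrib_left[symmetric] * by (simp only: s)
  finally show ?thesis by (simp add: u_def v_def algebra_simps)
qed

definition main_term :: "nat \<Rightarrow> real" where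
  "main_term n = conv_sum beta n / (fact n * (4 * beta) ^ n * sqrt n)"

text \<open>The ratio is \<open>2 * 4^n\<close> times the Pochhammer symbol of \<open>1/2\<close>,
  so Euler's limit for \<open>Gamma (1/2) = sqrt pi\<close> applies.\<close>

lemma fact_ratio_tendsto: "(\<lambda>n. fact (2 * n + 1) / fact n / (4 ^ n * fact n * sqrt n)) \<longlonglongrightarrow> 2 / sqrt pi"
proof -
  have p: "fact (2 * n + 1) / fact n = (2 * 4 ^ n * pochhammer (1/2) (Suc n) :: real)" for n
  proof (induction n)
    case (Suc n)
    show ?case
      unfolding fact_ratio_Suc Suc pochhammer_Suc[of _ "Suc n"] by (simp add: algebra_simps)
  qed simp
  have "(\<lambda>n. 2 * inverse (Gamma_series (1/2) n)) \<longlonglongrightarrow> 2 * inverse (Gamma (1/2 :: real))"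
    by (intro tendsto_intros Gamma_series_LIMSEQ) (simp add: Gamma_one_half_real)
  also have "2 * inverse (Gamma (1/2 :: real)) = 2 / sqrt pi"
    by (simp add: Gamma_one_half_real field_simps)
  finally show ?thesis
  proof (rule Lim_transform_eventually)
    show "eventually (\<lambda>n. 2 * inverse (Gamma_series (1/2) n) = fact (2 * n + 1) / fact n / (4 ^ n * fact n * sqrt n)) sequentially"
      using eventually_gt_at_top[of 0]
    proof eventually_elim
      case (elim n)
      have "exp (1/2 * ln (real n)) = sqrt n"
        using elim by (simp add: powr_half_sqrt[symmetric] powr_def)
      then show ?case
        unfolding p by (simp add: Gamma_series_def)
    qed
  qed
qed

text \<open>The summand \<open>k = n\<close> gives the limit. For \<open>k < n\<close> the factorial
  \<open>(k+1)!\<close> is at most \<open>n!\<close>, so the other summands together are smaller by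
  a factor of order \<open>sqrt n\<close>.\<close>

lemma main_term_tendsto: "main_term \<longlonglongrightarrow> 2 / sqrt pi"
proof -
  define F where "F = (\<lambda>n. fact (2 * n + 1) / fact n / (4 ^ n * fact n * sqrt n) :: real)"
  have "(\<lambda>n. main_term n - F n) \<longlonglongrightarrow> 0"
  proof (rule Lim_null_comparison)
    show "(\<lambda>n. exp (1 / (96 * beta)) / sqrt n) \<longlonglongrightarrow> 0" by real_asymp
    show "eventually (\<lambda>n. norm (main_term n - F n) \<le> exp (1 / (96 * beta)) / sqrt n) sequentially"
      using eventually_gt_at_top[of 0]
    proof eventually_elim
      case (elim n)
      define t where "t = (\<lambda>k. (1/24) ^ (n - k) / fact (n - k) * (beta ^ k * (fact (2 * k + 1) / fact k)) :: real)"
      let ?e = "\<lambda>k. (1 / (96 * beta)) ^ (n - k) / fact (n - k)"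
      define V where "V = fact n * (4 * beta) ^ n * sqrt n"
      have V: "V > 0" using elim beta_pos by (simp add: V_def)
      have "conv_sum beta n = (\<Sum>k<n. t k) + t n"
        unfolding conv_sum_def t_def by (simp add: lessThan_Suc_atMost[symmetric])
      moreover have "t n / V = F n"
        using elim beta_pos by (simp add: t_def V_def F_def power_mult_distrib)
      ultimately have eq: "main_term n - F n = (\<Sum>k<n. t k) / V"
        by (simp add: main_term_def V_def add_divide_distrib)
      have "(\<Sum>k<n. t k) \<le> (\<Sum>k<n. (4 * beta) ^ n * fact n * ?e k)"
      proof (rule sum_mono)
        fix k assume k: "k \<in> {..<n}"
        have "t k \<le> (4 * beta) ^ n * ?e k * fact (Suc k)"
          using conv_sum_term_le[OF beta_pos, of k n] k by (simp add: t_def)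
        also have "\<dots> \<le> (4 * beta) ^ n * ?e k * fact n"
          using k beta_pos by (intro mult_left_mono fact_mono) auto
        finally show "t k \<le> (4 * beta) ^ n * fact n * ?e k"
          by (simp only: mult_ac)
      qed
      also have "\<dots> \<le> (4 * beta) ^ n * fact n * (\<Sum>k\<le>n. ?e k)"
        unfolding sum_distrib_left using beta_pos by (intro sum_mono2) auto
      also have "\<dots> \<le> (4 * beta) ^ n * fact n * exp (1 / (96 * beta))"
        using beta_pos by (intro mult_left_mono exp_partial_sum_le) auto
      finally have "(\<Sum>k<n. t k) / V \<le> (4 * beta) ^ n * fact n * exp (1 / (96 * beta)) / V"
        using V by (intro divide_right_mono) auto
      also have "\<dots> = exp (1 / (96 * beta)) / sqrt n"
        using beta_pos by (simp add: V_def)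
      finally have "(\<Sum>k<n. t k) / V \<le> exp (1 / (96 * beta)) / sqrt n" .
      moreover have "(\<Sum>k<n. t k) / V \<ge> 0"
        using V beta_pos by (intro divide_nonneg_pos sum_nonneg) (auto simp: t_def)
      ultimately show ?case unfolding eq by simp
    qed
  qed
  then have "(\<lambda>n. (main_term n - F n) + F n) \<longlonglongrightarrow> 0 + 2 / sqrt pi"
    by (rule tendsto_add) (use fact_ratio_tendsto in \<open>simp add: F_def\<close>)
  then show ?thesis by simp
qed

text \<open>The recurrence of \<open>conv_sum\<close> is divided by the normalisation
  \<open>W n\<close>. Here \<open>4 (n - 2) + 10 = 4 n (1 + 1/(2n))\<close> and
  \<open>pi^2/144 = (beta/6) / (4 beta)^2\<close>; the square roots are quotients of the factors
  \<open>sqrt n\<close>.\<close>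

lemma main_term_rec:
  assumes "n \<ge> 3"
  shows "main_term n = (1 + 1 / (2 * real n)) * sqrt (1 - 1 / real n) * main_term (n - 1)
    - pi\<^sup>2 / 144 / (real n * (real n - 1)) * sqrt (1 - 2 / real n) * main_term (n - 2)
    + (pi\<^sup>2 / 144) ^ n / ((fact n)\<^sup>2 * sqrt (real n))"
proof -
  obtain k where k: "n = Suc (Suc k)" "k > 0"
    using assms by (metis Suc_le_D Suc_le_eq numeral_3_eq_3 Suc_le_mono)
  define W where "W = (\<lambda>n. fact n * (4 * beta) ^ n * sqrt (real n))"
  have W: "W m > 0" if "m > 0" for m
    using that beta_pos by (simp add: W_def)
  have mt: "conv_sum beta m = main_term m * W m" if "m > 0" for m
  proof -
    have "main_term m = conv_sum beta m / W m" by (simp only: main_term_def W_def)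
    then show ?thesis using W[OF that] by simp
  qed
  have r1: "sqrt (1 - 1 / real n) * sqrt (real n) = sqrt (real (Suc k))" "sqrt (1 - 2 / real n) * sqrt (real n) = sqrt (real k)"
    unfolding real_sqrt_mult[symmetric] k by (simp_all add: field_simps)
  have W1: "beta * (4 * real k + 10) * W (Suc k) = (1 + 1 / (2 * real n)) * sqrt (1 - 1 / real n) * W n"
  proof -
    have "beta * (4 * real k + 10) = (1 + 1 / (2 * real n)) * (real n * (4 * beta))"
      by (simp add: k field_simps)
    then have "beta * (4 * real k + 10) * W (Suc k)
      = (1 + 1 / (2 * real n)) * (real n * (4 * beta)) * (fact (Suc k) * (4 * beta) ^ Suc k * (sqrt (1 - 1 / real n) * sqrt (real n)))"
      unfolding r1 by (simp only: W_def)
    also have "\<dots> = (1 + 1 / (2 * real n)) * sqrt (1 - 1 / real n) * (real n * fact (Suc k) * ((4 * beta) * (4 * beta) ^ Suc k) * sqrt (real n))"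
      by (simp only: mult_ac)
    also have "real n * fact (Suc k) * ((4 * beta) * (4 * beta) ^ Suc k) * sqrt (real n) = W n"
      by (simp add: W_def k fact_Suc)
    finally show ?thesis .
  qed
  have W2: "beta / 6 * W k = pi\<^sup>2 / 144 / (real n * (real n - 1)) * sqrt (1 - 2 / real n) * W n"
  proof -
    have "beta / 6 = pi\<^sup>2 / 144 * (4 * beta) ^ 2"
      by (simp add: beta_def power_divide power_mult_distrib field_simps power2_eq_square)
    then have "beta / 6 * W k = pi\<^sup>2 / 144 * (4 * beta) ^ 2 * (fact k * (4 * beta) ^ k * (sqrt (1 - 2 / real n) * sqrt (real n)))"
      unfolding r1 by (simp only: W_def)
    also have "\<dots> = pi\<^sup>2 / 144 / (real n * (real n - 1)) * sqrt (1 - 2 / real n)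
        * ((real n * (real n - 1) * fact k) * ((4 * beta) ^ 2 * (4 * beta) ^ k) * sqrt (real n))"
    proof -
      have "x * y * (f * z * (s * q)) = x / N * s * ((N * f) * (y * z) * q)" if "N \<noteq> 0" for x y f z s q N :: real
        using that by simp
      note * = this
      show ?thesis by (rule *) (use k in simp)
    qed
    also have "(real n * (real n - 1) * fact k) * ((4 * beta) ^ 2 * (4 * beta) ^ k) * sqrt (real n) = W n"
      by (simp add: W_def k fact_Suc power2_eq_square)
    finally show ?thesis .
  qed
  have W3: "(1/24) ^ n / fact n = (pi\<^sup>2 / 144) ^ n / ((fact n)\<^sup>2 * sqrt (real n)) * W n"
  proof -
    have "1/24 = pi\<^sup>2 / 144 * (4 * beta)" by (simp add: beta_def)
    then have "(1/24 :: real) ^ n = (pi\<^sup>2 / 144) ^ n * (4 * beta) ^ n"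
      by (simp only: power_mult_distrib)
    moreover have "n > 0" using k by simp
    ultimately show ?thesis by (simp add: W_def power2_eq_square)
  qed
  have "main_term n * W n = conv_sum beta n" using mt k by simp
  also have "\<dots> = beta * (4 * real k + 10) * W (Suc k) * main_term (Suc k) - beta / 6 * W k * main_term k
      + (1/24) ^ n / fact n"
    unfolding k conv_sum_rec by (simp add: mt k mult_ac)
  also have "\<dots> = ((1 + 1 / (2 * real n)) * sqrt (1 - 1 / real n) * main_term (n - 1)
    - pi\<^sup>2 / 144 / (real n * (real n - 1)) * sqrt (1 - 2 / real n) * main_term (n - 2)
    + (pi\<^sup>2 / 144) ^ n / ((fact n)\<^sup>2 * sqrt (real n))) * W n"
    unfolding W1 W2 W3 by (simp add: k algebra_simps)
  finally show ?thesis using W[of n] k by simp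
qed

section \<open>Asymptotic expansion of the main term\<close>

text \<open>The coefficient of \<open>x\<^sup>s\<close> in \<open>(1 - c x) powr (1/2 - l)\<close>.\<close>

definition binom_coeff :: "nat \<Rightarrow> nat \<Rightarrow> nat \<Rightarrow> real" where
  "binom_coeff c l s = (\<Prod>t<s. real c * (real t + real l - 1/2) / real (Suc t))"

text \<open>The recurrence of \<open>main_term\<close>, written for \<open>x = 1/n\<close>, maps \<open>x\<^sup>l\<close> to \<open>x\<^sup>l\<close> times a power series without
  constant term; \<open>defect_coeff l s\<close> is the coefficient of \<open>x\<^bsup>s+1\<^esup>\<close> of the latter. It equals \<open>- l\<close> for
  \<open>s = 0\<close>, and \<open>asym_coeff\<close> is chosen to cancel the coefficient of \<open>x\<^bsup>i+1\<^esup>\<close>.\<close>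

definition defect_coeff :: "nat \<Rightarrow> nat \<Rightarrow> real" where
  "defect_coeff l s = pi\<^sup>2 / 144 * (\<Sum>t<s. binom_coeff 2 l t)
     - (binom_coeff 1 l (Suc s) + binom_coeff 1 l s / 2)"

fun asym_coeff :: "nat \<Rightarrow> real" where
  "asym_coeff i = (if i = 0 then 1 else (\<Sum>l<i. defect_coeff l (i - l) * asym_coeff l) / real i)"

declare asym_coeff.simps [simp del]

lemma asym_coeff_0: "asym_coeff 0 = 1"
  by (simp add: asym_coeff.simps)

text \<open>The product form serves the computability proof, the binomial form the power series
  expansion.\<close>

lemma binom_coeff_gchoose: "binom_coeff c l s = ((1/2 - real l) gchoose s) * (- real c) ^ s"
proof (induction s)
  case (Suc s)
  have "binom_coeff c l (Suc s) = binom_coeff c l s * (real c * (real s + real l - 1/2) / real (Suc s))"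
    by (simp add: binom_coeff_def)
  then show ?case
    unfolding Suc by (simp add: gbinomial_Suc_rec field_simps)
qed (simp add: binom_coeff_def)

lemma has_fps_expansion_binom_coeff:
  "(\<lambda>x. (1 - real c * x) powr (1/2 - real l)) has_fps_expansion Abs_fps (binom_coeff c l)"
proof (rule has_fps_expansionI)
  have "eventually (\<lambda>x :: real. x \<in> ball 0 (1 / (real c + 1))) (nhds 0)"
    by (intro eventually_nhds_in_open) auto
  then show "eventually (\<lambda>x. (\<lambda>n. Abs_fps (binom_coeff c l) $ n * x ^ n) sums
      (1 - real c * x) powr (1/2 - real l)) (nhds 0)"
  proof eventually_elim
    case (elim x)
    then have "\<bar>x\<bar> * (real c + 1) < 1"
      by (simp add: dist_norm field_simps)
    then have "\<bar>- real c * x\<bar> < 1"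
      by (simp add: abs_mult algebra_simps)
    moreover have "Abs_fps (binom_coeff c l) $ n * x ^ n = ((1/2 - real l) gchoose n) * (- real c * x) ^ n" for n
      by (simp only: fps_nth_Abs_fps binom_coeff_gchoose power_mult_distrib mult.assoc)
    ultimately show ?case
      using gen_binomial_real[of "- real c * x" "1/2 - real l"] by (simp add: add_uminus_conv_diff)
  qed
qed

text \<open>The quotient \<open>f x / x^n\<close> extends continuously to 0 and is therefore bounded
  nearby. The zero series is separate because its subdegree is 0 by convention.\<close>

lemma has_fps_expansion_bound:
  fixes f :: "real \<Rightarrow> real"
  assumes f: "f has_fps_expansion F" and zero: "\<And>i. i < n \<Longrightarrow> F $ i = 0"
  shows "\<exists>C. eventually (\<lambda>x. \<bar>f x\<bar> \<le> C * \<bar>x\<bar> ^ n) (nhds 0)"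
proof (cases "F = 0")
  case True
  then have "eventually (\<lambda>x. f x = 0) (nhds 0)"
    using f by (auto simp: has_fps_expansion_def elim: eventually_mono)
  then have "eventually (\<lambda>x. \<bar>f x\<bar> \<le> 0 * \<bar>x\<bar> ^ n) (nhds 0)"
    by (rule eventually_mono) simp
  then show ?thesis by blast
next
  case False
  have "n \<le> subdegree F" using False zero by (intro subdegree_geI) auto
  define g where "g = (\<lambda>x. if x = 0 then F $ n else f x / x ^ n)"
  have "g has_fps_expansion fps_shift n F"
    unfolding g_def by (rule has_fps_expansion_shift[OF f \<open>n \<le> subdegree F\<close> refl])
  then have "isCont g 0"
    using has_fps_expansion_imp_continuous[of g _ UNIV] by simp
  then have "(g \<longlongrightarrow> g 0) (nhds 0)"
    by (simp add: continuous_at tendsto_nhds_iff)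
  then have "eventually (\<lambda>x. dist (g x) (g 0) < 1) (nhds 0)"
    by (rule tendstoD) simp
  then have "eventually (\<lambda>x. \<bar>f x\<bar> \<le> (\<bar>g 0\<bar> + 1) * \<bar>x\<bar> ^ n) (nhds 0)"
  proof eventually_elim
    case (elim x)
    have "f x = g x * x ^ n"
    proof (cases "x = 0")
      case True
      have "f 0 = F $ 0"
        using f by (auto simp: has_fps_expansion_def eval_fps_at_0 dest: eventually_nhds_x_imp_x)
      then show ?thesis using True zero[of 0] by (cases "n = 0") (auto simp: g_def)
    qed (simp add: g_def)
    moreover have "\<bar>g x\<bar> \<le> \<bar>g 0\<bar> + 1"
      using elim by (auto simp: dist_real_def)
    ultimately show ?case
      by (simp add: abs_mult power_abs mult_right_mono)
  qed
  then show ?thesis by blast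
qed

text \<open>For \<open>x = 1/n\<close> one has \<open>1/(n - c) = x / (1 - c x)\<close>, so a
  shifted power times its square root becomes \<open>x^l (1 - c x)^(1/2 - l)\<close>, and
  \<open>1/(n (n - 1)) = x^2 / (1 - x)\<close>. What remains after taking out \<open>x^l\<close> is
  this function.\<close>

definition defect_fun :: "nat \<Rightarrow> real \<Rightarrow> real" where
  "defect_fun l x = 1 - (1 + x * (1/2)) * (1 - real 1 * x) powr (1/2 - real l)
     + (pi\<^sup>2 / 144) * (x ^ 2 * (inverse (1 - x) * (1 - real 2 * x) powr (1/2 - real l)))"

definition defect_fps :: "nat \<Rightarrow> real fps" where
  "defect_fps l = 1 - (1 + fps_X * fps_const (1/2)) * Abs_fps (binom_coeff 1 l)
     + fps_const (pi\<^sup>2 / 144) * (fps_X ^ 2 * (inverse (1 - fps_X) * Abs_fps (binom_coeff 2 l)))"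

lemma has_fps_expansion_defect_fun: "defect_fun l has_fps_expansion defect_fps l"
  unfolding defect_fun_def defect_fps_def
  by (intro has_fps_expansion_add has_fps_expansion_diff has_fps_expansion_mult has_fps_expansion_1
      has_fps_expansion_fps_X has_fps_expansion_fps_X_power has_fps_expansion_const
      has_fps_expansion_inverse has_fps_expansion_binom_coeff has_fps_expansion_cmult_left
      has_fps_expansion_cmult_right) simp

lemma defect_fps_nth: "defect_fps l $ Suc s = defect_coeff l s" "defect_fps l $ 0 = 0"
proof -
  have b0: "binom_coeff c l 0 = 1" for c by (simp add: binom_coeff_def)
  have geo: "inverse (1 - fps_X :: real fps) = Abs_fps (\<lambda>_. 1)"
    by (rule fps_inverse_unique) (auto simp: fps_eq_iff left_diff_distrib)
  have "(fps_X ^ 2 * (inverse (1 - fps_X) * Abs_fps (binom_coeff 2 l))) $ Suc s = (\<Sum>t<s. binom_coeff 2 l t)"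
  proof (cases s)
    case 0
    then show ?thesis by (simp add: fps_X_power_mult_nth)
  next
    case (Suc r)
    have "(\<Sum>i=0..r. binom_coeff 2 l (r - i)) = (\<Sum>t<Suc r. binom_coeff 2 l t)"
      by (rule sum.reindex_bij_witness[of _ "\<lambda>i. r - i" "\<lambda>i. r - i"]) auto
    then have "(inverse (1 - fps_X) * Abs_fps (binom_coeff 2 l)) $ r = (\<Sum>t<s. binom_coeff 2 l t)"
      using Suc by (simp add: geo fps_mult_nth)
    moreover have "(fps_X ^ 2 * G) $ Suc (Suc r) = G $ r" for G :: "real fps"
      unfolding fps_X_power_mult_nth by simp
    ultimately show ?thesis
      using Suc by (simp only:)
  qed
  then show "defect_fps l $ Suc s = defect_coeff l s"
    by (simp add: defect_fps_def defect_coeff_def distrib_right mult.assoc)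
  show "defect_fps l $ 0 = 0"
    by (simp add: defect_fps_def b0)
qed

lemma defect_coeff_0: "defect_coeff l 0 = - real l"
  by (simp add: defect_coeff_def binom_coeff_def)

text \<open>The coefficient of \<open>x^(i+1)\<close> collects \<open>defect_coeff l (i - l)\<close>
  for \<open>l \<le> i\<close>. Its diagonal term is \<open>- i * asym_coeff i\<close>, which the
  recursion balances for every \<open>i \<le> M\<close>, so the first surviving power is
  \<open>x^(M+2)\<close>.\<close>

lemma truncated_defect:
  "\<exists>C. eventually (\<lambda>x. \<bar>\<Sum>l\<le>M. asym_coeff l * (x ^ l * defect_fun l x)\<bar> \<le> C * \<bar>x\<bar> ^ (M + 2)) (nhds 0)"
proof (rule has_fps_expansion_bound)
  show "(\<lambda>x. \<Sum>l\<le>M. asym_coeff l * (x ^ l * defect_fun l x)) has_fps_expansion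
    (\<Sum>l\<le>M. fps_const (asym_coeff l) * (fps_X ^ l * defect_fps l))"
    by (intro has_fps_expansion_sum has_fps_expansion_cmult_left has_fps_expansion_mult
        has_fps_expansion_fps_X_power has_fps_expansion_defect_fun)
next
  fix N assume N: "N < M + 2"
  have nth: "(\<Sum>l\<le>M. fps_const (asym_coeff l) * (fps_X ^ l * defect_fps l)) $ N
    = (\<Sum>l\<le>M. asym_coeff l * (if N < l then 0 else defect_fps l $ (N - l)))"
    by (simp add: fps_sum_nth fps_X_power_mult_nth)
  show "(\<Sum>l\<le>M. fps_const (asym_coeff l) * (fps_X ^ l * defect_fps l)) $ N = 0"
  proof (cases N)
    case 0
    then show ?thesis unfolding nth by (intro sum.neutral) (auto simp: defect_fps_nth)
  next
    case (Suc i)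
    then have i: "i \<le> M" using N by simp
    have "(\<Sum>l\<le>M. asym_coeff l * (if N < l then 0 else defect_fps l $ (N - l)))
      = (\<Sum>l\<le>i. asym_coeff l * defect_coeff l (i - l))"
      using Suc i
      by (intro sum.mono_neutral_cong_right)
        (auto simp: defect_fps_nth Suc_diff_le not_less_eq_eq less_Suc_eq)
    also have "\<dots> = (\<Sum>l<i. defect_coeff l (i - l) * asym_coeff l) - real i * asym_coeff i"
      by (simp add: lessThan_Suc_atMost[symmetric] defect_coeff_0 mult.commute)
    also have "\<dots> = 0"
      by (cases "i = 0") (simp_all add: asym_coeff.simps[of i])
    finally show ?thesis unfolding nth .
  qed
qed

text \<open>If \<open>d\<close> is \<open>O(n^-p)\<close>, the increments are
  \<open>O(n^-(p+2))\<close>; since \<open>d\<close> tends to 0, summing them to infinity gives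
  \<open>O(n^-(p+1))\<close>. Each round gains one order until the forcing term of order
  \<open>M + 2\<close> becomes the limit.\<close>

lemma bigo_bootstrap:
  fixes d :: "nat \<Rightarrow> real"
  assumes lim: "d \<longlonglongrightarrow> 0" and C: "C \<ge> 0"
    and step: "eventually (\<lambda>n. \<bar>d n - d (n - 1)\<bar>
      \<le> C / real n ^ 2 * (\<bar>d (n - 1)\<bar> + \<bar>d (n - 2)\<bar>) + C / real n ^ (M + 2)) sequentially"
  shows "p \<le> M + 1 \<Longrightarrow> d \<in> O(\<lambda>n. 1 / real n ^ p)"
proof (induction p)
  case 0
  have "Bseq d" using lim convergentI Bseq_conv_Bfun convergent_imp_Bseq by blast
  then obtain K where "\<And>n. norm (d n) \<le> K" unfolding Bseq_def by blast
  then show ?case by (intro bigoI[of _ K]) simp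
next
  case (Suc p)
  then have p: "p \<le> M" "d \<in> O(\<lambda>n. 1 / real n ^ p)" by auto
  obtain c where c: "c > 0" "eventually (\<lambda>n. norm (d n) \<le> c * norm (1 / real n ^ p)) sequentially"
    using p(2) by (elim landau_o.bigE)
  then obtain n1 where n1: "\<And>n. n \<ge> n1 \<Longrightarrow> \<bar>d n\<bar> \<le> c / real n ^ p"
    unfolding eventually_sequentially by auto
  obtain n2 where n2: "\<And>n. n \<ge> n2 \<Longrightarrow> \<bar>d n - d (n - 1)\<bar>
      \<le> C / real n ^ 2 * (\<bar>d (n - 1)\<bar> + \<bar>d (n - 2)\<bar>) + C / real n ^ (M + 2)"
    using step unfolding eventually_sequentially by blast
  define N where "N = n1 + n2 + 4"
  define C' where "C' = C * (2 * c * 2 ^ p + 1)"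
  have C': "C' \<ge> 0" using C c by (simp add: C'_def)
  \<comment> \<open>For \<open>n \<ge> 4\<close> and \<open>j \<le> 2\<close> one has
    \<open>n - j \<ge> n/2\<close>, which costs the factor \<open>2^p\<close>.\<close>
  have shift: "\<bar>d (n - j)\<bar> \<le> c * 2 ^ p / real n ^ p" if "n \<ge> N" "j \<le> 2" for n j
  proof -
    have "real n / 2 \<le> real (n - j)" "real n > 0" "real (n - j) > 0"
      using that by (auto simp: N_def)
    then have "(real n / 2) ^ p \<le> real (n - j) ^ p" "(real n / 2) ^ p > 0" by (auto intro: power_mono)
    then have "c / real (n - j) ^ p \<le> c / (real n / 2) ^ p"
      using c \<open>real (n - j) > 0\<close> by (intro divide_left_mono mult_pos_pos zero_less_power) auto
    moreover have "\<bar>d (n - j)\<bar> \<le> c / real (n - j) ^ p"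
      using that by (intro n1) (auto simp: N_def)
    ultimately show ?thesis by (simp add: power_divide)
  qed
  have diff: "\<bar>d n - d (n - 1)\<bar> \<le> C' / real n ^ p * (1 / real n ^ 2)" if "n \<ge> N" for n
  proof -
    have n: "real n \<ge> 1" using that by (simp add: N_def)
    have "\<bar>d n - d (n - 1)\<bar> \<le> C / real n ^ 2 * (\<bar>d (n - 1)\<bar> + \<bar>d (n - 2)\<bar>) + C / real n ^ (M + 2)"
      using that by (intro n2) (simp add: N_def)
    also have "\<dots> \<le> C / real n ^ 2 * (c * 2 ^ p / real n ^ p + c * 2 ^ p / real n ^ p) + C / real n ^ (p + 2)"
      using C n p that
      by (intro add_mono mult_left_mono divide_left_mono shift power_increasing mult_pos_pos) auto
    also have "\<dots> = C' / real n ^ p * (1 / real n ^ 2)"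
      using n by (simp add: C'_def field_simps power_add power2_eq_square)
    finally show ?thesis .
  qed
  \<comment> \<open>The comparison \<open>1/k^2 \<le> 1/(k-1) - 1/k\<close> telescopes;
    \<open>m\<close> tends to infinity afterwards.\<close>
  have tele: "\<bar>d (n + m) - d n\<bar> \<le> C' / real n ^ p * (1 / real n - 1 / real (n + m))" if n: "n \<ge> N" for n m
  proof (induction m)
    case (Suc m)
    have pos: "real n > 0" "real (n + m) > 0" using n by (auto simp: N_def)
    define k where "k = n + Suc m"
    have "\<bar>d k - d (k - 1)\<bar> \<le> C' / real k ^ p * (1 / real k ^ 2)"
      using n by (intro diff) (simp add: k_def)
    also have "\<dots> \<le> C' / real n ^ p * (1 / real (n + m) - 1 / real k)"
    proof (rule mult_mono)
      show "C' / real k ^ p \<le> C' / real n ^ p"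
        using C' pos by (intro divide_left_mono power_mono mult_pos_pos) (auto simp: k_def)
      have "1 / real (n + m) - 1 / real k = 1 / (real (n + m) * real k)"
        using pos by (simp add: k_def divide_simps)
      also have "\<dots> \<ge> 1 / (real k * real k)"
        using pos by (intro divide_left_mono mult_right_mono mult_pos_pos) (auto simp: k_def)
      finally show "1 / real k ^ 2 \<le> 1 / real (n + m) - 1 / real k"
        by (simp add: power2_eq_square)
    qed (use C' pos in auto)
    finally have "\<bar>d (n + Suc m) - d (n + m)\<bar> \<le> C' / real n ^ p * (1 / real (n + m) - 1 / real k)"
      by (simp add: k_def)
    then have "\<bar>d (n + Suc m) - d n\<bar> \<le> C' / real n ^ p * (1 / real (n + m) - 1 / real k)
        + C' / real n ^ p * (1 / real n - 1 / real (n + m))"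
      using Suc by linarith
    also have "\<dots> = C' / real n ^ p * (1 / real n - 1 / real k)"
      by (simp add: algebra_simps)
    finally show ?case by (simp add: k_def)
  qed simp
  show ?case
  proof (rule bigoI)
    show "eventually (\<lambda>n. norm (d n) \<le> C' * norm (1 / real n ^ Suc p)) sequentially"
      using eventually_ge_at_top[of N]
    proof eventually_elim
      case (elim n)
      have "(\<lambda>m. \<bar>d (n + m) - d n\<bar>) \<longlonglongrightarrow> \<bar>0 - d n\<bar>"
        using LIMSEQ_ignore_initial_segment[OF lim, of n]
        by (intro tendsto_intros) (simp add: add.commute)
      moreover have "\<bar>d (n + m) - d n\<bar> \<le> C' / real n ^ Suc p" for m
      proof -
        have "C' / real n ^ p * (1 / real n - 1 / real (n + m)) \<le> C' / real n ^ p * (1 / real n)"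
          using C' by (intro mult_left_mono) auto
        then show ?thesis using tele[OF elim, of m] by (simp add: mult.commute)
      qed
      ultimately have "\<bar>0 - d n\<bar> \<le> C' / real n ^ Suc p"
        by (intro LIMSEQ_le_const2) auto
      then show ?case by simp
    qed
  qed
qed

text \<open>The base 4/5 covers both exponentially small errors: \<open>pi < 4\<close> gives
  \<open>(8/27) / (6/pi^2) \<le> 64/81\<close> and \<open>pi^2/144 \<le> 1/9\<close>.\<close>

lemma exp_decay_bigo: "(\<lambda>n. (real n + 1) * (4/5) ^ n) \<in> O(\<lambda>n. 1 / real n ^ m)"
proof -
  have "(\<lambda>n. (real n + 1) * (4/5) ^ n) \<in> O(\<lambda>n. real n powr (- real m))"
    by real_asymp
  also have "(\<lambda>n. real n powr (- real m)) \<in> O(\<lambda>n. 1 / real n ^ m)"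
  proof (intro landau_o.big_mono eventually_mono[OF eventually_gt_at_top[of 0]])
    fix n :: nat assume "n > 0"
    then show "norm (real n powr - real m) \<le> norm (1 / real n ^ m)"
      by (simp add: powr_minus powr_realpow inverse_eq_divide)
  qed
  finally show ?thesis .
qed

lemma main_term_truncation_step:
  fixes n M :: nat
  assumes "n \<ge> 3"
  defines "Y \<equiv> \<lambda>x. \<Sum>l\<le>M. asym_coeff l * x ^ l" and "x \<equiv> 1 / real n"
  shows "Y x - (1 + 1 / (2 * real n)) * sqrt (1 - 1 / real n) * Y (1 / real (n - 1))
    + pi\<^sup>2 / 144 / (real n * (real n - 1)) * sqrt (1 - 2 / real n) * Y (1 / real (n - 2))
    = (\<Sum>l\<le>M. asym_coeff l * (x ^ l * defect_fun l x))"
proof -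
  have n: "real n \<ge> 3" using assms(1) by simp
  have pos: "1 - x > 0" "1 - 2 * x > 0" "x \<noteq> 0" using n by (auto simp: x_def field_simps)
  have shift: "sqrt (1 - c * x) * (1 / (real n - c)) ^ l = x ^ l * (1 - c * x) powr (1/2 - real l)"
    if "1 - c * x > 0" for c l
  proof -
    have "1 / (real n - c) = x / (1 - c * x)"
      using n that by (simp add: x_def field_simps)
    then have "sqrt (1 - c * x) * (1 / (real n - c)) ^ l = x ^ l * (sqrt (1 - c * x) / (1 - c * x) ^ l)"
      by (simp add: power_divide)
    also have "sqrt (1 - c * x) / (1 - c * x) ^ l = (1 - c * x) powr (1/2 - real l)"
      using that by (simp add: powr_diff powr_half_sqrt powr_realpow)
    finally show ?thesis .
  qed
  have "pi\<^sup>2 / 144 / (real n * (real n - 1)) = pi\<^sup>2 / 144 * x\<^sup>2 * inverse (1 - x)"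
    using n by (simp add: x_def field_simps power2_eq_square)
  moreover have "real (n - 1) = real n - 1" "real (n - 2) = real n - 2" using assms(1) by auto
  moreover have "1 / real n = 1 * x" "2 / real n = 2 * x" "1 / (2 * real n) = x * (1/2)" by (simp_all add: x_def)
  ultimately have "Y x - (1 + 1 / (2 * real n)) * sqrt (1 - 1 / real n) * Y (1 / real (n - 1))
    + pi\<^sup>2 / 144 / (real n * (real n - 1)) * sqrt (1 - 2 / real n) * Y (1 / real (n - 2))
    = Y x - (1 + x * (1/2)) * (sqrt (1 - 1 * x) * Y (1 / (real n - 1)))
    + pi\<^sup>2 / 144 * x\<^sup>2 * inverse (1 - x) * (sqrt (1 - 2 * x) * Y (1 / (real n - 2)))"
    by (simp only: mult.assoc)
  also have "sqrt (1 - 1 * x) * Y (1 / (real n - 1)) = (\<Sum>l\<le>M. asym_coeff l * (x ^ l * (1 - 1 * x) powr (1/2 - real l)))"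
    unfolding Y_def sum_distrib_left
    by (intro sum.cong refl) (use shift[of 1] pos in \<open>simp add: mult.left_commute\<close>)
  also have "sqrt (1 - 2 * x) * Y (1 / (real n - 2)) = (\<Sum>l\<le>M. asym_coeff l * (x ^ l * (1 - 2 * x) powr (1/2 - real l)))"
    unfolding Y_def sum_distrib_left
    by (intro sum.cong refl) (use shift[of 2] pos in \<open>simp add: mult.left_commute\<close>)
  finally show ?thesis
    unfolding Y_def sum_distrib_left sum_subtractf[symmetric] sum.distrib[symmetric]
    by (simp add: defect_fun_def algebra_simps)
qed

text \<open>The truncated formal solution, scaled to the limit of \<open>main_term\<close>,
  satisfies the same recurrence up to forcing of order \<open>n^-(M+2)\<close>. The difference
  \<open>d\<close> thus tends to 0 and has small increments.\<close>

theorem main_term_expansion: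
  "(\<lambda>n. main_term n - 2 / sqrt pi * (\<Sum>l\<le>M. asym_coeff l / real n ^ l)) \<in> O(\<lambda>n. 1 / real n ^ (M + 1))"
proof -
  define Y where "Y = (\<lambda>x. \<Sum>l\<le>M. asym_coeff l * x ^ l)"
  define k where "k = 2 / sqrt pi"
  define d where "d = (\<lambda>n. main_term n - k * Y (1 / real n))"
  define E where "E = (\<lambda>x. \<Sum>l\<le>M. asym_coeff l * (x ^ l * defect_fun l x))"
  define A where "A = (\<lambda>n. (1 + 1 / (2 * real n)) * sqrt (1 - 1 / real n))"
  define B where "B = (\<lambda>n. pi\<^sup>2 / 144 / (real n * (real n - 1)) * sqrt (1 - 2 / real n))"
  define t where "t = (\<lambda>n. (pi\<^sup>2 / 144) ^ n / ((fact n)\<^sup>2 * sqrt (real n)))"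
  have "(\<lambda>n. Y (1 / real n)) \<longlonglongrightarrow> Y 0"
    unfolding Y_def by (intro tendsto_intros lim_1_over_n)
  moreover have "Y 0 = 1"
    unfolding Y_def by (simp add: power_0_left asym_coeff_0 if_distrib[of "\<lambda>x. _ * x"] cong: if_cong)
  ultimately have "(\<lambda>n. main_term n - k * Y (1 / real n)) \<longlonglongrightarrow> 2 / sqrt pi - k * 1"
    by (intro tendsto_intros main_term_tendsto) simp
  then have lim: "d \<longlonglongrightarrow> 0" by (simp add: d_def k_def)
  have step: "d n - d (n - 1) = (A n - 1) * d (n - 1) - B n * d (n - 2) + t n - k * E (1 / real n)"
    if "n \<ge> 3" for n
  proof -
    have "Y (1 / real n) = A n * Y (1 / real (n - 1)) - B n * Y (1 / real (n - 2)) + E (1 / real n)"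
      using main_term_truncation_step[OF that, of M] unfolding Y_def A_def B_def E_def by linarith
    moreover have "main_term n = A n * main_term (n - 1) - B n * main_term (n - 2) + t n"
      using main_term_rec[OF that] by (simp only: A_def B_def t_def)
    ultimately have "d n = A n * main_term (n - 1) - B n * main_term (n - 2) + t n
      - k * (A n * Y (1 / real (n - 1)) - B n * Y (1 / real (n - 2)) + E (1 / real n))"
      by (simp only: d_def)
    also have "\<dots> = A n * d (n - 1) - B n * d (n - 2) + t n - k * E (1 / real n)"
      by (simp add: d_def algebra_simps)
    finally show ?thesis by (simp add: algebra_simps)
  qed
  \<comment> \<open>The terms of order \<open>1/n\<close> in \<open>1 + 1/(2n)\<close> and
    \<open>sqrt (1 - 1/n)\<close> cancel; this is the effect of the factor \<open>sqrt n\<close> in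
    the normalisation.\<close>
  have "(\<lambda>n. A n - 1) \<in> O(\<lambda>n. 1 / real n ^ 2)"
    unfolding A_def by real_asymp
  then obtain c1 where c1: "c1 > 0" "eventually (\<lambda>n. norm (A n - 1) \<le> c1 * norm (1 / real n ^ 2)) sequentially"
    by (elim landau_o.bigE)
  have "B \<in> O(\<lambda>n. 1 / real n ^ 2)"
    unfolding B_def by real_asymp
  then obtain c2 where c2: "c2 > 0" "eventually (\<lambda>n. norm (B n) \<le> c2 * norm (1 / real n ^ 2)) sequentially"
    by (elim landau_o.bigE)
  have "t \<in> O(\<lambda>n. (real n + 1) * (4/5) ^ n)"
  proof (intro landau_o.big_mono eventually_mono[OF eventually_gt_at_top[of 0]])
    fix n :: nat assume n: "n > 0"
    have "pi\<^sup>2 \<le> 4\<^sup>2" using pi_less_4 by (intro power_mono) auto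
    then have "(pi\<^sup>2 / 144) ^ n \<le> (4/5 :: real) ^ n" by (intro power_mono) auto
    moreover have "(fact n)\<^sup>2 * sqrt (real n) \<ge> (1 :: real)"
    proof -
      have "(fact n)\<^sup>2 \<ge> (1 :: real)" by (intro one_le_power) simp
      then show ?thesis using n mult_mono[of 1 "(fact n)\<^sup>2 :: real" 1 "sqrt (real n)"] by simp
    qed
    ultimately have "t n \<le> (4/5) ^ n / 1"
      unfolding t_def by (intro frac_le) auto
    also have "\<dots> \<le> (real n + 1) * (4/5) ^ n" by simp
    finally show "norm (t n) \<le> norm ((real n + 1) * (4/5) ^ n)"
      by (simp add: t_def)
  qed
  from landau_o.big_trans[OF this exp_decay_bigo[of "M + 2"]]
  obtain c3 where c3: "c3 > 0" "eventually (\<lambda>n. norm (t n) \<le> c3 * norm (1 / real n ^ (M + 2))) sequentially"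
    by (elim landau_o.bigE)
  obtain c4 where c4: "eventually (\<lambda>x. \<bar>E x\<bar> \<le> c4 * \<bar>x\<bar> ^ (M + 2)) (nhds 0)"
    using truncated_defect[of M] unfolding E_def by blast
  then have c4: "eventually (\<lambda>n. \<bar>E (1 / real n)\<bar> \<le> c4 * \<bar>1 / real n\<bar> ^ (M + 2)) sequentially"
    by (rule eventually_compose_filterlim[OF _ lim_1_over_n])
  define C where "C = c1 + c2 + c3 + k * \<bar>c4\<bar>"
  have C: "C \<ge> 0" "c1 \<le> C" "c2 \<le> C" "c3 + k * \<bar>c4\<bar> \<le> C"
    using c1 c2 c3 by (auto simp: C_def k_def)
  have "d \<in> O(\<lambda>n. 1 / real n ^ (M + 1))"
  proof (rule bigo_bootstrap[OF lim C(1)])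
    show "eventually (\<lambda>n. \<bar>d n - d (n - 1)\<bar>
      \<le> C / real n ^ 2 * (\<bar>d (n - 1)\<bar> + \<bar>d (n - 2)\<bar>) + C / real n ^ (M + 2)) sequentially"
      using c1(2) c2(2) c3(2) c4 eventually_ge_at_top[of 3]
    proof eventually_elim
      case (elim n)
      have n: "real n > 0" using elim by simp
      have "\<bar>d n - d (n - 1)\<bar> \<le> \<bar>A n - 1\<bar> * \<bar>d (n - 1)\<bar> + \<bar>B n\<bar> * \<bar>d (n - 2)\<bar> + \<bar>t n\<bar> + k * \<bar>E (1 / real n)\<bar>"
      proof -
        have "k * \<bar>E (1 / real n)\<bar> = \<bar>k * E (1 / real n)\<bar>" by (simp add: abs_mult k_def)
        then show ?thesis
          unfolding step[OF elim(5)] abs_mult[symmetric] by linarith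
      qed
      also have "\<dots> \<le> C / real n ^ 2 * \<bar>d (n - 1)\<bar> + C / real n ^ 2 * \<bar>d (n - 2)\<bar>
          + c3 / real n ^ (M + 2) + k * (\<bar>c4\<bar> / real n ^ (M + 2))"
      proof (intro add_mono mult_right_mono mult_left_mono)
        have "\<bar>A n - 1\<bar> \<le> c1 / real n ^ 2" using elim(1) by simp
        also have "\<dots> \<le> C / real n ^ 2" using C by (intro divide_right_mono) auto
        finally show "\<bar>A n - 1\<bar> \<le> C / real n ^ 2" .
        have "\<bar>B n\<bar> \<le> c2 / real n ^ 2" using elim(2) by simp
        also have "\<dots> \<le> C / real n ^ 2" using C by (intro divide_right_mono) auto
        finally show "\<bar>B n\<bar> \<le> C / real n ^ 2" .
        show "\<bar>t n\<bar> \<le> c3 / real n ^ (M + 2)" using elim(3) n by simp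
        have "\<bar>E (1 / real n)\<bar> \<le> c4 / real n ^ (M + 2)"
          using elim(4) n by (simp add: power_divide)
        also have "\<dots> \<le> \<bar>c4\<bar> / real n ^ (M + 2)" by (intro divide_right_mono) auto
        finally show "\<bar>E (1 / real n)\<bar> \<le> \<bar>c4\<bar> / real n ^ (M + 2)" .
      qed (auto simp: k_def)
      also have "\<dots> = C / real n ^ 2 * (\<bar>d (n - 1)\<bar> + \<bar>d (n - 2)\<bar>) + (c3 + k * \<bar>c4\<bar>) / real n ^ (M + 2)"
        by (simp add: distrib_left add_divide_distrib)
      also have "\<dots> \<le> C / real n ^ 2 * (\<bar>d (n - 1)\<bar> + \<bar>d (n - 2)\<bar>) + C / real n ^ (M + 2)"
        using C by (intro add_left_mono divide_right_mono) auto
      finally show ?case .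
    qed
  qed simp
  then show ?thesis
    by (simp add: d_def k_def Y_def power_one_over field_simps)
qed

section \<open>Expansion of the number of interval orders\<close>

definition leading_coeff :: real where
  "leading_coeff = 12 * sqrt 3 / pi powr (5 / 2)"

lemma leading_coeff_eq: "leading_coeff = 18 / (pi\<^sup>2 * sqrt 3) * (2 / sqrt pi)"
proof -
  have "pi powr (5/2) = pi powr (2 + 1/2)" by simp
  also have "\<dots> = pi\<^sup>2 * sqrt pi"
    by (subst powr_add) (simp add: powr_half_sqrt powr_numeral)
  finally have "leading_coeff = 12 * sqrt 3 / (pi\<^sup>2 * sqrt pi)"
    by (simp add: leading_coeff_def)
  also have "12 * sqrt 3 = 36 / sqrt 3"
    by (simp add: field_simps)
  finally show ?thesis by (simp add: mult_ac)
qed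

definition normalized_count :: "nat \<Rightarrow> real" where
  "normalized_count n = real (num_labelled_interval_orders n) / ((fact n)\<^sup>2 * sqrt (real n) * (6 / pi\<^sup>2) ^ n)"

text \<open>The discarded part grows at most like \<open>(n+1)! (8/27)^n\<close> against
  \<open>n! (6/pi^2)^n\<close>, and \<open>8/27 < 6/pi^2\<close>.\<close>

lemma normalized_count_main_term:
  "(\<lambda>n. normalized_count n - 18 / (pi\<^sup>2 * sqrt 3) * main_term n) \<in> O(\<lambda>n. 1 / real n ^ m)"
proof -
  let ?c = "18 / (pi\<^sup>2 * sqrt 3) :: real"
  obtain B where B: "\<And>n. \<bar>real (num_labelled_interval_orders n) - fact n * (?c * conv_sum beta n)\<bar>
    \<le> fact n * (B * conv_sum (2/27) n)"
    using num_labelled_interval_orders_conv_sum by blast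
  define K :: real where "K = exp (1 / (96 * (2/27)))"
  have q: "4 * beta = 6 / pi\<^sup>2" by (simp add: beta_def)
  have "(\<lambda>n. normalized_count n - ?c * main_term n) \<in> O(\<lambda>n. (real n + 1) * (4/5) ^ n)"
  proof (intro bigoI[of _ "\<bar>B\<bar> * K"] eventually_mono[OF eventually_gt_at_top[of 0]])
    fix n :: nat assume n: "n > 0"
    define V where "V = (fact n)\<^sup>2 * sqrt (real n) * (6 / pi\<^sup>2) ^ n"
    have V: "V > 0" using n by (simp add: V_def)
    have "normalized_count n - ?c * main_term n
      = (real (num_labelled_interval_orders n) - fact n * (?c * conv_sum beta n)) / V"
    proof -
      have "main_term n = fact n * conv_sum beta n / V"
        unfolding main_term_def q V_def by (simp add: power2_eq_square)
      then show ?thesis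
        by (simp add: normalized_count_def V_def diff_divide_distrib)
    qed
    also have "norm \<dots> \<le> fact n * (B * conv_sum (2/27) n) / V"
      using B[of n] V by (simp add: abs_divide divide_right_mono)
    also have "\<dots> \<le> fact n * (\<bar>B\<bar> * (K * fact (Suc n) * (8/27) ^ n)) / V"
    proof (intro divide_right_mono mult_left_mono mult_mono)
      show "conv_sum (2/27) n \<le> K * fact (Suc n) * (8/27) ^ n"
        using conv_sum_le[of "2/27" n] by (simp add: K_def)
    qed (use V in \<open>auto simp: conv_sum_nonneg\<close>)
    also have "\<dots> = \<bar>B\<bar> * K * (real n + 1) * ((8/27) ^ n / (6 / pi\<^sup>2) ^ n) / sqrt (real n)"
      using n by (simp add: V_def power2_eq_square field_simps)
    also have "\<dots> \<le> \<bar>B\<bar> * K * (real n + 1) * (4/5) ^ n / 1"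
    proof (intro frac_le mult_left_mono)
      have "pi\<^sup>2 \<le> 4\<^sup>2" using pi_less_4 by (intro power_mono) auto
      then have "(8/27) / (6 / pi\<^sup>2) \<le> (4/5 :: real)" by simp
      then show "(8/27) ^ n / (6 / pi\<^sup>2) ^ n \<le> (4/5 :: real) ^ n"
        unfolding power_divide[symmetric] by (intro power_mono) auto
    qed (use n in \<open>auto simp: K_def\<close>)
    finally show "norm (normalized_count n - ?c * main_term n)
      \<le> \<bar>B\<bar> * K * norm ((real n + 1) * (4/5) ^ n)" by simp
  qed
  from landau_o.big_trans[OF this exp_decay_bigo] show ?thesis .
qed

theorem normalized_count_expansion:
  "(\<lambda>n. normalized_count n - (\<Sum>i=0..m. leading_coeff * asym_coeff i / real n ^ i)) \<in> O(\<lambda>n. 1 / real n ^ (m + 1))"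
proof -
  define c where "c = 18 / (pi\<^sup>2 * sqrt 3)"
  have "(\<lambda>n. c * (main_term n - 2 / sqrt pi * (\<Sum>l\<le>m. asym_coeff l / real n ^ l))) \<in> O(\<lambda>n. 1 / real n ^ (m + 1))"
    using main_term_expansion[of m] by simp
  from sum_in_bigo(1)[OF normalized_count_main_term[folded c_def] this]
  have "(\<lambda>n. (normalized_count n - c * main_term n)
    + c * (main_term n - 2 / sqrt pi * (\<Sum>l\<le>m. asym_coeff l / real n ^ l))) \<in> O(\<lambda>n. 1 / real n ^ (m + 1))" .
  moreover have "(normalized_count n - c * main_term n)
    + c * (main_term n - 2 / sqrt pi * (\<Sum>l\<le>m. asym_coeff l / real n ^ l))
    = normalized_count n - (\<Sum>i=0..m. leading_coeff * asym_coeff i / real n ^ i)" for n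
    unfolding leading_coeff_eq c_def[symmetric] atLeast0AtMost
    by (simp add: sum_distrib_left right_diff_distrib mult.assoc)
  ultimately show ?thesis by (simp only:)
qed

lemma num_labelled_interval_orders_expansion:
  "\<exists>R. R \<in> O(\<lambda>n. 1 / real n ^ (m + 1)) \<and>
     (\<forall>n\<ge>1. real (num_labelled_interval_orders n) =
        (fact n)\<^sup>2 * sqrt (real n) * (6 / pi\<^sup>2) ^ n *
        ((\<Sum>i=0..m. leading_coeff * asym_coeff i / real n ^ i) + R n))"
  using normalized_count_expansion[of m]
  by (intro exI[of _ "\<lambda>n. normalized_count n - (\<Sum>i=0..m. leading_coeff * asym_coeff i / real n ^ i)"])
    (simp add: normalized_count_def)

section \<open>Recursive functions\<close>

text \<open>Extensional closure of \<^const>\<open>total_recursive\<close>: only the values on lists of length \<open>k\<close> matter.\<close>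

definition trec :: "nat \<Rightarrow> (nat list \<Rightarrow> nat) \<Rightarrow> bool" where
  "trec k f \<longleftrightarrow> (\<exists>g. total_recursive k g \<and> (\<forall>xs. length xs = k \<longrightarrow> g xs = f xs))"

lemma trec_cong: "trec k f \<Longrightarrow> (\<And>xs. length xs = k \<Longrightarrow> f xs = g xs) \<Longrightarrow> trec k g"
  unfolding trec_def by metis

lemma trec_total_recursive: "total_recursive k f \<Longrightarrow> trec k f"
  unfolding trec_def by blast

lemma trec_comp:
  assumes f: "trec (length gs) f" and gs: "\<And>g. g \<in> set gs \<Longrightarrow> trec k g"
  shows "trec k (\<lambda>xs. f (map (\<lambda>g. g xs) gs))"
proof -
  obtain f' where f': "total_recursive (length gs) f'" "\<And>xs. length xs = length gs \<Longrightarrow> f' xs = f xs"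
    using f unfolding trec_def by blast
  have "\<forall>g\<in>set gs. \<exists>g'. total_recursive k g' \<and> (\<forall>xs. length xs = k \<longrightarrow> g' xs = g xs)"
    using gs unfolding trec_def by blast
  from bchoice[OF this] obtain c where
    c: "\<And>g. g \<in> set gs \<Longrightarrow> total_recursive k (c g)"
       "\<And>g xs. g \<in> set gs \<Longrightarrow> length xs = k \<Longrightarrow> c g xs = g xs" by blast
  have "total_recursive k (\<lambda>xs. f' (map (\<lambda>g. g xs) (map c gs)))"
    by (rule total_recursive.Comp) (use f' c in auto)
  then show ?thesis
  proof (rule trec_cong[OF trec_total_recursive])
    fix xs :: "nat list" assume "length xs = k"
    then have "map (\<lambda>g. g xs) (map c gs) = map (\<lambda>g. g xs) gs" using c by simp
    then show "f' (map (\<lambda>g. g xs) (map c gs)) = f (map (\<lambda>g. g xs) gs)"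
      by (simp only: f'(2) length_map)
  qed
qed

lemma trec_nth: "i < k \<Longrightarrow> trec k (\<lambda>xs. xs ! i)"
  by (rule trec_total_recursive, rule total_recursive.Proj)

text \<open>Bound variables and precisions are kept at the end of argument lists throughout, so
  substitution retains a prefix and replaces the rest.\<close>

lemma trec_app:
  assumes f: "trec (k + length gs) f" and "k \<le> j" and gs: "\<And>g. g \<in> set gs \<Longrightarrow> trec j g"
  shows "trec j (\<lambda>xs. f (take k xs @ map (\<lambda>g. g xs) gs))"
proof -
  let ?hs = "map (\<lambda>i xs. xs ! i) [0..<k] @ gs"
  have "trec j (\<lambda>xs. f (map (\<lambda>g. g xs) ?hs))"
    by (rule trec_comp) (use assms in \<open>auto intro: trec_nth\<close>)
  then show ?thesis
  proof (rule trec_cong)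
    fix xs :: "nat list" assume "length xs = j"
    then have "map (\<lambda>g. g xs) (map (\<lambda>i xs. xs ! i) [0..<k]) = take k xs"
      using \<open>k \<le> j\<close> by (auto intro!: nth_equalityI)
    then show "f (map (\<lambda>g. g xs) ?hs) = f (take k xs @ map (\<lambda>g. g xs) gs)" by simp
  qed
qed

lemma trec_comp1: "trec 1 (\<lambda>xs. F (xs ! 0)) \<Longrightarrow> trec k g \<Longrightarrow> trec k (\<lambda>xs. F (g xs))"
  using trec_comp[of "[g]" "\<lambda>xs. F (xs ! 0)" k] by simp

lemma trec_comp2:
  "trec 2 (\<lambda>xs. F (xs ! 0) (xs ! 1)) \<Longrightarrow> trec k g \<Longrightarrow> trec k h \<Longrightarrow> trec k (\<lambda>xs. F (g xs) (h xs))"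
  using trec_comp[of "[g, h]" "\<lambda>xs. F (xs ! 0) (xs ! 1)" k] by (auto simp: numeral_2_eq_2)

lemma trec_weaken: "trec k f \<Longrightarrow> k \<le> j \<Longrightarrow> trec j (\<lambda>xs. f (take k xs))"
  using trec_app[of k "[]" f j] by simp

lemma trec_Suc:
  assumes "trec k f"
  shows "trec k (\<lambda>xs. Suc (f xs))"
proof (rule trec_comp1[OF _ assms])
  show "trec 1 (\<lambda>xs. Suc (xs ! 0))"
    by (rule trec_cong[OF trec_total_recursive[OF total_recursive.Succ]]) (auto simp: length_Suc_conv)
qed

lemma trec_const: "trec k (\<lambda>_. c)"
  by (induction c) (auto intro: trec_Suc trec_total_recursive total_recursive.Zero)

lemma trec_rec:
  assumes f: "trec k f" and G: "trec (k + 2) G" and b: "trec k b"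
  shows "trec k (\<lambda>xs. rec_nat (f xs) (\<lambda>n v. G (n # v # xs)) (b xs))"
proof -
  obtain f' where f': "total_recursive k f'" "\<And>xs. length xs = k \<Longrightarrow> f' xs = f xs"
    using f unfolding trec_def by blast
  obtain G' where G': "total_recursive (k + 2) G'" "\<And>xs. length xs = k + 2 \<Longrightarrow> G' xs = G xs"
    using G unfolding trec_def by blast
  define h where "h = (\<lambda>ys. rec_nat (f' (tl ys)) (\<lambda>n v. G' (n # v # tl ys)) (hd ys))"
  have h: "total_recursive (k + 1) h"
    unfolding h_def by (rule total_recursive.Prim[OF f'(1) G'(1)])
  let ?gs = "b # map (\<lambda>i xs. xs ! i) [0..<k]"
  have "trec k (\<lambda>xs. h (map (\<lambda>g. g xs) ?gs))"
    by (rule trec_comp) (use trec_total_recursive[OF h] b in \<open>auto intro: trec_nth\<close>)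
  then show ?thesis
  proof (rule trec_cong)
    fix xs :: "nat list" assume xs: "length xs = k"
    then have "map (\<lambda>g. g xs) ?gs = b xs # xs"
      by (auto intro!: nth_equalityI)
    then have "h (map (\<lambda>g. g xs) ?gs) = rec_nat (f' xs) (\<lambda>n v. G' (n # v # xs)) (b xs)"
      by (simp only: h_def list.sel)
    also have "\<dots> = rec_nat (f xs) (\<lambda>n v. G (n # v # xs)) (b xs)"
      using xs f'(2) G'(2) by simp
    finally show "h (map (\<lambda>g. g xs) ?gs) = rec_nat (f xs) (\<lambda>n v. G (n # v # xs)) (b xs)" .
  qed
qed

lemma trec_add:
  assumes "trec k f" "trec k g"
  shows "trec k (\<lambda>xs. f xs + g xs)"
proof (rule trec_comp2[OF _ assms])
  have "trec 2 (\<lambda>xs. rec_nat (xs ! 0) (\<lambda>n v. Suc ((n # v # xs) ! 1)) (xs ! 1))"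
    by (rule trec_rec) (intro trec_Suc trec_nth, simp)+
  moreover have "rec_nat x (\<lambda>n v. Suc v) y = x + y" for x y :: nat by (induction y) auto
  ultimately show "trec 2 (\<lambda>xs. xs ! 0 + xs ! 1)" by simp
qed

lemma trec_mult:
  assumes "trec k f" "trec k g"
  shows "trec k (\<lambda>xs. f xs * g xs)"
proof (rule trec_comp2[OF _ assms])
  have "trec 2 (\<lambda>xs. rec_nat 0 (\<lambda>n v. (n # v # xs) ! 1 + (n # v # xs) ! 2) (xs ! 1))"
    by (rule trec_rec[OF trec_const]) (intro trec_add trec_nth; simp)+
  moreover have "rec_nat 0 (\<lambda>n v. v + x) y = x * y" for x y :: nat by (induction y) auto
  ultimately show "trec 2 (\<lambda>xs. xs ! 0 * xs ! 1)" by simp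
qed

lemma trec_diff:
  assumes "trec k f" "trec k g"
  shows "trec k (\<lambda>xs. f xs - g xs)"
proof (rule trec_comp2[OF _ assms])
  have "trec 1 (\<lambda>xs. rec_nat 0 (\<lambda>n v. (n # v # xs) ! 0) (xs ! 0))"
    by (rule trec_rec[OF trec_const]) (intro trec_nth; simp)+
  moreover have "rec_nat 0 (\<lambda>n v. n) y = y - 1" for y :: nat by (cases y) auto
  ultimately have pred: "trec 1 (\<lambda>xs. xs ! 0 - 1)" by simp
  have "trec 2 (\<lambda>xs. rec_nat (xs ! 0) (\<lambda>n v. (n # v # xs) ! 1 - 1) (xs ! 1))"
    by (rule trec_rec) (intro trec_comp1[OF pred] trec_nth; simp)+
  moreover have "rec_nat x (\<lambda>n v. v - 1) y = x - y" for x y :: nat by (induction y) auto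
  ultimately show "trec 2 (\<lambda>xs. xs ! 0 - xs ! 1)" by simp
qed

text \<open>Primitive recursion places the counter and the accumulated value before the parameters;
  sums and products append their index. This lemma converts between the two orders.\<close>

lemma trec_fold:
  assumes F: "trec 2 (\<lambda>xs. F (xs ! 0) (xs ! 1))" and f: "trec (Suc k) f" and b: "trec k b"
  shows "trec k (\<lambda>xs. rec_nat c (\<lambda>n v. F v (f (xs @ [n]))) (b xs))"
proof -
  let ?gs = "map (\<lambda>i xs. xs ! (i + 2)) [0..<k] @ [\<lambda>xs. xs ! 0]"
  have "trec (k + 2) (\<lambda>ys. f (map (\<lambda>g. g ys) ?gs))"
    by (rule trec_comp) (use f in \<open>auto intro: trec_nth\<close>)
  then have "trec (k + 2) (\<lambda>ys. F (ys ! 1) (f (map (\<lambda>g. g ys) ?gs)))"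
    by (intro trec_comp2[OF F] trec_nth) auto
  from trec_rec[OF trec_const this b, of c]
  show ?thesis
  proof (rule trec_cong)
    fix xs :: "nat list" assume "length xs = k"
    then have "map (\<lambda>g. g (n # v # xs)) ?gs = xs @ [n]" for n v
      by (auto intro!: nth_equalityI simp: nth_append)
    then show "rec_nat c (\<lambda>n v. F ((n # v # xs) ! 1) (f (map (\<lambda>g. g (n # v # xs)) ?gs))) (b xs)
      = rec_nat c (\<lambda>n v. F v (f (xs @ [n]))) (b xs)" by simp
  qed
qed

lemma trec_sum:
  assumes "trec (Suc k) f" "trec k b"
  shows "trec k (\<lambda>xs. \<Sum>l<b xs. f (xs @ [l]))"
proof -
  have "rec_nat 0 (\<lambda>n v. v + f (xs @ [n])) m = (\<Sum>l<m. f (xs @ [l]))" for xs m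
    by (induction m) auto
  then show ?thesis
    using trec_fold[of "(+)" k f b 0, OF trec_add[OF trec_nth trec_nth] assms] by simp
qed

lemma trec_prod:
  assumes "trec (Suc k) f" "trec k b"
  shows "trec k (\<lambda>xs. \<Prod>l<b xs. f (xs @ [l]))"
proof -
  have "rec_nat 1 (\<lambda>n v. v * f (xs @ [n])) m = (\<Prod>l<m. f (xs @ [l]))" for xs m
    by (induction m) auto
  then show ?thesis
    using trec_fold[of "(*)" k f b 1, OF trec_mult[OF trec_nth trec_nth] assms] by simp
qed

lemma trec_power:
  assumes "trec k f" "trec k g"
  shows "trec k (\<lambda>xs. f xs ^ g xs)"
proof (rule trec_comp2[OF _ assms])
  have "trec 2 (\<lambda>xs. \<Prod>l<xs ! 1. (xs @ [l]) ! 0)"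
    by (rule trec_prod) (auto intro: trec_nth)
  then show "trec 2 (\<lambda>xs. xs ! 0 ^ xs ! 1)"
    by (rule trec_cong) (simp add: nth_append)
qed

text \<open>With truncated subtraction, \<open>1 - (f - g)\<close> is the indicator.\<close>

lemma trec_le:
  assumes "trec k f" "trec k g"
  shows "trec k (\<lambda>xs. of_bool (f xs \<le> g xs))"
  by (rule trec_cong[OF trec_diff[OF trec_const[of k 1] trec_diff[OF assms]]]) auto

lemma trec_less:
  assumes "trec k f" "trec k g"
  shows "trec k (\<lambda>xs. of_bool (f xs < g xs))"
  using trec_le[OF trec_Suc[OF assms(1)] assms(2)] by (simp add: Suc_le_eq)

lemma trec_eq:
  assumes "trec k f" "trec k g"
  shows "trec k (\<lambda>xs. of_bool (f xs = g xs))"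
  by (rule trec_cong[OF trec_mult[OF trec_le[OF assms] trec_le[OF assms(2,1)]]]) auto

text \<open>The quotient counts the \<open>l < x\<close> with \<open>(l + 1) y \<le> x\<close>. For
  \<open>y = 0\<close> the count would be \<open>x\<close>, so an indicator restores the convention
  \<open>x div 0 = 0\<close>.\<close>

lemma trec_div:
  assumes "trec k f" "trec k g"
  shows "trec k (\<lambda>xs. f xs div g xs)"
proof (rule trec_comp2[OF _ assms])
  have "trec 2 (\<lambda>xs. of_bool (0 < xs ! 1) * (\<Sum>l<xs ! 0. of_bool (Suc ((xs @ [l]) ! 2) * (xs @ [l]) ! 1 \<le> (xs @ [l]) ! 0)))"
    by (intro trec_mult[of 2] trec_sum[of 2] trec_less trec_le trec_Suc trec_const trec_nth trec_mult[of "Suc 2"]) simp_all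
  then show "trec 2 (\<lambda>xs. xs ! 0 div xs ! 1)"
  proof (rule trec_cong)
    fix xs :: "nat list" assume xs: "length xs = 2"
    define x y where "x = xs ! 0" and "y = xs ! 1"
    have "of_bool (0 < y) * (\<Sum>l<x. of_bool (Suc l * y \<le> x)) = x div y"
    proof (cases "y = 0")
      case False
      have "{..<x} \<inter> {l. Suc l * y \<le> x} = {..<x div y}"
      proof -
        have "{l. Suc l * y \<le> x} = {..<x div y}"
          using False
          by (simp only: lessThan_def Suc_le_eq[symmetric] less_eq_div_iff_mult_less_eq neq0_conv)
        moreover have "{..<x div y} \<subseteq> {..<x}" by simp
        ultimately show ?thesis by (simp only: Int_absorb1)
      qed
      moreover have "(\<Sum>l<x. of_bool (Suc l * y \<le> x)) = card ({..<x} \<inter> {l. Suc l * y \<le> x})"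
        by (simp only: sum_of_bool_eq finite_lessThan of_nat_id)
      ultimately show ?thesis using False by (simp only: card_lessThan of_bool_eq neq0_conv mult_1)
    qed simp
    then show "of_bool (0 < xs ! 1) * (\<Sum>l<xs ! 0. of_bool (Suc ((xs @ [l]) ! 2) * (xs @ [l]) ! 1 \<le> (xs @ [l]) ! 0))
      = xs ! 0 div xs ! 1"
      using xs by (simp add: nth_append x_def y_def)
  qed
qed

lemma trec_mod:
  assumes "trec k f" "trec k g"
  shows "trec k (\<lambda>xs. f xs mod g xs)"
  by (rule trec_cong[OF trec_diff[OF assms(1) trec_mult[OF assms(2) trec_div[OF assms]]]])
    (simp add: minus_mult_div_eq_mod)

lemma trec_floor_sqrt:
  assumes "trec k f"
  shows "trec k (\<lambda>xs. floor_sqrt (f xs))"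
proof (rule trec_comp1[OF _ assms])
  have "trec 1 (\<lambda>xs. \<Sum>l<xs ! 0. of_bool (Suc ((xs @ [l]) ! 1) * Suc ((xs @ [l]) ! 1) \<le> (xs @ [l]) ! 0))"
    by (intro trec_mult trec_sum trec_nth trec_le trec_Suc) auto
  then show "trec 1 (\<lambda>xs. floor_sqrt (xs ! 0))"
  proof (rule trec_cong)
    fix xs :: "nat list" assume xs: "length xs = 1"
    define x where "x = xs ! 0"
    have "{l. Suc l * Suc l \<le> x} = {..<floor_sqrt x}"
      by (simp only: lessThan_def power2_eq_square[symmetric] le_floor_sqrt_iff[symmetric] Suc_le_eq)
    moreover have "{..<floor_sqrt x} \<subseteq> {..<x}" using floor_sqrt_le[of x] by simp
    ultimately have "{..<x} \<inter> {l. Suc l * Suc l \<le> x} = {..<floor_sqrt x}"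
      by (simp only: Int_absorb1)
    moreover have "(\<Sum>l<x. of_bool (Suc l * Suc l \<le> x)) = card ({..<x} \<inter> {l. Suc l * Suc l \<le> x})"
      by (simp only: sum_of_bool_eq finite_lessThan of_nat_id)
    ultimately have "(\<Sum>l<x. of_bool (Suc l * Suc l \<le> x)) = floor_sqrt x" by (simp only: card_lessThan)
    then show "(\<Sum>l<xs ! 0. of_bool (Suc ((xs @ [l]) ! 1) * Suc ((xs @ [l]) ! 1) \<le> (xs @ [l]) ! 0)) = floor_sqrt (xs ! 0)"
      using xs by (simp add: nth_append x_def del: mult_Suc mult_Suc_right)
  qed
qed

lemmas trec_intros = trec_nth trec_Suc trec_const trec_add trec_mult trec_diff trec_power trec_le trec_less
  trec_eq trec_div trec_mod

section \<open>Integer-valued recursive functions, as differences of natural ones\<close>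

definition irec :: "nat \<Rightarrow> (nat list \<Rightarrow> int) \<Rightarrow> bool" where
  "irec k F \<longleftrightarrow> (\<exists>p q. trec k p \<and> trec k q \<and> (\<forall>xs. length xs = k \<longrightarrow> F xs = int (p xs) - int (q xs)))"

lemma irecE:
  assumes "irec k F"
  obtains p q where "trec k p" "trec k q" "\<And>xs. length xs = k \<Longrightarrow> F xs = int (p xs) - int (q xs)"
  using assms unfolding irec_def by blast

lemma irecI:
  "trec k p \<Longrightarrow> trec k q \<Longrightarrow> (\<And>xs. length xs = k \<Longrightarrow> F xs = int (p xs) - int (q xs)) \<Longrightarrow> irec k F"
  unfolding irec_def by blast

lemma irec_int: "trec k f \<Longrightarrow> irec k (\<lambda>xs. int (f xs))"
  by (rule irecI[OF _ trec_const[of k 0]]) auto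

lemma irec_const: "irec k (\<lambda>_. c)"
  by (rule irecI[OF trec_const[of k "nat c"] trec_const[of k "nat (- c)"]]) auto

lemma irec_app:
  assumes F: "irec (k + length gs) F" and k: "k \<le> j" and gs: "\<And>g. g \<in> set gs \<Longrightarrow> trec j g"
  shows "irec j (\<lambda>xs. F (take k xs @ map (\<lambda>g. g xs) gs))"
proof -
  obtain p q where pq: "trec (k + length gs) p" "trec (k + length gs) q"
    "\<And>xs. length xs = k + length gs \<Longrightarrow> F xs = int (p xs) - int (q xs)"
    using F by (rule irecE) blast
  show ?thesis
    by (rule irecI[OF trec_app[OF pq(1) k gs] trec_app[OF pq(2) k gs]]) (use pq(3) k in auto)
qed

lemma irec_add:
  assumes F: "irec k F" and G: "irec k G"
  shows "irec k (\<lambda>xs. F xs + G xs)"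
proof -
  obtain p q where pq: "trec k p" "trec k q" "\<And>xs. length xs = k \<Longrightarrow> F xs = int (p xs) - int (q xs)"
    using F by (rule irecE) blast
  obtain r s where rs: "trec k r" "trec k s" "\<And>xs. length xs = k \<Longrightarrow> G xs = int (r xs) - int (s xs)"
    using G by (rule irecE) blast
  show ?thesis
    by (rule irecI[OF trec_add[OF pq(1) rs(1)] trec_add[OF pq(2) rs(2)]]) (use pq(3) rs(3) in auto)
qed

lemma irec_mult:
  assumes F: "irec k F" and G: "irec k G"
  shows "irec k (\<lambda>xs. F xs * G xs)"
proof -
  obtain p q where pq: "trec k p" "trec k q" "\<And>xs. length xs = k \<Longrightarrow> F xs = int (p xs) - int (q xs)"
    using F by (rule irecE) blast
  obtain r s where rs: "trec k r" "trec k s" "\<And>xs. length xs = k \<Longrightarrow> G xs = int (r xs) - int (s xs)"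
    using G by (rule irecE) blast
  show ?thesis
  proof (rule irecI)
    show "trec k (\<lambda>xs. p xs * r xs + q xs * s xs)" "trec k (\<lambda>xs. p xs * s xs + q xs * r xs)"
      by (intro trec_add trec_mult pq rs)+
    fix xs :: "nat list" assume "length xs = k"
    then show "F xs * G xs = int (p xs * r xs + q xs * s xs) - int (p xs * s xs + q xs * r xs)"
      by (simp only: pq(3) rs(3) of_nat_add of_nat_mult) (simp add: algebra_simps)
  qed
qed

lemma irec_diff:
  assumes "irec k F" "irec k G"
  shows "irec k (\<lambda>xs. F xs - G xs)"
  using irec_add[OF assms(1) irec_mult[OF irec_const[of k "-1"] assms(2)]] by simp

lemma irec_sum:
  assumes F: "irec (Suc k) F" and b: "trec k b"
  shows "irec k (\<lambda>xs. \<Sum>l<b xs. F (xs @ [l]))"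
proof -
  obtain p q where pq: "trec (Suc k) p" "trec (Suc k) q"
    "\<And>xs. length xs = Suc k \<Longrightarrow> F xs = int (p xs) - int (q xs)"
    using F by (rule irecE) blast
  show ?thesis
    by (rule irecI[OF trec_sum[OF pq(1) b] trec_sum[OF pq(2) b]]) (simp add: pq(3) sum_subtractf)
qed

text \<open>The absolute value of the product is a product of natural numbers; its sign is the parity of
  the number of negative factors.\<close>

lemma irec_prod:
  assumes F: "irec (Suc k) F" and b: "trec k b"
  shows "irec k (\<lambda>xs. \<Prod>l<b xs. F (xs @ [l]))"
proof -
  obtain p q where pq: "trec (Suc k) p" "trec (Suc k) q"
    "\<And>xs. length xs = Suc k \<Longrightarrow> F xs = int (p xs) - int (q xs)"
    using F by (rule irecE) blast
  define m where "m = (\<lambda>xs. \<Prod>l<b xs. (p (xs @ [l]) - q (xs @ [l])) + (q (xs @ [l]) - p (xs @ [l])))"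
  define s where "s = (\<lambda>xs. (\<Sum>l<b xs. of_bool (p (xs @ [l]) < q (xs @ [l]))) mod 2 :: nat)"
  have m: "trec k m"
    unfolding m_def by (rule trec_prod[OF trec_add[OF trec_diff[OF pq(1,2)] trec_diff[OF pq(2,1)]] b])
  have s: "trec k s"
    unfolding s_def by (rule trec_mod[OF trec_sum[OF trec_less[OF pq(1,2)] b] trec_const])
  have eq: "(\<Prod>l<n. int (x l) - int (y l))
    = int (\<Prod>l<n. (x l - y l) + (y l - x l)) * (1 - 2 * int ((\<Sum>l<n. of_bool (x l < y l)) mod 2))"
    for x y :: "nat \<Rightarrow> nat" and n
  proof (induction n)
    case (Suc n)
    define c where "c = (\<Sum>l<n. of_bool (x l < y l) :: nat)"
    show ?case
    proof (cases "x n < y n")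
      case True
      have f1: "1 - 2 * int (Suc c mod 2) = - (1 - 2 * int (c mod 2))"
        by (simp add: mod_Suc)
      have f2: "int ((x n - y n) + (y n - x n)) = - (int (x n) - int (y n))"
        using True by simp
      have f3: "(\<Sum>l<Suc n. of_bool (x l < y l)) = Suc c"
        using True by (simp add: c_def)
      show ?thesis
        unfolding prod.lessThan_Suc of_nat_mult f3 f2 f1 Suc[folded c_def]
        by (simp only: mult_ac mult_minus_left mult_minus_right minus_minus)
    next
      case False
      then show ?thesis
        using Suc by (simp add: of_nat_diff)
    qed
  qed simp
  show ?thesis
  proof (rule irecI)
    show "trec k (\<lambda>xs. m xs * (1 - s xs))" "trec k (\<lambda>xs. m xs * s xs)"
      by (intro trec_intros m s)+
    fix xs :: "nat list" assume "length xs = k"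
    then have "(\<Prod>l<b xs. F (xs @ [l])) = int (m xs) * (1 - 2 * int (s xs))"
      by (simp add: pq(3) eq m_def s_def)
    moreover have "s xs = 0 \<or> s xs = 1" by (auto simp: s_def)
    ultimately show "(\<Prod>l<b xs. F (xs @ [l])) = int (m xs * (1 - s xs)) - int (m xs * s xs)"
      by auto
  qed
qed

section \<open>Computable real functions\<close>

text \<open>The precision \<open>N\<close> is passed as the last argument of the approximating functions.\<close>

definition creal :: "nat \<Rightarrow> (nat list \<Rightarrow> real) \<Rightarrow> bool" where
  "creal k E \<longleftrightarrow> (\<exists>F d. irec (Suc k) F \<and> trec (Suc k) d \<and>
     (\<forall>xs N. length xs = k \<longrightarrow> d (xs @ [N]) > 0 \<and>
        \<bar>E xs - of_int (F (xs @ [N])) / real (d (xs @ [N]))\<bar> \<le> 1 / 2 ^ N))"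

lemma crealI:
  assumes "irec (Suc k) F" "trec (Suc k) d"
    and "\<And>xs N. length xs = k \<Longrightarrow> d (xs @ [N]) > 0"
    and "\<And>xs N. length xs = k \<Longrightarrow> \<bar>E xs - of_int (F (xs @ [N])) / real (d (xs @ [N]))\<bar> \<le> 1 / 2 ^ N"
  shows "creal k E"
  unfolding creal_def using assms by blast

lemma nth_append_at [simp]: "length xs = k \<Longrightarrow> (xs @ y # ys) ! k = y"
  by auto

lemma creal_cong: "creal k E \<Longrightarrow> (\<And>xs. length xs = k \<Longrightarrow> E xs = E' xs) \<Longrightarrow> creal k E'"
  unfolding creal_def by (metis (no_types, lifting))

lemma nat_div_approx:
  assumes "m > 0"
  shows "0 \<le> real a / real m - real (a div m)" "real a / real m - real (a div m) < 1"
proof -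
  have "real (a div m) * real m \<le> real a"
    by (metis div_times_less_eq_dividend of_nat_le_iff of_nat_mult)
  then show "0 \<le> real a / real m - real (a div m)" using assms by (simp add: field_simps)
  have "a < (a div m + 1) * m" using assms by (simp add: dividend_less_div_times)
  then have "real a < (real (a div m) + 1) * real m"
    by (metis of_nat_1 of_nat_add of_nat_less_iff of_nat_mult)
  then show "real a / real m - real (a div m) < 1" using assms by (simp add: field_simps)
qed

text \<open>A denominator that depends only on the precision lets arbitrarily many approximations be
  added or multiplied through their integer numerators.\<close>

definition dyadic_approx :: "nat \<Rightarrow> (nat list \<Rightarrow> real) \<Rightarrow> (nat list \<Rightarrow> int) \<Rightarrow> bool" where
  "dyadic_approx k E F \<longleftrightarrow> irec (Suc k) F \<and>
     (\<forall>xs N. length xs = k \<longrightarrow> \<bar>E xs - of_int (F (xs @ [N])) / 2 ^ Suc N\<bar> \<le> 1 / 2 ^ N)"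

lemma dyadic_approxD:
  assumes "dyadic_approx k E F"
  shows "irec (Suc k) F"
    "length xs = k \<Longrightarrow> \<bar>E xs - of_int (F (xs @ [N])) / 2 ^ Suc N\<bar> \<le> 1 / 2 ^ N"
  using assms unfolding dyadic_approx_def by auto

text \<open>Half of the error budget is spent on precision \<open>N + 1\<close>. The positive and
  negative parts of the scaled numerator are rounded down separately; each rounding error lies in
  \<open>[0, 1)\<close>, so together they cost at most one unit \<open>1 / 2^(N+1)\<close>.\<close>

lemma creal_dyadic:
  assumes "creal k E"
  shows "\<exists>F. dyadic_approx k E F"
proof -
  obtain F d where F: "irec (Suc k) F" and d: "trec (Suc k) d" and
    pos: "\<And>xs N. length xs = k \<Longrightarrow> d (xs @ [N]) > 0" and
    approx: "\<And>xs N. length xs = k \<Longrightarrow> \<bar>E xs - of_int (F (xs @ [N])) / real (d (xs @ [N]))\<bar> \<le> 1 / 2 ^ N"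
    using assms unfolding creal_def by blast
  obtain p q where pq: "trec (Suc k) p" "trec (Suc k) q"
    "\<And>xs. length xs = Suc k \<Longrightarrow> F xs = int (p xs) - int (q xs)"
    using F by (rule irecE) blast
  have sh: "trec (Suc k) (\<lambda>xs. f (take k xs @ [Suc (xs ! k)]))" if "trec (Suc k) f" for f
    using trec_app[of k "[\<lambda>xs. Suc (xs ! k)]" f "Suc k"] that trec_Suc[OF trec_nth[of k "Suc k"]] by simp
  define r where "r = (\<lambda>f xs. (f (take k xs @ [Suc (xs ! k)]) * 2 ^ Suc (xs ! k)) div d (take k xs @ [Suc (xs ! k)]))"
  have r: "trec (Suc k) (r f)" if "trec (Suc k) f" for f
    unfolding r_def by (intro trec_div trec_mult trec_power trec_const trec_Suc trec_nth sh that d) simp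
  show ?thesis
    unfolding dyadic_approx_def
  proof (intro exI conjI allI impI)
    show "irec (Suc k) (\<lambda>xs. int (r p xs) - int (r q xs))"
      by (intro irec_diff irec_int r pq)
    fix xs :: "nat list" and N :: nat assume xs: "length xs = k"
    define m P Q where "m = d (xs @ [Suc N])" and "P = p (xs @ [Suc N]) * 2 ^ Suc N"
      and "Q = q (xs @ [Suc N]) * 2 ^ Suc N"
    have m: "m > 0" using pos[OF xs] by (simp add: m_def)
    have rr: "r p (xs @ [N]) = P div m" "r q (xs @ [N]) = Q div m"
      using xs by (simp_all add: r_def m_def P_def Q_def)
    have "of_int (F (xs @ [Suc N])) / real m = (real P / real m - real Q / real m) / 2 ^ Suc N"
      using xs m by (simp add: pq(3) P_def Q_def field_simps)
    then have "of_int (F (xs @ [Suc N])) / real m - (real (P div m) - real (Q div m)) / 2 ^ Suc N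
      = ((real P / real m - real (P div m)) - (real Q / real m - real (Q div m))) / 2 ^ Suc N"
      by (simp add: diff_divide_distrib)
    moreover have "\<bar>(real P / real m - real (P div m)) - (real Q / real m - real (Q div m))\<bar> \<le> 1"
      using nat_div_approx[OF m, of P] nat_div_approx[OF m, of Q] by linarith
    ultimately have "\<bar>of_int (F (xs @ [Suc N])) / real m - (real (P div m) - real (Q div m)) / 2 ^ Suc N\<bar> \<le> 1 / 2 ^ Suc N"
      by (simp add: abs_divide divide_right_mono del: power_Suc)
    moreover have "\<bar>E xs - of_int (F (xs @ [Suc N])) / real m\<bar> \<le> 1 / 2 ^ Suc N"
      using approx[OF xs] by (simp only: m_def)
    moreover have "1 / 2 ^ Suc N + 1 / 2 ^ Suc N = (1 / 2 ^ N :: real)" by simp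
    ultimately have "\<bar>E xs - (real (P div m) - real (Q div m)) / 2 ^ Suc N\<bar> \<le> 1 / 2 ^ N"
      by linarith
    then show "\<bar>E xs - of_int (int (r p (xs @ [N])) - int (r q (xs @ [N]))) / 2 ^ Suc N\<bar> \<le> 1 / 2 ^ N"
      by (simp only: rr of_int_diff of_int_of_nat_eq)
  qed
qed

lemma creal_ratio:
  assumes F: "irec k F" and d: "trec k d" and pos: "\<And>xs. length xs = k \<Longrightarrow> d xs > 0"
  shows "creal k (\<lambda>xs. of_int (F xs) / real (d xs))"
proof (rule crealI)
  show "irec (Suc k) (\<lambda>xs. F (take k xs))" using irec_app[of k "[]" F "Suc k"] F by simp
  show "trec (Suc k) (\<lambda>xs. d (take k xs))" using trec_app[of k "[]" d "Suc k"] d by simp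
qed (use pos in auto)

lemma creal_of_nat: "trec k f \<Longrightarrow> creal k (\<lambda>xs. real (f xs))"
  using creal_ratio[OF irec_int trec_const[of k 1]] by simp

lemma creal_rat: "d > 0 \<Longrightarrow> creal k (\<lambda>_. of_int c / real d)"
  by (rule creal_ratio[OF irec_const trec_const])

lemma creal_app:
  assumes E: "creal (k + length gs) E" and k: "k \<le> j" and gs: "\<And>g. g \<in> set gs \<Longrightarrow> trec j g"
  shows "creal j (\<lambda>xs. E (take k xs @ map (\<lambda>g. g xs) gs))"
proof -
  obtain F where "dyadic_approx (k + length gs) E F" using creal_dyadic[OF E] by blast
  note F = dyadic_approxD[OF this]
  define hs where "hs = map (\<lambda>g xs. g (take j xs)) gs @ [\<lambda>xs. xs ! j]"
  have "irec (Suc j) (\<lambda>xs. F (take k xs @ map (\<lambda>g. g xs) hs))"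
  proof (rule irec_app)
    show "irec (k + length hs) F" using F(1) by (simp add: hs_def)
    show "trec (Suc j) g" if "g \<in> set hs" for g
      using that gs trec_weaken[of j _ "Suc j"] by (auto simp: hs_def intro: trec_nth)
  qed (use k in simp)
  then show ?thesis
  proof (rule crealI[where d = "\<lambda>xs. 2 ^ Suc (xs ! j)"])
    show "trec (Suc j) (\<lambda>xs. 2 ^ Suc (xs ! j))"
      by (intro trec_power trec_const trec_Suc trec_nth) simp
    fix xs :: "nat list" and N :: nat assume xs: "length xs = j"
    then have "take k (xs @ [N]) @ map (\<lambda>g. g (xs @ [N])) hs = (take k xs @ map (\<lambda>g. g xs) gs) @ [N]"
      using k by (simp add: hs_def comp_def)
    then show "\<bar>E (take k xs @ map (\<lambda>g. g xs) gs)
      - of_int (F (take k (xs @ [N]) @ map (\<lambda>g. g (xs @ [N])) hs)) / real (2 ^ Suc ((xs @ [N]) ! j))\<bar> \<le> 1 / 2 ^ N"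
      using F(2)[of "take k xs @ map (\<lambda>g. g xs) gs" N] xs k by simp
  qed simp
qed

lemma creal_weaken: "creal k E \<Longrightarrow> k \<le> j \<Longrightarrow> creal j (\<lambda>xs. E (take k xs))"
  using creal_app[of k "[]" E j] by simp

lemma creal_comp:
  assumes "creal (length gs) E" "\<And>g. g \<in> set gs \<Longrightarrow> trec j g"
  shows "creal j (\<lambda>xs. E (map (\<lambda>g. g xs) gs))"
  using creal_app[of 0 gs E j] assms by simp

lemma irec_shift_last:
  assumes F: "irec (Suc k) F" and f: "trec (Suc k) f"
  shows "irec (Suc k) (\<lambda>xs. F (take k xs @ [f xs]))"
  using irec_app[of k "[f]" F "Suc k"] assms by simp

lemma creal_add:
  assumes "creal k E" "creal k G"
  shows "creal k (\<lambda>xs. E xs + G xs)"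
proof -
  obtain F where "dyadic_approx k E F" using creal_dyadic[OF assms(1)] by blast
  note F = dyadic_approxD[OF this]
  obtain H where "dyadic_approx k G H" using creal_dyadic[OF assms(2)] by blast
  note H = dyadic_approxD[OF this]
  show ?thesis
  proof (rule crealI)
    show "irec (Suc k) (\<lambda>xs. F (take k xs @ [Suc (xs ! k)]) + H (take k xs @ [Suc (xs ! k)]))"
      by (intro irec_add irec_shift_last F(1) H(1) trec_Suc trec_nth) simp_all
    show "trec (Suc k) (\<lambda>xs. 2 ^ Suc (Suc (xs ! k)))"
      by (intro trec_power trec_const trec_Suc trec_nth) simp
    fix xs :: "nat list" and N :: nat assume xs: "length xs = k"
    have "\<bar>E xs - of_int (F (xs @ [Suc N])) / 2 ^ Suc (Suc N)\<bar> \<le> 1 / 2 ^ Suc N"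
      "\<bar>G xs - of_int (H (xs @ [Suc N])) / 2 ^ Suc (Suc N)\<bar> \<le> 1 / 2 ^ Suc N"
      using F(2)[OF xs] H(2)[OF xs] by blast+
    moreover have "1 / 2 ^ Suc N + 1 / 2 ^ Suc N = (1 / 2 ^ N :: real)" by simp
    ultimately have "\<bar>E xs + G xs - (of_int (F (xs @ [Suc N])) / 2 ^ Suc (Suc N) + of_int (H (xs @ [Suc N])) / 2 ^ Suc (Suc N))\<bar> \<le> 1 / 2 ^ N"
      by linarith
    then show "\<bar>E xs + G xs - of_int (F (take k (xs @ [N]) @ [Suc ((xs @ [N]) ! k)]) + H (take k (xs @ [N]) @ [Suc ((xs @ [N]) ! k)]))
      / real (2 ^ Suc (Suc ((xs @ [N]) ! k)))\<bar> \<le> 1 / 2 ^ N"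
      using xs by (simp add: add_divide_distrib)
  qed simp
qed

text \<open>The approximation at precision 0 is \<open>(p - q) / 2\<close> with error at most 1. A
  recursive bound is what lets products choose their working precision.\<close>

lemma creal_bound:
  assumes "creal k E"
  obtains c where "trec k c" "\<And>xs. length xs = k \<Longrightarrow> \<bar>E xs\<bar> + 1 \<le> real (c xs)"
proof -
  obtain F where "dyadic_approx k E F" using creal_dyadic[OF assms] by blast
  note F = dyadic_approxD[OF this]
  obtain p q where pq: "trec (Suc k) p" "trec (Suc k) q"
    "\<And>xs. length xs = Suc k \<Longrightarrow> F xs = int (p xs) - int (q xs)"
    using F(1) by (rule irecE) blast
  have sh: "trec k (\<lambda>xs. f (xs @ [0]))" if "trec (Suc k) f" for f
    by (rule trec_cong[OF trec_app[of k "[\<lambda>_. 0]" f k]]) (use that in \<open>auto intro: trec_const\<close>)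
  show ?thesis
  proof (rule that)
    show "trec k (\<lambda>xs. p (xs @ [0]) + q (xs @ [0]) + 2)"
      by (intro trec_add trec_const sh pq)
    fix xs :: "nat list" assume xs: "length xs = k"
    have "\<bar>E xs - of_int (F (xs @ [0])) / 2\<bar> \<le> 1" using F(2)[OF xs, of 0] by simp
    then have "\<bar>E xs - (real (p (xs @ [0])) - real (q (xs @ [0]))) / 2\<bar> \<le> 1" using xs by (simp add: pq(3))
    then show "\<bar>E xs\<bar> + 1 \<le> real (p (xs @ [0]) + q (xs @ [0]) + 2)"
      by (simp add: abs_le_iff field_simps)
  qed
qed

lemma of_nat_le_two_power: "real n \<le> 2 ^ n"
  using less_exp[of n] by (metis less_imp_le of_nat_le_iff of_nat_numeral of_nat_power)

lemma creal_mult: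
  assumes "creal k E" "creal k G"
  shows "creal k (\<lambda>xs. E xs * G xs)"
proof -
  obtain F where "dyadic_approx k E F" using creal_dyadic[OF assms(1)] by blast
  note F = dyadic_approxD[OF this]
  obtain H where "dyadic_approx k G H" using creal_dyadic[OF assms(2)] by blast
  note H = dyadic_approxD[OF this]
  obtain c where c: "trec k c" "\<And>xs. length xs = k \<Longrightarrow> \<bar>E xs\<bar> + 1 \<le> real (c xs)"
    using creal_bound[OF assms(1)] by metis
  obtain d where d: "trec k d" "\<And>xs. length xs = k \<Longrightarrow> \<bar>G xs\<bar> + 1 \<le> real (d xs)"
    using creal_bound[OF assms(2)] by metis
  \<comment> \<open>The error of the product is at most \<open>(c + d) / 2^M\<close>, and
    \<open>c + d \<le> 2^(c + d)\<close>, so \<open>c + d\<close> extra bits suffice.\<close>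
  define N' where "N' = (\<lambda>ys. ys ! k + (c (take k ys) + d (take k ys)))"
  have N': "trec (Suc k) N'"
    unfolding N'_def by (intro trec_add trec_nth trec_weaken c d) simp_all
  show ?thesis
  proof (rule crealI)
    show "irec (Suc k) (\<lambda>xs. F (take k xs @ [N' xs]) * H (take k xs @ [N' xs]))"
      by (intro irec_mult irec_shift_last F(1) H(1) N')
    show "trec (Suc k) (\<lambda>xs. 2 ^ Suc (N' xs) * 2 ^ Suc (N' xs))"
      by (intro trec_mult trec_power trec_const trec_Suc N')
    fix xs :: "nat list" and N :: nat assume xs: "length xs = k"
    define M where "M = N + (c xs + d xs)"
    have M: "N' (xs @ [N]) = M" using xs by (simp add: N'_def M_def)
    define x y :: real where "x = of_int (F (xs @ [M])) / 2 ^ Suc M" and "y = of_int (H (xs @ [M])) / 2 ^ Suc M"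
    have x: "\<bar>E xs - x\<bar> \<le> 1 / 2 ^ M" unfolding x_def by (rule F(2)[OF xs])
    have y: "\<bar>G xs - y\<bar> \<le> 1 / 2 ^ M" unfolding y_def by (rule H(2)[OF xs])
    have "\<bar>y\<bar> \<le> \<bar>G xs\<bar> + 1"
    proof -
      have "1 / 2 ^ M \<le> (1 :: real)" by simp
      then show ?thesis using y by linarith
    qed
    then have yd: "\<bar>y\<bar> \<le> real (d xs)" using d(2)[OF xs] by linarith
    have "E xs * G xs - x * y = E xs * (G xs - y) + (E xs - x) * y" by (simp add: algebra_simps)
    also have "\<bar>\<dots>\<bar> \<le> \<bar>E xs\<bar> * \<bar>G xs - y\<bar> + \<bar>E xs - x\<bar> * \<bar>y\<bar>"
      by (metis abs_mult abs_triangle_ineq)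
    also have "\<dots> \<le> real (c xs) * (1 / 2 ^ M) + 1 / 2 ^ M * real (d xs)"
      using x y yd c(2)[OF xs] by (intro add_mono mult_mono) auto
    also have "\<dots> = real (c xs + d xs) / 2 ^ M" by (simp add: add_divide_distrib)
    also have "\<dots> \<le> 2 ^ (c xs + d xs) / 2 ^ M"
      by (intro divide_right_mono of_nat_le_two_power) simp
    also have "\<dots> = 1 / 2 ^ N" by (simp add: M_def power_add)
    finally have "\<bar>E xs * G xs - x * y\<bar> \<le> 1 / 2 ^ N" .
    moreover have "x * y = of_int (F (xs @ [M]) * H (xs @ [M])) / real (2 ^ Suc M * 2 ^ Suc M)"
      by (simp add: x_def y_def)
    ultimately show "\<bar>E xs * G xs - of_int (F (take k (xs @ [N]) @ [N' (xs @ [N])]) * H (take k (xs @ [N]) @ [N' (xs @ [N])]))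
      / real (2 ^ Suc (N' (xs @ [N])) * 2 ^ Suc (N' (xs @ [N])))\<bar> \<le> 1 / 2 ^ N"
      unfolding M using xs by (simp del: power_Suc)
  qed simp
qed

lemma creal_diff:
  assumes "creal k E" "creal k G"
  shows "creal k (\<lambda>xs. E xs - G xs)"
  using creal_add[OF assms(1) creal_mult[OF creal_rat[of 1 k "-1"] assms(2)]] by simp

lemma creal_sum:
  assumes E: "creal (Suc k) E" and b: "trec k b"
  shows "creal k (\<lambda>xs. \<Sum>l<b xs. E (xs @ [l]))"
proof -
  obtain F where "dyadic_approx (Suc k) E F" using creal_dyadic[OF E] by blast
  note F = dyadic_approxD[OF this]
  define N' where "N' = (\<lambda>ys. ys ! k + b (take k ys))"
  have N': "trec j N'" if "k < j" for j
    unfolding N'_def using that by (intro trec_add trec_nth trec_weaken b) simp_all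
  \<comment> \<open>The arguments arrive as \<open>xs\<close>, target precision, summation index,
    whereas \<open>F\<close> expects the index before the precision. The \<open>b\<close> extra bits
    in \<open>N'\<close> pay for \<open>b\<close> summands.\<close>
  let ?H = "\<lambda>ys. F (take k ys @ map (\<lambda>g. g ys) [\<lambda>ys. ys ! Suc k, N'])"
  show ?thesis
  proof (rule crealI)
    have "irec (Suc (Suc k)) (\<lambda>ys. ?H ys)"
      by (rule irec_app) (use F(1) N' in \<open>auto intro: trec_nth\<close>)
    from irec_sum[OF this, of "\<lambda>ys. b (take k ys)"]
    show "irec (Suc k) (\<lambda>ys. \<Sum>l<b (take k ys). ?H (ys @ [l]))"
      using trec_weaken[OF b, of "Suc k"] by simp
    show "trec (Suc k) (\<lambda>xs. 2 ^ Suc (N' xs))"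
      by (intro trec_power trec_const trec_Suc N') simp
    fix xs :: "nat list" and N :: nat assume xs: "length xs = k"
    define M where "M = N + b xs"
    have M: "N' (xs @ N # zs) = M" for zs using xs by (simp add: N'_def M_def)
    have "\<bar>(\<Sum>l<b xs. E (xs @ [l])) - (\<Sum>l<b xs. of_int (F (xs @ [l, M])) / 2 ^ Suc M)\<bar>
      \<le> (\<Sum>l<b xs. \<bar>E (xs @ [l]) - of_int (F (xs @ [l, M])) / 2 ^ Suc M\<bar>)"
      unfolding sum_subtractf[symmetric] by (rule sum_abs)
    also have "\<dots> \<le> (\<Sum>l<b xs. 1 / 2 ^ M)"
    proof (rule sum_mono)
      fix l
      show "\<bar>E (xs @ [l]) - of_int (F (xs @ [l, M])) / 2 ^ Suc M\<bar> \<le> 1 / 2 ^ M"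
        using F(2)[of "xs @ [l]" M] xs by simp
    qed
    also have "\<dots> = real (b xs) / 2 ^ M" by simp
    also have "\<dots> \<le> 2 ^ b xs / 2 ^ M"
      by (intro divide_right_mono of_nat_le_two_power) simp
    also have "\<dots> = 1 / 2 ^ N" by (simp add: M_def power_add)
    finally show "\<bar>(\<Sum>l<b xs. E (xs @ [l]))
      - of_int (\<Sum>l<b (take k (xs @ [N])). ?H ((xs @ [N]) @ [l]))
        / real (2 ^ Suc (N' (xs @ [N])))\<bar> \<le> 1 / 2 ^ N"
      using xs by (simp add: M nth_append sum_divide_distrib del: power_Suc)
  qed simp
qed

text \<open>Factors are exchanged one at a time, each exchange costing \<open>e\<close> times bounds
  of the other factors; \<open>C \<ge> 1\<close> allows the missing bound to be included.\<close>

lemma prod_diff_bound: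
  fixes x y C :: "nat \<Rightarrow> real"
  assumes "\<And>l. l < n \<Longrightarrow> \<bar>x l\<bar> \<le> C l" "\<And>l. l < n \<Longrightarrow> \<bar>y l\<bar> \<le> C l" "\<And>l. l < n \<Longrightarrow> 1 \<le> C l"
    "\<And>l. l < n \<Longrightarrow> \<bar>x l - y l\<bar> \<le> e" "e \<ge> 0"
  shows "\<bar>(\<Prod>l<n. x l) - (\<Prod>l<n. y l)\<bar> \<le> real n * e * (\<Prod>l<n. C l)"
  using assms
proof (induction n)
  case (Suc n)
  define X Y P where "X = (\<Prod>l<n. x l)" and "Y = (\<Prod>l<n. y l)" and "P = (\<Prod>l<n. C l)"
  have IH: "\<bar>X - Y\<bar> \<le> real n * e * P" using Suc by (simp add: X_def Y_def P_def)
  have Y: "\<bar>Y\<bar> \<le> P" unfolding Y_def P_def abs_prod using Suc.prems by (intro prod_mono) auto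
  have P: "P \<ge> 0" using Y by linarith
  have C: "1 \<le> C n" "\<bar>x n\<bar> \<le> C n" "\<bar>x n - y n\<bar> \<le> e" using Suc.prems by auto
  have "X * x n - Y * y n = (X - Y) * x n + Y * (x n - y n)" by (simp add: algebra_simps)
  also have "\<bar>\<dots>\<bar> \<le> \<bar>X - Y\<bar> * \<bar>x n\<bar> + \<bar>Y\<bar> * \<bar>x n - y n\<bar>"
    by (metis abs_mult abs_triangle_ineq)
  also have "\<dots> \<le> (real n * e * P) * C n + P * e"
    using IH Y C P Suc.prems(5) by (intro add_mono mult_mono) auto
  also have "\<dots> \<le> (real n * e * P) * C n + P * e * C n"
    using C P Suc.prems(5) mult_left_mono[of 1 "C n" "P * e"] by simp
  finally show ?case by (simp add: X_def Y_def P_def algebra_simps)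
qed simp

lemma creal_prod:
  assumes E: "creal (Suc k) E" and b: "trec k b"
  shows "creal k (\<lambda>xs. \<Prod>l<b xs. E (xs @ [l]))"
proof -
  obtain F where "dyadic_approx (Suc k) E F" using creal_dyadic[OF E] by blast
  note F = dyadic_approxD[OF this]
  obtain c where c: "trec (Suc k) c" "\<And>xs. length xs = Suc k \<Longrightarrow> \<bar>E xs\<bar> + 1 \<le> real (c xs)"
    using creal_bound[OF E] by metis
  define P where "P = (\<lambda>xs. \<Prod>l<b xs. c (xs @ [l]))"
  have P: "trec k P" unfolding P_def by (rule trec_prod[OF c(1) b])
  \<comment> \<open>The error is at most \<open>b P / 2^M\<close> with \<open>P\<close> the product
    of the bounds, and \<open>b P \<le> 2^b * 2^P\<close>.\<close>
  define N' where "N' = (\<lambda>ys. ys ! k + (b (take k ys) + P (take k ys)))"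
  have N': "trec j N'" if "k < j" for j
    unfolding N'_def using that by (intro trec_add trec_nth trec_weaken b P) simp_all
  let ?H = "\<lambda>ys. F (take k ys @ map (\<lambda>g. g ys) [\<lambda>ys. ys ! Suc k, N'])"
  show ?thesis
  proof (rule crealI)
    have "irec (Suc (Suc k)) (\<lambda>ys. ?H ys)"
      by (rule irec_app) (use F(1) N' in \<open>auto intro: trec_nth\<close>)
    from irec_prod[OF this, of "\<lambda>ys. b (take k ys)"]
    show "irec (Suc k) (\<lambda>ys. \<Prod>l<b (take k ys). ?H (ys @ [l]))"
      using trec_weaken[OF b, of "Suc k"] by simp
    show "trec (Suc k) (\<lambda>xs. (2 ^ Suc (N' xs)) ^ b (take k xs))"
      by (intro trec_power trec_const trec_Suc N' trec_weaken b) simp_all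
    fix xs :: "nat list" and N :: nat assume xs: "length xs = k"
    define M where "M = N + (b xs + P xs)"
    have M: "N' (xs @ N # zs) = M" for zs using xs by (simp add: N'_def M_def)
    have cl: "\<bar>E (xs @ [l])\<bar> + 1 \<le> real (c (xs @ [l]))" for l using c(2)[of "xs @ [l]"] xs by simp
    have approx: "\<bar>E (xs @ [l]) - of_int (F (xs @ [l, M])) / 2 ^ Suc M\<bar> \<le> 1 / 2 ^ M" for l
      using F(2)[of "xs @ [l]" M] xs by simp
    have "\<bar>(\<Prod>l<b xs. E (xs @ [l])) - (\<Prod>l<b xs. of_int (F (xs @ [l, M])) / 2 ^ Suc M)\<bar>
      \<le> real (b xs) * (1 / 2 ^ M) * (\<Prod>l<b xs. real (c (xs @ [l])))"
    proof (rule prod_diff_bound)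
      fix l
      show "\<bar>E (xs @ [l])\<bar> \<le> real (c (xs @ [l]))" "1 \<le> real (c (xs @ [l]))"
        using cl[of l] by linarith+
      have "1 / 2 ^ M \<le> (1 :: real)" by simp
      then show "\<bar>of_int (F (xs @ [l, M])) / 2 ^ Suc M\<bar> \<le> real (c (xs @ [l]))"
        using cl[of l] approx[of l] by linarith
    qed (use approx in auto)
    also have "\<dots> = real (b xs) * real (P xs) / 2 ^ M" by (simp add: P_def)
    also have "\<dots> \<le> 2 ^ b xs * 2 ^ P xs / 2 ^ M"
      by (intro divide_right_mono mult_mono of_nat_le_two_power) simp_all
    also have "\<dots> = 1 / 2 ^ N" by (simp add: M_def power_add)
    finally show "\<bar>(\<Prod>l<b xs. E (xs @ [l]))
      - of_int (\<Prod>l<b (take k (xs @ [N])). ?H ((xs @ [N]) @ [l]))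
        / real ((2 ^ Suc (N' (xs @ [N]))) ^ b (take k (xs @ [N])))\<bar> \<le> 1 / 2 ^ N"
      using xs by (simp add: M nth_append prod_dividef del: power_Suc)
  qed simp
qed

text \<open>\<open>N + 1\<close> serves both as index of the approximant and as precision of its
  evaluation, so the two errors add up to \<open>1 / 2^N\<close>.\<close>

lemma creal_limit:
  assumes E: "creal (Suc k) E"
    and lim: "\<And>xs N. length xs = k \<Longrightarrow> \<bar>G xs - E (xs @ [N])\<bar> \<le> 1 / 2 ^ N"
  shows "creal k G"
proof -
  obtain F where "dyadic_approx (Suc k) E F" using creal_dyadic[OF E] by blast
  note F = dyadic_approxD[OF this]
  let ?s = "\<lambda>ys. Suc (ys ! k)"
  show ?thesis
  proof (rule crealI)
    show "irec (Suc k) (\<lambda>ys. F (take k ys @ map (\<lambda>g. g ys) [?s, ?s]))"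
      by (rule irec_app) (use F(1) in \<open>auto intro!: trec_Suc trec_nth\<close>)
    show "trec (Suc k) (\<lambda>ys. 2 ^ Suc (Suc (ys ! k)))"
      by (intro trec_power trec_const trec_Suc trec_nth) simp
    fix xs :: "nat list" and N :: nat assume xs: "length xs = k"
    have "\<bar>G xs - E (xs @ [Suc N])\<bar> \<le> 1 / 2 ^ Suc N" by (rule lim[OF xs])
    moreover have "\<bar>E (xs @ [Suc N]) - of_int (F (xs @ [Suc N, Suc N])) / 2 ^ Suc (Suc N)\<bar> \<le> 1 / 2 ^ Suc N"
      using F(2)[of "xs @ [Suc N]" "Suc N"] xs by simp
    moreover have "1 / 2 ^ Suc N + 1 / 2 ^ Suc N = (1 / 2 ^ N :: real)" by simp
    ultimately have "\<bar>G xs - of_int (F (xs @ [Suc N, Suc N])) / 2 ^ Suc (Suc N)\<bar> \<le> 1 / 2 ^ N"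
      by linarith
    then show "\<bar>G xs - of_int (F (take k (xs @ [N]) @ map (\<lambda>g. g (xs @ [N])) [?s, ?s]))
      / real (2 ^ Suc (Suc ((xs @ [N]) ! k)))\<bar> \<le> 1 / 2 ^ N"
      using xs by simp
  qed simp
qed

lemma sqrt_diff_le:
  assumes "x \<ge> 0" "y \<ge> 0" "\<bar>x - y\<bar> \<le> e\<^sup>2" "e \<ge> 0"
  shows "\<bar>sqrt x - sqrt y\<bar> \<le> e"
proof -
  have "sqrt u \<le> sqrt v + e" if "u \<ge> 0" "v \<ge> 0" "u \<le> v + e\<^sup>2" for u v
  proof -
    have "v + e\<^sup>2 \<le> (sqrt v + e)\<^sup>2" using that assms(4) by (simp add: power2_sum)
    then have "u \<le> (sqrt v + e)\<^sup>2" using that by linarith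
    then show ?thesis using that assms(4) by (intro real_le_lsqrt) auto
  qed
  from this[of x y] this[of y x] show ?thesis using assms by linarith
qed

lemma creal_sqrt:
  assumes E: "creal k E" and nonneg: "\<And>xs. length xs = k \<Longrightarrow> E xs \<ge> 0"
  shows "creal k (\<lambda>xs. sqrt (E xs))"
proof -
  obtain F where "dyadic_approx k E F" using creal_dyadic[OF E] by blast
  note F = dyadic_approxD[OF this]
  \<comment> \<open>Square roots halve the precision: for \<open>M = 2 N + 4\<close> one has
    \<open>1 / 2^M = (1 / 2^(N+2))^2\<close>, which leaves room for the rounding by
    \<open>floor_sqrt\<close>.\<close>
  define N' :: "nat list \<Rightarrow> nat" where "N' = (\<lambda>ys. 2 * (ys ! k) + 4)"
  have N': "trec (Suc k) N'"
    unfolding N'_def by (intro trec_add trec_mult trec_const trec_nth) simp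
  obtain p q where pq: "trec (Suc k) p" "trec (Suc k) q"
    "\<And>xs. length xs = Suc k \<Longrightarrow> F (take k xs @ [N' xs]) = int (p xs) - int (q xs)"
    using irec_shift_last[OF F(1) N'] by (rule irecE) blast
  show ?thesis
  proof (rule crealI)
    show "irec (Suc k) (\<lambda>xs. int (floor_sqrt ((p xs - q xs) * 2 ^ Suc (N' xs))))"
      by (intro irec_int trec_floor_sqrt trec_mult trec_diff trec_power trec_const trec_Suc pq N')
    show "trec (Suc k) (\<lambda>xs. 2 ^ Suc (N' xs))"
      by (intro trec_power trec_const trec_Suc N')
    fix xs :: "nat list" and N :: nat assume xs: "length xs = k"
    define M where "M = 2 * N + 4"
    have M: "N' (xs @ [N]) = M" using xs by (simp add: N'_def M_def)
    define f where "f = p (xs @ [N]) - q (xs @ [N])"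
    define S where "S = floor_sqrt (f * 2 ^ Suc M)"
    have "F (xs @ [M]) = int (p (xs @ [N])) - int (q (xs @ [N]))"
      using pq(3)[of "xs @ [N]"] xs by (simp add: M)
    moreover have "\<bar>E xs - of_int (F (xs @ [M])) / 2 ^ Suc M\<bar> \<le> 1 / 2 ^ M" by (rule F(2)[OF xs])
    ultimately have approx: "\<bar>E xs - (real (p (xs @ [N])) - real (q (xs @ [N]))) / 2 ^ Suc M\<bar> \<le> 1 / 2 ^ M"
      by simp
    \<comment> \<open>Truncated subtraction replaces a negative approximation by 0, which is closer
      still to the nonnegative \<open>E xs\<close>.\<close>
    have "\<bar>E xs - real f / 2 ^ Suc M\<bar> \<le> 1 / 2 ^ M"
    proof (cases "q (xs @ [N]) \<le> p (xs @ [N])")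
      case True
      then have "real f = real (p (xs @ [N])) - real (q (xs @ [N]))" by (simp add: f_def of_nat_diff)
      then show ?thesis using approx by (simp only:)
    next
      case False
      then have "(real (p (xs @ [N])) - real (q (xs @ [N]))) / 2 ^ Suc M \<le> 0"
        by (intro divide_nonpos_pos) auto
      moreover have "real f / 2 ^ Suc M = 0" using False by (simp add: f_def)
      ultimately show ?thesis using approx nonneg[OF xs] by linarith
    qed
    moreover have "1 / 2 ^ M = (1 / 2 ^ (N + 2) :: real)\<^sup>2"
    proof -
      have "M = (N + 2) * 2" by (simp add: M_def)
      then show ?thesis by (simp only: power_mult power_divide power_one)
    qed
    ultimately have "\<bar>sqrt (E xs) - sqrt (real f / 2 ^ Suc M)\<bar> \<le> 1 / 2 ^ (N + 2)"
      using nonneg[OF xs] by (intro sqrt_diff_le) auto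
    moreover have "\<bar>sqrt (real f / 2 ^ Suc M) - real S / 2 ^ Suc M\<bar> \<le> 1 / 2 ^ (N + 2)"
    proof -
      have "S\<^sup>2 \<le> f * 2 ^ Suc M" "f * 2 ^ Suc M < (Suc S)\<^sup>2"
        using floor_sqrt_power2_le[of "f * 2 ^ Suc M"] Suc_floor_sqrt_power2_gt[of "f * 2 ^ Suc M"]
        by (simp_all add: S_def)
      then have "real (S\<^sup>2) \<le> real (f * 2 ^ Suc M)" "real (f * 2 ^ Suc M) \<le> real ((Suc S)\<^sup>2)"
        by (simp_all only: of_nat_le_iff less_imp_le)
      then have "(real S)\<^sup>2 \<le> real f * 2 ^ Suc M" "real f * 2 ^ Suc M \<le> (real S + 1)\<^sup>2"
        by (simp_all only: of_nat_power of_nat_mult of_nat_numeral of_nat_Suc add.commute)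
      then have S: "real S \<le> sqrt (real f * 2 ^ Suc M)" "sqrt (real f * 2 ^ Suc M) \<le> real S + 1"
        by (auto intro: real_le_rsqrt real_le_lsqrt)
      have sqrt_div: "sqrt (x / D) = sqrt (x * D) / D" if "D > 0" for x D :: real
      proof -
        have eq: "x / D = x * D / D\<^sup>2" using that by (simp add: power2_eq_square)
        show ?thesis unfolding eq real_sqrt_divide real_sqrt_abs using that by simp
      qed
      moreover have "sqrt (real f / 2 ^ Suc M) = sqrt (real f * 2 ^ Suc M) / 2 ^ Suc M"
        by (rule sqrt_div) simp
      moreover have "\<bar>sqrt (real f * 2 ^ Suc M) - real S\<bar> \<le> 1" using S by linarith
      ultimately have "\<bar>sqrt (real f / 2 ^ Suc M) - real S / 2 ^ Suc M\<bar> \<le> 1 / 2 ^ Suc M"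
        by (simp add: diff_divide_distrib[symmetric] abs_divide divide_right_mono del: power_Suc)
      also have "\<dots> \<le> 1 / 2 ^ (N + 2)"
        unfolding M_def by (intro divide_left_mono power_increasing) auto
      finally show ?thesis .
    qed
    moreover have "1 / 2 ^ (N + 2) + 1 / 2 ^ (N + 2) \<le> (1 / 2 ^ N :: real)" by (simp add: power_add field_simps)
    ultimately have "\<bar>sqrt (E xs) - real S / 2 ^ Suc M\<bar> \<le> 1 / 2 ^ N" by linarith
    then show "\<bar>sqrt (E xs) - of_int (int (floor_sqrt ((p (xs @ [N]) - q (xs @ [N])) * 2 ^ Suc (N' (xs @ [N])))))
      / real (2 ^ Suc (N' (xs @ [N])))\<bar> \<le> 1 / 2 ^ N"
      unfolding M S_def f_def by (simp del: power_Suc)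
  qed simp
qed

lemma computable_real_seq_creal:
  assumes "creal 1 (\<lambda>xs. E (xs ! 0))"
  shows "computable_real_seq E"
proof -
  obtain F d where F: "irec (Suc 1) F" and d: "trec (Suc 1) d" and
    pos: "\<And>xs N. length xs = 1 \<Longrightarrow> d (xs @ [N]) > 0" and
    approx: "\<And>xs N. length xs = 1 \<Longrightarrow> \<bar>E (xs ! 0) - of_int (F (xs @ [N])) / real (d (xs @ [N]))\<bar> \<le> 1 / 2 ^ N"
    using assms unfolding creal_def by blast
  obtain p q where pq: "trec (Suc 1) p" "trec (Suc 1) q"
    "\<And>xs. length xs = Suc 1 \<Longrightarrow> F xs = int (p xs) - int (q xs)"
    using F by (rule irecE) blast
  obtain p' where p': "total_recursive 2 p'" "\<And>xs. length xs = 2 \<Longrightarrow> p' xs = p xs"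
    using pq(1) unfolding trec_def by (auto simp: numeral_2_eq_2)
  obtain q' where q': "total_recursive 2 q'" "\<And>xs. length xs = 2 \<Longrightarrow> q' xs = q xs"
    using pq(2) unfolding trec_def by (auto simp: numeral_2_eq_2)
  \<comment> \<open>The target format divides by \<open>d + 1\<close>, so the positive denominator
    is lowered by one.\<close>
  obtain d' where d': "total_recursive 2 d'" "\<And>xs. length xs = 2 \<Longrightarrow> d' xs = d xs - 1"
    using trec_diff[OF d trec_const[of _ 1]] unfolding trec_def by (auto simp: numeral_2_eq_2)
  have "\<bar>E i - (real (p' [i, k]) - real (q' [i, k])) / (real (d' [i, k]) + 1)\<bar> \<le> 1 / 2 ^ k" for i k
  proof -
    have "d [i, k] > 0" using pos[of "[i]" k] by simp
    then have "real (d' [i, k]) + 1 = real (d [i, k])" using d'(2)[of "[i, k]"] by (simp add: of_nat_diff)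
    moreover have "of_int (F [i, k]) = real (p' [i, k]) - real (q' [i, k])"
      by (simp add: pq(3) p'(2) q'(2))
    ultimately show ?thesis using approx[of "[i]" k] by simp
  qed
  then show ?thesis unfolding computable_real_seq_def using p'(1) q'(1) d'(1) by blast
qed

section \<open>Computability of the coefficients\<close>

lemma creal_comp2:
  "creal 2 (\<lambda>xs. F (xs ! 0) (xs ! 1)) \<Longrightarrow> trec k g \<Longrightarrow> trec k h \<Longrightarrow> creal k (\<lambda>xs. F (g xs) (h xs))"
  using creal_comp[of "[g, h]" "\<lambda>xs. F (xs ! 0) (xs ! 1)" k] by (auto simp: numeral_2_eq_2)

lemma creal_comp3:
  "creal 3 (\<lambda>xs. F (xs ! 0) (xs ! 1) (xs ! 2)) \<Longrightarrow> trec k f \<Longrightarrow> trec k g \<Longrightarrow> trec k h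
    \<Longrightarrow> creal k (\<lambda>xs. F (f xs) (g xs) (h xs))"
  using creal_comp[of "[f, g, h]" "\<lambda>xs. F (xs ! 0) (xs ! 1) (xs ! 2)" k]
  by (auto simp: numeral_2_eq_2 numeral_3_eq_3)

lemma creal_const_weaken: "creal 0 (\<lambda>_. c) \<Longrightarrow> creal k (\<lambda>_. c)"
  using creal_weaken[of 0 "\<lambda>_. c" k] by simp

lemma creal_of_bool: "trec k (\<lambda>xs. of_bool (P xs)) \<Longrightarrow> creal k (\<lambda>xs. of_bool (P xs))"
  by (drule creal_of_nat) simp

lemma creal_power_const:
  assumes "creal 0 (\<lambda>_. c)" "trec k f"
  shows "creal k (\<lambda>xs. c ^ f xs)"
  using creal_prod[OF creal_const_weaken[OF assms(1)] assms(2)] by simp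

text \<open>\<open>pi\<close> lies between an even partial sum and the next one, which differ by the
  last term.\<close>

lemma leibniz_error: "\<bar>pi - (\<Sum>k<2 * n. 4 * (-1) ^ k / real (2 * k + 1))\<bar> \<le> 4 / real (4 * n + 1)"
proof -
  define a where "a = (\<lambda>k. 1 / real (k * 2 + 1))"
  have a: "a \<longlonglongrightarrow> 0" "\<And>n. 0 \<le> a n" "\<And>n. a (Suc n) \<le> a n"
    unfolding a_def by real_asymp (auto simp: field_simps)
  have p: "pi / 4 = (\<Sum>k. (-1) ^ k * a k)"
    using pi_series by (simp add: a_def)
  have "(\<Sum>k<2 * n. (-1) ^ k * a k) \<le> pi / 4" "pi / 4 \<le> (\<Sum>k<2 * n + 1. (-1) ^ k * a k)"
    unfolding p by (rule summable_Leibniz'(2,4)[OF a])+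
  moreover have "(\<Sum>k<2 * n. 4 * (-1) ^ k / real (2 * k + 1)) = 4 * (\<Sum>k<2 * n. (-1) ^ k * a k)"
    by (simp add: a_def sum_distrib_left mult.commute)
  moreover have "(\<Sum>k<2 * n + 1. (-1) ^ k * a k) = (\<Sum>k<2 * n. (-1) ^ k * a k) + 1 / real (4 * n + 1)"
    by (simp add: a_def)
  ultimately show ?thesis by (simp add: abs_le_iff)
qed

lemma creal_pi: "creal 0 (\<lambda>_. pi)"
proof (rule creal_limit[where E = "\<lambda>xs. \<Sum>l<2 * 2 ^ Suc (xs ! 0). 4 * (-1) ^ l / real (2 * l + 1)"])
  have "creal (Suc (Suc 0)) (\<lambda>xs. of_int (int 4 * (1 - int 2 * int (xs ! 1 mod 2))) / real (2 * (xs ! 1) + 1))"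
    by (intro creal_ratio irec_mult irec_diff irec_const irec_int trec_intros) simp_all
  moreover have "trec (Suc 0) (\<lambda>xs. 2 * 2 ^ Suc (xs ! 0))"
    by (intro trec_intros) simp
  ultimately have "creal (Suc 0) (\<lambda>xs. \<Sum>l<2 * 2 ^ Suc (xs ! 0).
      of_int (int 4 * (1 - int 2 * int ((xs @ [l]) ! 1 mod 2))) / real (2 * ((xs @ [l]) ! 1) + 1))"
    by (rule creal_sum)
  then show "creal (Suc 0) (\<lambda>xs. \<Sum>l<2 * 2 ^ Suc (xs ! 0). 4 * (-1) ^ l / real (2 * l + 1))"
  proof (rule creal_cong)
    fix xs :: "nat list" assume "length xs = Suc 0"
    then have nth: "(xs @ [l]) ! 1 = l" for l by simp
    have "of_int (int 4 * (1 - int 2 * int (l mod 2))) = (4 * (-1) ^ l :: real)" for l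
      by (cases "even l") (auto simp: odd_iff_mod_2_eq_one)
    then show "(\<Sum>l<2 * 2 ^ Suc (xs ! 0). of_int (int 4 * (1 - int 2 * int ((xs @ [l]) ! 1 mod 2))) / real (2 * ((xs @ [l]) ! 1) + 1))
      = (\<Sum>l<2 * 2 ^ Suc (xs ! 0). 4 * (-1) ^ l / real (2 * l + 1))"
      by (simp only: nth)
  qed
next
  fix xs :: "nat list" and N assume "length xs = 0"
  have "\<bar>pi - (\<Sum>l<2 * 2 ^ Suc N. 4 * (-1) ^ l / real (2 * l + 1))\<bar> \<le> 4 / real (4 * 2 ^ Suc N + 1)"
    by (rule leibniz_error)
  also have "\<dots> \<le> 4 / real (4 * 2 ^ N)"
    by (intro frac_le) auto
  finally show "\<bar>pi - (\<Sum>l<2 * 2 ^ Suc ((xs @ [N]) ! 0). 4 * (-1) ^ l / real (2 * l + 1))\<bar> \<le> 1 / 2 ^ N"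
    using \<open>length xs = 0\<close> by simp
qed

text \<open>The geometric series for \<open>(1 / 4) / (1 - (1 - pi / 4))\<close>.\<close>

lemma creal_inverse_pi: "creal 0 (\<lambda>_. 1 / pi)"
proof (rule creal_limit)
  define x where "x = 1 - pi / 4"
  have x: "0 \<le> x" "x \<le> 1/4" using pi_gt3 pi_less_4 by (auto simp: x_def)
  have "creal 0 (\<lambda>_. 1 - pi * (1/4))"
    using creal_diff[OF creal_rat[of 1 0 1] creal_mult[OF creal_pi creal_rat[of 4 0 1]]] by simp
  then have cx: "creal 0 (\<lambda>_. x)" by (simp add: x_def)
  have "creal 2 (\<lambda>xs. x ^ (xs ! 1) * (1/4))"
    using creal_mult[OF creal_power_const[OF cx trec_nth[of 1 2]] creal_rat[of 4 2 1]] by simp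
  from creal_sum[OF this[unfolded numeral_2_eq_2], of "\<lambda>xs. xs ! 0"]
  have "creal 1 (\<lambda>xs. \<Sum>l<xs ! 0. x ^ ((xs @ [l]) ! 1) * (1/4))"
    by (simp add: trec_nth)
  then show "creal (Suc 0) (\<lambda>xs. \<Sum>l<xs ! 0. x ^ l * (1/4))"
    unfolding One_nat_def by (rule creal_cong) simp
  fix xs :: "nat list" and N assume "length xs = 0"
  have "(\<Sum>l<N. x ^ l * (1/4)) = (1 - x ^ N) / pi"
  proof -
    have "(\<Sum>l<N. x ^ l) = (1 - x ^ N) / (pi / 4)"
      using x by (subst sum_gp_strict) (auto simp: x_def)
    moreover have "(1 - x ^ N) / (pi / 4) * (1/4) = (1 - x ^ N) / pi"
      by (simp add: field_simps)
    ultimately show ?thesis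
      unfolding sum_distrib_right[symmetric] by (simp only:)
  qed
  then have "\<bar>1 / pi - (\<Sum>l<N. x ^ l * (1/4))\<bar> = x ^ N / pi"
    using x by (simp add: diff_divide_distrib)
  also have "\<dots> \<le> (1/2) ^ N / 1"
    using x pi_gt3 by (intro frac_le power_mono) auto
  finally show "\<bar>1 / pi - (\<Sum>l<(xs @ [N]) ! 0. x ^ l * (1/4))\<bar> \<le> 1 / 2 ^ N"
    using \<open>length xs = 0\<close> by (simp add: power_one_over)
qed

text \<open>Squaring removes the half-integer power:
  \<open>144 * 3 / pi^5 = 432 / pi^5\<close>.\<close>

lemma creal_leading_coeff: "creal 0 (\<lambda>_. leading_coeff)"
proof -
  have "creal 0 (\<lambda>_. 432 * (1 / pi) ^ 5)"
    using creal_mult[OF creal_rat[of 1 0 432] creal_power_const[OF creal_inverse_pi trec_const[of 0 5]]] by simp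
  then have "creal 0 (\<lambda>_. sqrt (432 * (1 / pi) ^ 5))"
    by (rule creal_sqrt) simp
  moreover have "sqrt (432 * (1 / pi) ^ 5) = leading_coeff"
  proof (rule real_sqrt_unique)
    have "(pi powr (5/2))\<^sup>2 = pi ^ 5"
      by (simp add: powr_power powr_numeral)
    then show "leading_coeff\<^sup>2 = 432 * (1 / pi) ^ 5"
      by (simp add: leading_coeff_def power_divide power_mult_distrib)
    show "0 \<le> leading_coeff" by (simp add: leading_coeff_def)
  qed
  ultimately show ?thesis by simp
qed

lemma creal_binom_coeff: "creal 3 (\<lambda>xs. binom_coeff (xs ! 0) (xs ! 1) (xs ! 2))"
proof -
  \<comment> \<open>The factor of \<open>binom_coeff\<close> with the fraction \<open>1/2\<close>
    cleared, as a quotient of an integer by a positive natural number.\<close>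
  let ?q = "\<lambda>c l t. of_int (int (2 * c * (t + l)) - int c) / real (2 * Suc t)"
  have "creal (Suc 3) (\<lambda>xs. ?q (xs ! 0) (xs ! 1) (xs ! 3))"
    by (intro creal_ratio irec_diff irec_int trec_intros) simp_all
  from creal_prod[OF this, of "\<lambda>xs. xs ! 2"]
  have "creal 3 (\<lambda>xs. \<Prod>l<xs ! 2. ?q ((xs @ [l]) ! 0) ((xs @ [l]) ! 1) ((xs @ [l]) ! 3))"
    by (simp add: trec_nth)
  then show ?thesis
  proof (rule creal_cong)
    fix xs :: "nat list" assume xs: "length xs = 3"
    have "?q c l t = real c * (real t + real l - 1/2) / real (Suc t)" for c t l
      by (simp add: field_simps)
    then show "(\<Prod>l<xs ! 2. ?q ((xs @ [l]) ! 0) ((xs @ [l]) ! 1) ((xs @ [l]) ! 3)) = binom_coeff (xs ! 0) (xs ! 1) (xs ! 2)"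
      unfolding binom_coeff_def using xs by (intro prod.cong refl) (simp only: nth_append_at, simp add: nth_append)
  qed
qed

lemma creal_defect_coeff: "creal 2 (\<lambda>xs. defect_coeff (xs ! 0) (xs ! 1))"
proof -
  have "creal (Suc 2) (\<lambda>xs. binom_coeff 2 (xs ! 0) (xs ! 2))"
    by (rule creal_comp3[OF creal_binom_coeff]) (intro trec_intros; simp)+
  from creal_sum[OF this trec_nth[of 1 2]]
  have "creal 2 (\<lambda>xs. \<Sum>t<xs ! 1. binom_coeff 2 ((xs @ [t]) ! 0) ((xs @ [t]) ! 2))" by simp
  then have sum: "creal 2 (\<lambda>xs. \<Sum>t<xs ! 1. binom_coeff 2 (xs ! 0) t)"
    by (rule creal_cong) (simp add: nth_append)
  have "creal 0 (\<lambda>_. pi * pi * (1/144))"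
    using creal_mult[OF creal_mult[OF creal_pi creal_pi] creal_rat[of 144 0 1]] by simp
  then have "creal 0 (\<lambda>_. pi\<^sup>2 / 144)"
    by (simp add: power2_eq_square)
  then have kappa: "creal 2 (\<lambda>_. pi\<^sup>2 / 144)"
    by (rule creal_const_weaken)
  have "creal 2 (\<lambda>xs. binom_coeff 1 (xs ! 0) (Suc (xs ! 1)))" "creal 2 (\<lambda>xs. binom_coeff 1 (xs ! 0) (xs ! 1))"
    by (rule creal_comp3[OF creal_binom_coeff]; intro trec_intros; simp)+
  note creal_diff[OF creal_mult[OF kappa sum] creal_add[OF this(1) creal_mult[OF this(2) creal_rat[of 2 2 1]]]]
  then show ?thesis by (simp add: defect_coeff_def)
qed

text \<open>Iterating the recursion of \<^const>\<open>asym_coeff\<close> turns it into a sum over paths that descend to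
  \<open>0\<close> and stay there. Encoding a path of length \<open>s\<close> by a number with \<open>s + 1\<close> digits in base \<open>B\<close>
  makes it a plain bounded sum of bounded products.\<close>

definition step_weight :: "nat \<Rightarrow> nat \<Rightarrow> real" where
  "step_weight u l = of_bool (l < u) * (defect_coeff l (u - l) * (1 / real (u + (1 - u)))) + of_bool (u + l = 0)"

definition digit :: "nat \<Rightarrow> nat \<Rightarrow> nat \<Rightarrow> nat" where
  "digit B c t = c div B ^ t mod B"

definition path_sum :: "nat \<Rightarrow> nat \<Rightarrow> nat \<Rightarrow> real" where
  "path_sum B s u = (\<Sum>c<B ^ Suc s. of_bool (digit B c 0 = u) *
     (\<Prod>t<s. step_weight (digit B c t) (digit B c (Suc t))) * of_bool (digit B c s = 0))"

lemma sum_lessThan_mult: "(\<Sum>c<n * B. f c) = (\<Sum>c<n. \<Sum>r<B. f (r + c * B))"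
  for f :: "nat \<Rightarrow> 'a :: comm_monoid_add"
proof -
  have "sum f {c * B..<c * B + B} = (\<Sum>r<B. f (r + c * B))" for c
    using sum.shift_bounds_nat_ivl[of f 0 "c * B" B] by (simp add: atLeast0LessThan add.commute)
  then show ?thesis
    using sum.nat_group[of f B n] by simp
qed

lemma path_sum_0: "u < B \<Longrightarrow> path_sum B 0 u = of_bool (u = 0)"
proof -
  assume u: "u < B"
  have "path_sum B 0 u = (\<Sum>c<B. of_bool (c = u) * of_bool (c = 0))"
    unfolding path_sum_def by (simp add: digit_def)
  also have "\<dots> = (\<Sum>c\<in>{u}. of_bool (c = 0))"
    using u by (intro sum.mono_neutral_cong_right) auto
  finally show ?thesis by simp
qed

text \<open>Writing a code as \<open>r + c * B\<close> separates the first vertex \<open>r\<close>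
  from the code \<open>c\<close> of the remaining path, so one more step is one more multiplication
  by the matrix \<open>step_weight\<close>.\<close>

lemma path_sum_Suc:
  assumes u: "u < B"
  shows "path_sum B (Suc s) u = (\<Sum>v<B. step_weight u v * path_sum B s v)"
proof -
  define X where "X = (\<lambda>c. (\<Prod>t<s. step_weight (digit B c t) (digit B c (Suc t))) * of_bool (digit B c s = 0))"
  have d0: "digit B (r + c * B) 0 = r" if "r < B" for r c
    using that by (simp add: digit_def)
  have dS: "digit B (r + c * B) (Suc t) = digit B c t" if "r < B" for r c t
    using that u by (simp add: digit_def div_mult2_eq)
  define Y where "Y = (\<lambda>c. of_bool (digit B c 0 = u) *
     (\<Prod>t<Suc s. step_weight (digit B c t) (digit B c (Suc t))) * of_bool (digit B c (Suc s) = 0))"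
  have "path_sum B (Suc s) u = (\<Sum>c<B ^ Suc s. \<Sum>r<B. Y (r + c * B))"
    unfolding path_sum_def Y_def power_Suc2[of B "Suc s"] by (rule sum_lessThan_mult)
  also have "\<dots> = (\<Sum>c<B ^ Suc s. step_weight u (digit B c 0) * X c)"
  proof (rule sum.cong[OF refl])
    fix c
    have "(\<Sum>r<B. Y (r + c * B))
     = (\<Sum>r<B. of_bool (r = u) * (step_weight r (digit B c 0) * X c))"
      by (intro sum.cong refl) (simp add: d0 dS X_def Y_def prod.lessThan_Suc_shift del: prod.lessThan_Suc)
    also have "\<dots> = (\<Sum>r\<in>{u}. step_weight r (digit B c 0) * X c)"
      using u by (intro sum.mono_neutral_cong_right) auto
    finally show "(\<Sum>r<B. Y (r + c * B))
     = step_weight u (digit B c 0) * X c" by simp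
  qed
  also have "\<dots> = (\<Sum>c<B ^ Suc s. \<Sum>v<B. step_weight u v * (of_bool (digit B c 0 = v) * X c))"
  proof (rule sum.cong[OF refl])
    fix c
    have "(\<Sum>v<B. step_weight u v * (of_bool (digit B c 0 = v) * X c)) = (\<Sum>v\<in>{digit B c 0}. step_weight u v * X c)"
      using u by (intro sum.mono_neutral_cong_right) (auto simp: digit_def)
    then show "step_weight u (digit B c 0) * X c = (\<Sum>v<B. step_weight u v * (of_bool (digit B c 0 = v) * X c))"
      by simp
  qed
  also have "\<dots> = (\<Sum>v<B. step_weight u v * path_sum B s v)"
    unfolding path_sum_def sum_distrib_left
    by (subst sum.swap) (simp only: X_def mult.assoc)
  finally show ?thesis .
qed

text \<open>Paths of nonzero weight descend strictly until they reach 0 and then stay there with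
  weight 1. From \<open>u\<close> this takes at most \<open>u \<le> s\<close> steps, so lengthening
  the paths changes nothing.\<close>

lemma path_sum_eq_asym_coeff: "u \<le> s \<Longrightarrow> u < B \<Longrightarrow> path_sum B s u = asym_coeff u"
proof (induction s arbitrary: u)
  case 0
  then show ?case by (simp add: path_sum_0 asym_coeff_0)
next
  case (Suc s)
  show ?case
  proof (cases "u = 0")
    case True
    have "path_sum B (Suc s) u = (\<Sum>v\<in>{0}. step_weight u v * path_sum B s v)"
      unfolding path_sum_Suc[OF Suc.prems(2)]
      using True Suc.prems by (intro sum.mono_neutral_right) (auto simp: step_weight_def)
    then show ?thesis using True Suc by (simp add: step_weight_def)
  next
    case False
    have "path_sum B (Suc s) u = (\<Sum>v<u. defect_coeff v (u - v) / real u * asym_coeff v)"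
      unfolding path_sum_Suc[OF Suc.prems(2)]
    proof (rule sum.mono_neutral_cong_right)
      fix v assume v: "v \<in> {..<u}"
      then have "path_sum B s v = asym_coeff v" using Suc by simp
      moreover have "u + (1 - u) = u" using False by simp
      ultimately show "step_weight u v * path_sum B s v = defect_coeff v (u - v) / real u * asym_coeff v"
        using v False by (simp add: step_weight_def)
    qed (use Suc.prems False in \<open>auto simp: step_weight_def\<close>)
    also have "\<dots> = asym_coeff u"
      using False by (simp add: asym_coeff.simps[of u] sum_divide_distrib)
    finally show ?thesis .
  qed
qed

lemma creal_step_weight: "creal 2 (\<lambda>xs. step_weight (xs ! 0) (xs ! 1))"
proof -
  have d: "creal 2 (\<lambda>xs. defect_coeff (xs ! 1) (xs ! 0 - xs ! 1))"
    by (rule creal_comp2[OF creal_defect_coeff]) (intro trec_intros; simp)+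
  \<comment> \<open>\<open>u + (1 - u)\<close> is \<open>u\<close> for positive \<open>u\<close> and
    1 for \<open>u = 0\<close>: a denominator must be positive even where the indicator removes the
    term.\<close>
  have r: "creal 2 (\<lambda>xs. of_int 1 / real (xs ! 0 + (1 - xs ! 0)))"
    by (intro creal_ratio irec_const trec_intros) auto
  have "creal 2 (\<lambda>xs. of_bool (xs ! 1 < xs ! 0) * (defect_coeff (xs ! 1) (xs ! 0 - xs ! 1) * (of_int 1 / real (xs ! 0 + (1 - xs ! 0))))
    + of_bool (xs ! 0 + xs ! 1 = 0))"
    by (intro creal_add creal_mult creal_of_bool d r trec_intros) simp_all
  then show ?thesis by (simp add: step_weight_def)
qed

text \<open>Base \<open>i + 1\<close> and length \<open>i\<close> suffice for paths starting at
  \<open>i\<close>, and both are recursive in \<open>i\<close>, which makes the algorithm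
  uniform.\<close>

lemma creal_asym_coeff: "creal 1 (\<lambda>xs. asym_coeff (xs ! 0))"
proof -
  let ?W = "\<lambda>i c t. step_weight (digit (Suc i) c t) (digit (Suc i) c (Suc t))"
  let ?T = "\<lambda>i c. of_bool (digit (Suc i) c 0 = i) * (\<Prod>t<i. ?W i c t) * of_bool (digit (Suc i) c i = 0)"
  have dig: "trec k (\<lambda>xs. digit (Suc (xs ! 0)) (xs ! 1) (f xs))" if "trec k f" "k \<ge> 2" for k f
    unfolding digit_def using that by (intro trec_intros) auto
  have "creal (Suc 2) (\<lambda>xs. ?W (xs ! 0) (xs ! 1) (xs ! 2))"
    by (rule creal_comp2[OF creal_step_weight]) (intro dig trec_intros; simp)+
  from creal_prod[OF this trec_nth[of 0 2]]
  have "creal 2 (\<lambda>xs. \<Prod>t<xs ! 0. ?W ((xs @ [t]) ! 0) ((xs @ [t]) ! 1) ((xs @ [t]) ! 2))" by simp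
  then have prod: "creal 2 (\<lambda>xs. \<Prod>t<xs ! 0. ?W (xs ! 0) (xs ! 1) t)"
    by (rule creal_cong) (simp add: nth_append)
  have "creal 2 (\<lambda>xs. ?T (xs ! 0) (xs ! 1))"
    by (intro creal_mult creal_of_bool prod trec_eq dig trec_const trec_nth) simp_all
  note bin = this[unfolded numeral_2_eq_2]
  have "trec (Suc 0) (\<lambda>xs. Suc (xs ! 0) ^ Suc (xs ! 0))"
    by (intro trec_intros) simp_all
  note creal_sum[OF bin this]
  then have "creal (Suc 0) (\<lambda>xs. path_sum (Suc (xs ! 0)) (xs ! 0) (xs ! 0))"
  proof (rule creal_cong)
    fix xs :: "nat list" assume xs: "length xs = Suc 0"
    then have nth: "(xs @ [c]) ! 0 = xs ! 0" "(xs @ [c]) ! 1 = c" for c by (simp_all add: nth_append)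
    show "(\<Sum>c<Suc (xs ! 0) ^ Suc (xs ! 0). ?T ((xs @ [c]) ! 0) ((xs @ [c]) ! 1)) = path_sum (Suc (xs ! 0)) (xs ! 0) (xs ! 0)"
      by (simp only: path_sum_def nth)
  qed
  then show ?thesis by (simp add: path_sum_eq_asym_coeff)
qed

lemma computable_coeffs: "computable_real_seq (\<lambda>i. leading_coeff * asym_coeff i)"
  using creal_mult[OF creal_const_weaken[OF creal_leading_coeff] creal_asym_coeff]
  by (rule computable_real_seq_creal)

theorem theorem6:
  shows "\<exists>E :: nat \<Rightarrow> real.
    (\<forall>m::nat. \<exists>R :: nat \<Rightarrow> real.
       R \<in> O(\<lambda>n. 1 / real n ^ (m + 1)) \<and>
       (\<forall>n\<ge>1. real (num_labelled_interval_orders n) =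
          (fact n)\<^sup>2 * sqrt (real n) * (6 / pi\<^sup>2) ^ n *
          ((\<Sum>i=0..m. E i / real n ^ i) + R n))) \<and>
    E 0 = 12 * sqrt 3 / pi powr (5 / 2) \<and>
    computable_real_seq E"
proof (rule exI[of _ "\<lambda>i. leading_coeff * asym_coeff i"], intro conjI allI)
  show "leading_coeff * asym_coeff 0 = 12 * sqrt 3 / pi powr (5 / 2)"
    by (simp add: asym_coeff_0 leading_coeff_def)
  show "computable_real_seq (\<lambda>i. leading_coeff * asym_coeff i)"
    by (rule computable_coeffs)
qed (rule num_labelled_interval_orders_expansion)

end
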